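(* Fix $t>0$ and $\lambda=a+ib\in\Lambda_t$. Then $$S(t,\lambda,0):=\lim_{\varepsilon\downarrow0}S(t,\lambda,\varepsilon)=\int_{\mathbb R}\log\big((a-x)^2+v_t(a)^2\big)\,d\mu(x)-\frac{v_t(a)^2-b^2}{t}.$$ In particular $S(t,\cdot,0)$ is real-analytic on $\Lambda_t$, and $$\Delta_\lambda S(t,\lambda,0)=\frac4t\left(1-\frac t2\frac{d}{da}\int_{\mathbb R}\frac{x\,d\mu(x)}{(a-x)^2+v_t(a)^2}\right),$$ which is independent of $b$.
   Context: Let $(\mathcal A,\tau)$ be a $W^*$-probability space with faithful normal tracial state. Let $x_0\in\mathcal A$ be self-adjoint with compactly supported spectral distribution $\mu$, and let $c_t$ be a free circular Brownian motion freely independent from $x_0$. For $t\ge0$, $\lambda\in\mathbb C$, $\varepsilon>0$ put $S(t,\lambda,\varepsilon)=\tau[\log((\lambda-x_0-c_t)^*(\lambda-x_0-c_t)+\varepsilon)]$. For $a\in\mathbb R$ let $v_t(a)=\inf\{b>0:\int\frac{d\mu(x)}{(a-x)^2+b^2}\le\frac1t\}$ and $\Lambda_t=\{a+ib:|b|<v_t(a)\}$; $v_t$ is real-analytic where positive and there satisfies $\int\frac{d\mu(x)}{(a-x)^2+v_t(a)^2}=\frac1t$. $\Delta_\lambda=\partial_a^2+\partial_b^2$. *)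

theory Defs
  imports "HOL-Probability.Probability"
begin

text \<open>An algebra over the complex numbers is modelled by a ring_1 type 'a together with
  a scalar multiplication sm, an involution st and a state tau.\<close>

definition star_prob_space ::
  "(complex \<Rightarrow> 'a::ring_1 \<Rightarrow> 'a) \<Rightarrow> ('a \<Rightarrow> 'a) \<Rightarrow> ('a \<Rightarrow> complex) \<Rightarrow> bool" where
  "star_prob_space sm st tau \<longleftrightarrow>
    (\<forall>z x y. sm z (x + y) = sm z x + sm z y) \<and>
    (\<forall>z w x. sm (z + w) x = sm z x + sm w x) \<and>
    (\<forall>z w x. sm (z * w) x = sm z (sm w x)) \<and>
    (\<forall>x. sm 1 x = x) \<and>
    (\<forall>z x y. sm z (x * y) = sm z x * y \<and> sm z (x * y) = x * sm z y) \<and>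
    (\<forall>x y. st (x + y) = st x + st y) \<and>
    (\<forall>z x. st (sm z x) = sm (cnj z) (st x)) \<and>
    (\<forall>x y. st (x * y) = st y * st x) \<and>
    (\<forall>x. st (st x) = x) \<and>
    (\<forall>x y. tau (x + y) = tau x + tau y) \<and>
    (\<forall>z x. tau (sm z x) = z * tau x) \<and>
    tau 1 = 1 \<and>
    (\<forall>x y. tau (x * y) = tau (y * x)) \<and>
    (\<forall>x. tau (st x) = cnj (tau x)) \<and>
    (\<forall>x. Im (tau (st x * x)) = 0 \<and> Re (tau (st x * x)) \<ge> 0) \<and>
    (\<forall>x. tau (st x * x) = 0 \<longrightarrow> x = 0) \<and>
    (\<forall>x. \<exists>C. \<forall>n. Re (tau ((st x * x) ^ n)) \<le> C ^ n)"

inductive_set star_alg ::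
  "(complex \<Rightarrow> 'a::ring_1 \<Rightarrow> 'a) \<Rightarrow> ('a \<Rightarrow> 'a) \<Rightarrow> 'a set \<Rightarrow> 'a set"
  for sm st S where
  gen: "x \<in> S \<Longrightarrow> x \<in> star_alg sm st S"
| one: "1 \<in> star_alg sm st S"
| add: "x \<in> star_alg sm st S \<Longrightarrow> y \<in> star_alg sm st S \<Longrightarrow> x + y \<in> star_alg sm st S"
| mult: "x \<in> star_alg sm st S \<Longrightarrow> y \<in> star_alg sm st S \<Longrightarrow> x * y \<in> star_alg sm st S"
| smult: "x \<in> star_alg sm st S \<Longrightarrow> sm z x \<in> star_alg sm st S"
| star: "x \<in> star_alg sm st S \<Longrightarrow> st x \<in> star_alg sm st S"

definition free_family :: "('a::ring_1 \<Rightarrow> complex) \<Rightarrow> ('i \<Rightarrow> 'a set) \<Rightarrow> 'i set \<Rightarrow> bool" where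
  "free_family tau A I \<longleftrightarrow>
    (\<forall>is xs. is \<noteq> [] \<and> length xs = length is \<and> set is \<subseteq> I \<and>
       (\<forall>k. Suc k < length is \<longrightarrow> is ! k \<noteq> is ! Suc k) \<and>
       (\<forall>k < length is. xs ! k \<in> A (is ! k) \<and> tau (xs ! k) = 0)
       \<longrightarrow> tau (prod_list xs) = 0)"

text \<open>Number of non-crossing pairings of a word in c (True) and c* (False)
  in which every pair consists of one c and one c*.\<close>

fun ncp :: "bool list \<Rightarrow> nat" where
  "ncp [] = 1"
| "ncp (x # xs) =
     (\<Sum>j\<in>{..<length xs}. if xs ! j \<noteq> x then ncp (take j xs) * ncp (drop (Suc j) xs) else 0)"

definition circular :: "('a::ring_1 \<Rightarrow> complex) \<Rightarrow> ('a \<Rightarrow> 'a) \<Rightarrow> 'a \<Rightarrow> real \<Rightarrow> bool" where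
  "circular tau st c s \<longleftrightarrow>
    (\<forall>w. tau (prod_list (map (\<lambda>b. if b then c else st c) w))
         = complex_of_real (s ^ (length w div 2) * real (ncp w)))"

definition free_circ_BM_free_from ::
  "(complex \<Rightarrow> 'a::ring_1 \<Rightarrow> 'a) \<Rightarrow> ('a \<Rightarrow> 'a) \<Rightarrow> ('a \<Rightarrow> complex) \<Rightarrow> (real \<Rightarrow> 'a) \<Rightarrow> 'a \<Rightarrow> bool" where
  "free_circ_BM_free_from sm st tau c x0 \<longleftrightarrow>
    c 0 = 0 \<and>
    (\<forall>s r. 0 \<le> s \<and> s \<le> r \<longrightarrow> circular tau st (c r - c s) (r - s)) \<and>
    (\<forall>ss::real list. sorted ss \<and> distinct ss \<and> ss \<noteq> [] \<and> hd ss = 0 \<longrightarrow>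
       free_family tau
         (\<lambda>i. case i of None \<Rightarrow> star_alg sm st {x0}
                     | Some k \<Rightarrow> star_alg sm st {c (ss ! Suc k) - c (ss ! k)})
         (insert None (Some ` {k. Suc k < length ss})))"

definition spec_dist :: "('a::ring_1 \<Rightarrow> complex) \<Rightarrow> 'a \<Rightarrow> real measure \<Rightarrow> bool" where
  "spec_dist tau P \<nu> \<longleftrightarrow>
    prob_space \<nu> \<and> sets \<nu> = sets borel \<and>
    (\<exists>R. measure \<nu> {0..R} = 1) \<and>
    (\<forall>n. integrable \<nu> (\<lambda>x. x ^ n) \<and> complex_of_real (\<integral>x. x ^ n \<partial>\<nu>) = tau (P ^ n))"

text \<open>tau[log(P + eps)] via functional calculus = integral against the spectral distribution.\<close>

definition tau_log :: "('a::ring_1 \<Rightarrow> complex) \<Rightarrow> 'a \<Rightarrow> real \<Rightarrow> real" where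
  "tau_log tau P eps = (\<integral>x. ln (x + eps) \<partial>(SOME \<nu>. spec_dist tau P \<nu>))"

definition S_fun ::
  "(complex \<Rightarrow> 'a::ring_1 \<Rightarrow> 'a) \<Rightarrow> ('a \<Rightarrow> 'a) \<Rightarrow> ('a \<Rightarrow> complex) \<Rightarrow> 'a \<Rightarrow> (real \<Rightarrow> 'a)
     \<Rightarrow> real \<Rightarrow> complex \<Rightarrow> real \<Rightarrow> real" where
  "S_fun sm st tau x0 c t lam eps =
     (let T = sm lam 1 - x0 - c t in tau_log tau (st T * T) eps)"

definition v_fun :: "real measure \<Rightarrow> real \<Rightarrow> real \<Rightarrow> real" where
  "v_fun \<mu> t a = Inf {b. b > 0 \<and> (\<integral>x. 1 / ((a - x)\<^sup>2 + b\<^sup>2) \<partial>\<mu>) \<le> 1 / t}"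

definition Lambda_set :: "real measure \<Rightarrow> real \<Rightarrow> complex set" where
  "Lambda_set \<mu> t = {z. \<bar>Im z\<bar> < v_fun \<mu> t (Re z)}"

definition real_analytic_on :: "(complex \<Rightarrow> real) \<Rightarrow> complex set \<Rightarrow> bool" where
  "real_analytic_on f U \<longleftrightarrow>
    (\<forall>z\<in>U. \<exists>r>0. \<exists>c :: nat \<Rightarrow> nat \<Rightarrow> real. \<forall>w\<in>ball z r.
       ((\<lambda>(j, k). c j k * (Re w - Re z) ^ j * (Im w - Im z) ^ k) has_sum f w) UNIV)"

definition laplacian :: "(complex \<Rightarrow> real) \<Rightarrow> complex \<Rightarrow> real" where
  "laplacian f z =
     deriv (deriv (\<lambda>a. f (Complex a (Im z)))) (Re z) +
     deriv (deriv (\<lambda>b. f (Complex (Re z) b))) (Im z)"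

end

theory Submission
  imports Defs "HOL-Complex_Analysis.Complex_Analysis"
begin

text \<open>
  Write \<open>A = \<lambda> - x\<^sub>0\<close>, \<open>T = A - c\<^sub>t\<close> and \<open>P = T\<^sup>* T\<close>. Freeness and circularity give the Schwinger--Dyson
  equation \<open>\<tau>(c\<^sub>t y) = t (\<tau> \<otimes> \<tau>)(\<partial> y)\<close>, where \<open>\<partial>\<close> is the free difference quotient with respect to
  \<open>c\<^sub>t\<^sup>*\<close>: decompose \<open>y\<close> into alternating products of centred elements and note that both sides vanish on
  all of them except those that lie in the algebra of \<open>c\<^sub>t\<close>. It yields recursions for the mixed moments
  \<open>\<tau>(P ^ n (A\<^sup>* A) ^ k)\<close>, which sum up, for large \<open>\<eta>\<close>, to the subordination equation
  \<open>g = w \<integral> d\<mu>(x) / (|\<lambda> - x|\<^sup>2 + w\<^sup>2)\<close> with \<open>w = \<eta> + t g\<close> and \<open>g(\<eta>) = \<eta> \<tau>((P + \<eta>\<^sup>2)\<^sup>-\<^sup>1)\<close>.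
  It persists on the half plane \<open>Re \<eta> > 0\<close> by analytic continuation, and integrating it in \<open>\<eta>\<close> gives
  \<open>\<tau>(log(P + \<eta>\<^sup>2)) = \<integral> log(|\<lambda> - x|\<^sup>2 + w\<^sup>2) d\<mu>(x) - t g\<^sup>2\<close>; as \<open>\<eta> \<rightarrow> 0\<close>, \<open>w\<^sup>2 \<rightarrow> v\<^sub>t(a)\<^sup>2 - b\<^sup>2\<close>.
  The spectral distribution of \<open>P\<close> exists because \<open>\<tau>(P ^ k (1 - P) ^ m) \<ge> 0\<close> after rescaling, so that
  Hausdorff's moment problem is solvable.

  For the regularity, \<open>H(z) = z + t \<integral> d\<mu>(x) / (z - x)\<close> maps \<open>a + i v\<^sub>t(a)\<close> to a real number \<open>r(a)\<close>. Inverting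
  \<open>H\<close> locally shows that \<open>r\<close> is analytic, and the \<open>a\<close>-dependent part of the limit has derivative
  \<open>2 (r(a) - a) / t\<close>, whereas \<open>\<integral> x d\<mu>(x) / ((a - x)\<^sup>2 + v\<^sub>t(a)\<^sup>2) = (2 a - r(a)) / t\<close>.
\<close>

subsection \<open>Tracial *-probability spaces and the Schwinger-Dyson equation\<close>

text \<open>No norm is available: the size of an operator is known only through the moment growth in
  \<open>star_prob_space\<close>, and neither resolvents nor logarithms need exist in the algebra.
  Everything about operators is therefore done with finite moment identities, and analysis starts
  only after passing to measures. This is why the subordination equation is first obtained for large
  \<open>\<eta>\<close>, where the moment series converge. The free difference quotient need not be
  a function of the element, since different words may have the same value. It is carried along as a
  relation between elements and bilinear forms, and the Schwinger-Dyson equation is proved for every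
  pair in that relation. The value of the limit comes from solving subordination for the integral of
  1 / (|\<lambda> - x|^2 + w^2) against \<mu>: it equals (1 - \<eta> / w) / t. As \<eta> tends to 0
  this becomes the equation satisfied by \<open>v_fun\<close>, with solution w^2 = v^2 - b^2, which
  is positive for \<lambda> in \<open>Lambda_set\<close>.\<close>

locale star_prob =
  fixes sm :: "complex \<Rightarrow> 'a::ring_1 \<Rightarrow> 'a" and st :: "'a \<Rightarrow> 'a" and tau :: "'a \<Rightarrow> complex"
  assumes sps: "star_prob_space sm st tau"
begin

lemma sm_add: "sm z (x + y) = sm z x + sm z y"
  and sm_add_left: "sm (z + w) x = sm z x + sm w x"
  and sm_sm: "sm z (sm w x) = sm (z * w) x"
  and sm_one [simp]: "sm 1 x = x"
  and sm_mult_left: "sm z x * y = sm z (x * y)"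
  and sm_mult_right: "x * sm z y = sm z (x * y)"
  and st_add: "st (x + y) = st x + st y"
  and st_sm: "st (sm z x) = sm (cnj z) (st x)"
  and st_mult: "st (x * y) = st y * st x"
  and st_st [simp]: "st (st x) = x"
  and tau_add: "tau (x + y) = tau x + tau y"
  and tau_sm: "tau (sm z x) = z * tau x"
  and tau_one [simp]: "tau 1 = 1"
  and tau_comm: "tau (x * y) = tau (y * x)"
  and tau_st: "tau (st x) = cnj (tau x)"
  and tau_pos_Im [simp]: "Im (tau (st x * x)) = 0"
  and tau_pos: "Re (tau (st x * x)) \<ge> 0"
  using sps unfolding star_prob_space_def by metis+

lemma tau_growth: "\<exists>C. \<forall>n. Re (tau ((st x * x) ^ n)) \<le> C ^ n"
  using sps unfolding star_prob_space_def by metis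

lemma sm_zero_left [simp]: "sm 0 x = 0"
  using sm_add_left[of 0 0 x] by simp

lemma sm_minus_left: "sm (- z) x = - sm z x"
  using sm_add_left[of z "- z" x] by (simp add: eq_neg_iff_add_eq_0 add.commute)

lemma minus_eq_sm: "- x = sm (- 1) x"
  by (simp add: sm_minus_left)

lemma sm_diff: "sm z (x - y) = sm z x - sm z y"
  using sm_add[of z "x - y" y] by simp

lemma tau_zero [simp]: "tau 0 = 0"
  using tau_add[of 0 0] by simp

lemma tau_minus: "tau (- x) = - tau x"
  by (simp add: minus_eq_sm tau_sm)

lemma tau_diff: "tau (x - y) = tau x - tau y"
  using tau_add[of x "- y"] by (simp add: tau_minus)

lemma st_one [simp]: "st 1 = 1"
proof -
  have "st (st 1 * 1) = st 1 * st (st 1)" by (rule st_mult)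
  then show ?thesis by simp
qed

lemma st_minus: "st (- x) = - st x"
  by (simp add: minus_eq_sm st_sm)

lemma st_diff: "st (x - y) = st x - st y"
  using st_add[of x "- y"] by (simp add: st_minus)

lemma st_power: "st (x ^ n) = st x ^ n"
  by (induction n) (simp_all add: st_mult power_commutes)

lemma Cauchy_Schwarz: "(cmod (tau (st x * y)))\<^sup>2 \<le> Re (tau (st x * x)) * Re (tau (st y * y))"
proof -
  define a b d where "a = Re (tau (st x * x))" "b = Re (tau (st y * y))" "d = tau (st x * y)"
  have d': "tau (st y * x) = cnj d"
    unfolding a_b_d_def using tau_st[of "st x * y"] by (simp add: st_mult)
  have ax: "tau (st x * x) = of_real a" and bx: "tau (st y * y) = of_real b"
    by (simp_all add: a_b_d_def complex_eq_iff)
  have pos: "0 \<le> a * (cmod z)\<^sup>2 + 2 * Re (cnj z * d) + b" for z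
  proof -
    have "tau (st (sm z x + y) * (sm z x + y)) =
        z * cnj z * of_real a + cnj z * d + z * cnj d + of_real b"
      by (simp add: st_add st_sm distrib_left distrib_right tau_add tau_sm sm_mult_left sm_mult_right
          ax bx d' sm_sm flip: a_b_d_def)
    moreover have "Re (z * cnj z * of_real a + cnj z * d + z * cnj d + of_real b)
        = a * (cmod z)\<^sup>2 + 2 * Re (cnj z * d) + b"
      unfolding cmod_power2 by (simp add: algebra_simps power2_eq_square)
    ultimately show ?thesis using tau_pos[of "sm z x + y"] by (simp only:)
  qed
  have "a \<ge> 0" "b \<ge> 0" unfolding a_b_d_def by (rule tau_pos)+
  have "(cmod d)\<^sup>2 \<le> a * b"
  proof (cases "a = 0")
    case True
    have "cmod d = 0"
    proof (rule ccontr)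
      assume "cmod d \<noteq> 0"
      then have n: "(cmod d)\<^sup>2 > 0" by simp
      \<comment> \<open>With a = 0 the expression is affine in z, and this z brings it down to - b -
        2.\<close>
      have "0 \<le> 2 * Re (cnj (of_real (- (b + 1) / (cmod d)\<^sup>2) * d) * d) + b"
        using pos[of "of_real (- (b + 1) / (cmod d)\<^sup>2) * d"] True by simp
      moreover have "Re (cnj (of_real (- (b + 1) / (cmod d)\<^sup>2) * d) * d) = - (b + 1)"
      proof -
        have "cnj (of_real (- (b + 1) / (cmod d)\<^sup>2) * d) * d = of_real (- (b + 1) / (cmod d)\<^sup>2) * (d * cnj d)"
          by (simp add: mult_ac)
        also have "\<dots> = of_real (- (b + 1) / (cmod d)\<^sup>2 * (cmod d)\<^sup>2)"
          by (simp only: complex_norm_square[symmetric] of_real_mult)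
        finally show ?thesis using n by simp
      qed
      ultimately show False using \<open>b \<ge> 0\<close> by linarith
    qed
    then show ?thesis using True by simp
  next
    case False
    then have "a > 0" using \<open>a \<ge> 0\<close> by simp
    \<comment> \<open>z = - d / a is the minimiser of the quadratic.\<close>
    have "Re (cnj (of_real (- 1 / a) * d) * d) = - (cmod d)\<^sup>2 / a"
    proof -
      have "cnj (of_real (- 1 / a) * d) * d = of_real (- 1 / a) * (d * cnj d)"
        by (simp add: mult_ac)
      also have "\<dots> = of_real (- 1 / a * (cmod d)\<^sup>2)"
        by (simp only: complex_norm_square[symmetric] of_real_mult)
      finally show ?thesis by (simp only: Re_complex_of_real) simp
    qed
    moreover have "a * (cmod (of_real (- 1 / a) * d))\<^sup>2 = (cmod d)\<^sup>2 / a"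
      using \<open>a > 0\<close> by (simp add: norm_mult norm_divide power_divide power_mult_distrib power2_eq_square)
    ultimately have "0 \<le> b - (cmod d)\<^sup>2 / a"
      using pos[of "of_real (- 1 / a) * d"] by linarith
    then show ?thesis using \<open>a > 0\<close> by (simp add: field_simps)
  qed
  then show ?thesis by (simp add: a_b_d_def)
qed

end

section \<open>Words and their non-crossing pairings\<close>

fun word_value :: "('a::ring_1 \<times> bool) list \<Rightarrow> 'a" where
  "word_value [] = 1"
| "word_value (l # w) = fst l * word_value w"

text \<open>Removing the first letter and its partner leaves two words whose lengths have an odd
  sum, so one of them is odd again.\<close>

lemma ncp_odd: "odd (length w) \<Longrightarrow> ncp w = 0"
proof (induction w rule: ncp.induct)
  case (2 x xs)
  have "ncp (take j xs) * ncp (drop (Suc j) xs) = 0" if "j < length xs" "xs ! j \<noteq> x" for j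
  proof -
    have "odd (length (take j xs)) \<or> odd (length (drop (Suc j) xs))"
      using that 2(3) by auto
    then show ?thesis using 2(1,2) that by (metis lessThan_iff mult_eq_0_iff)
  qed
  then show ?case by (simp add: sum.neutral)
qed simp

text \<open>Lets c and its adjoint exchange roles, so that the locale below can be used with d = c
  as well as with e = c.\<close>

lemma ncp_map_Not: "ncp (map Not w) = ncp w"
proof (induction w rule: ncp.induct)
  case (2 x xs)
  show ?case
    using 2 by (auto simp: take_map drop_map intro!: sum.cong)
qed simp

text \<open>
  The sets \<open>A\<close> and \<open>B\<close> are free unital subalgebras, and \<open>d\<close>, \<open>e\<close> stand for \<open>c\<close> and \<open>c\<^sup>*\<close>
  (or the other way round). A word is a list of letters, each flagged according to whether it is
  an occurrence of \<open>e\<close>. The free difference quotient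
  with respect to \<open>e\<close> is encoded by the bilinear form \<open>(u, v) \<mapsto> (\<tau> \<otimes> \<tau>)(u \<cdot> \<partial>y \<cdot> v)\<close>.
\<close>

locale free_circular = star_prob sm st tau
  for sm :: "complex \<Rightarrow> 'a::ring_1 \<Rightarrow> 'a" and st :: "'a \<Rightarrow> 'a" and tau :: "'a \<Rightarrow> complex" +
  fixes A B :: "'a set" and d e :: 'a and t :: real
  assumes A_one: "1 \<in> A" and A_add: "x \<in> A \<Longrightarrow> y \<in> A \<Longrightarrow> x + y \<in> A"
    and A_mult: "x \<in> A \<Longrightarrow> y \<in> A \<Longrightarrow> x * y \<in> A" and A_sm: "x \<in> A \<Longrightarrow> sm z x \<in> A"
    and B_one: "1 \<in> B" and B_add: "x \<in> B \<Longrightarrow> y \<in> B \<Longrightarrow> x + y \<in> B"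
    and B_mult: "x \<in> B \<Longrightarrow> y \<in> B \<Longrightarrow> x * y \<in> B" and B_sm: "x \<in> B \<Longrightarrow> sm z x \<in> B"
    and d_in: "d \<in> B" and e_in: "e \<in> B"
    and free: "free_family tau (\<lambda>i. if i then A else B) UNIV"
    and circ: "tau (prod_list (map (\<lambda>b. if b then d else e) w))
         = complex_of_real (t ^ (length w div 2) * real (ncp w))"
begin

text \<open>Inductive counterpart of the lists in \<open>free_family\<close>. The flag tells which
  algebra the leftmost factor comes from, \<open>True\<close> standing for \<open>A\<close>.\<close>

inductive alternating :: "bool \<Rightarrow> 'a \<Rightarrow> bool" where
  single: "x \<in> (if i then A else B) \<Longrightarrow> tau x = 0 \<Longrightarrow> alternating i x"
| cons: "x \<in> (if i then A else B) \<Longrightarrow> tau x = 0 \<Longrightarrow> alternating (\<not> i) y \<Longrightarrow> alternating i (x * y)"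

lemma alternating_A: "a \<in> A \<Longrightarrow> tau a = 0 \<Longrightarrow> alternating False y \<Longrightarrow> alternating True (a * y)"
  and alternating_B: "b \<in> B \<Longrightarrow> tau b = 0 \<Longrightarrow> alternating True y \<Longrightarrow> alternating False (b * y)"
  using alternating.cons[of a True y] alternating.cons[of b False y] by auto

lemma alternating_list:
  assumes "alternating i x"
  shows "\<exists>is xs. is \<noteq> [] \<and> hd is = i \<and> length xs = length is \<and>
       (\<forall>k. Suc k < length is \<longrightarrow> is ! k \<noteq> is ! Suc k) \<and>
       (\<forall>k < length is. xs ! k \<in> (if is ! k then A else B) \<and> tau (xs ! k) = 0) \<and> prod_list xs = x"
  using assms
proof induction
  case (single x i)
  then show ?case by (intro exI[of _ "[i]"] exI[of _ "[x]"]) simp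
next
  case (cons x i y)
  then obtain js ys where *: "js \<noteq> []" "hd js = (\<not> i)" "length ys = length js"
       "\<And>k. Suc k < length js \<Longrightarrow> js ! k \<noteq> js ! Suc k"
       "\<And>k. k < length js \<Longrightarrow> ys ! k \<in> (if js ! k then A else B) \<and> tau (ys ! k) = 0" "prod_list ys = y"
    by blast
  have 1: "(i # js) ! k \<noteq> (i # js) ! Suc k" if "Suc k < length (i # js)" for k
    using that * by (cases k) (auto simp: hd_conv_nth)
  have 2: "(x # ys) ! k \<in> (if (i # js) ! k then A else B) \<and> tau ((x # ys) ! k) = 0"
    if "k < length (i # js)" for k
    using that * cons by (cases k) auto
  show ?case
    using 1 2 * by (intro exI[of _ "i # js"] exI[of _ "x # ys"]) auto
qed

lemma tau_alternating: assumes "alternating i x" shows "tau x = 0"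
proof -
  from alternating_list[OF assms] obtain js xs where *: "js \<noteq> []" "length xs = length js"
       "(\<forall>k. Suc k < length js \<longrightarrow> js ! k \<noteq> js ! Suc k)"
       "(\<forall>k < length js. xs ! k \<in> (if js ! k then A else B) \<and> tau (xs ! k) = 0)" "prod_list xs = x"
    by blast
  then show ?thesis
    using free unfolding free_family_def by blast
qed

section \<open>Difference quotients of words\<close>

fun diff_quot :: "('a \<times> bool) list \<Rightarrow> 'a \<Rightarrow> 'a \<Rightarrow> complex" where
  "diff_quot [] u v = 0"
| "diff_quot (l # w) u v = (if snd l then tau u * tau (word_value w * v) else 0) + diff_quot w (u * fst l) v"

lemma word_value_append: "word_value (w @ w') = word_value w * word_value w'"
  by (induction w) (simp_all add: mult.assoc)

lemma diff_quot_append: "diff_quot (w @ w') u v = diff_quot w u (word_value w' * v) + diff_quot w' (u * word_value w) v"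
  by (induction w arbitrary: u) (simp_all add: word_value_append mult.assoc)

text \<open>A relation rather than a map: the same element may be written by several combinations of
  words, and each carries its own form.\<close>

inductive word_span :: "'a \<Rightarrow> ('a \<Rightarrow> 'a \<Rightarrow> complex) \<Rightarrow> bool" where
  word: "set w \<subseteq> {(d, False), (e, True)} \<Longrightarrow> word_span (word_value w) (diff_quot w)"
| add: "word_span y D \<Longrightarrow> word_span y' D' \<Longrightarrow> word_span (y + y') (\<lambda>u v. D u v + D' u v)"
| scale: "word_span y D \<Longrightarrow> word_span (sm z y) (\<lambda>u v. z * D u v)"

lemma word_span_cong: "word_span y D \<Longrightarrow> y = y' \<Longrightarrow> (\<And>u v. D u v = D' u v) \<Longrightarrow> word_span y' D'"
  by (metis ext)

lemma word_value_B: "set w \<subseteq> {(d, False), (e, True)} \<Longrightarrow> word_value w \<in> B"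
  by (induction w) (auto simp: B_one B_mult d_in e_in)

lemma word_span_B: "word_span y D \<Longrightarrow> y \<in> B"
  by (induction rule: word_span.induct) (auto simp: B_add B_sm word_value_B)

text \<open>In each term the left leg is \<open>u\<close> times a prefix of the word, and prefixes
  lie in \<open>B\<close>.\<close>

lemma diff_quot_left_zero:
  assumes "set w \<subseteq> {(d, False), (e, True)}" "\<And>b. b \<in> B \<Longrightarrow> tau (u * b) = 0"
  shows "diff_quot w u v = 0"
  using assms
proof (induction w arbitrary: u)
  case (Cons l w)
  have "fst l \<in> B" using Cons.prems(1) by (auto simp: d_in e_in)
  then have "diff_quot w (u * fst l) v = 0"
    using Cons.prems by (intro Cons.IH) (auto simp: mult.assoc B_mult)
  moreover have "tau u = 0" using Cons.prems(2)[OF B_one] by simp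
  ultimately show ?case by simp
qed simp

lemma diff_quot_right_zero:
  assumes "set w \<subseteq> {(d, False), (e, True)}" "\<And>b. b \<in> B \<Longrightarrow> tau (b * v) = 0"
  shows "diff_quot w u v = 0"
  using assms by (induction w arbitrary: u) (auto simp: word_value_B)

lemma word_span_left_zero: "word_span y D \<Longrightarrow> (\<And>b. b \<in> B \<Longrightarrow> tau (u * b) = 0) \<Longrightarrow> D u v = 0"
  by (induction rule: word_span.induct) (auto simp: diff_quot_left_zero)

lemma word_span_right_zero: "word_span y D \<Longrightarrow> (\<And>b. b \<in> B \<Longrightarrow> tau (b * v) = 0) \<Longrightarrow> D u v = 0"
  by (induction rule: word_span.induct) (auto simp: diff_quot_right_zero)

lemma diff_quot_lin_left:
  "diff_quot w (u + u') v = diff_quot w u v + diff_quot w u' v" "diff_quot w (sm z u) v = z * diff_quot w u v"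
  by (induction w arbitrary: u u') (auto simp: tau_add tau_sm sm_mult_left algebra_simps)

lemma diff_quot_lin_right:
  "diff_quot w u (v + v') = diff_quot w u v + diff_quot w u v'" "diff_quot w u (sm z v) = z * diff_quot w u v"
  by (induction w arbitrary: u) (auto simp: tau_add tau_sm sm_mult_right algebra_simps)

lemma word_span_lin:
  assumes "word_span y D"
  shows "D (u + u') v = D u v + D u' v" "D (sm z u) v = z * D u v"
    "D u (v + v') = D u v + D u v'" "D u (sm z v) = z * D u v"
  using assms by (induction rule: word_span.induct) (auto simp: diff_quot_lin_left diff_quot_lin_right algebra_simps)

lemma word_span_scalar: "word_span (sm z 1) (\<lambda>u v. 0)"
  by (rule word_span_cong[OF word_span.scale[OF word_span.word[of "[]"], of z]]) auto

lemma word_span_center: "word_span y D \<Longrightarrow> word_span (y - sm z 1) D"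
  by (rule word_span_cong[OF word_span.add[OF _ word_span_scalar[of "- z"]]]) (auto simp: sm_minus_left)

text \<open>Leibniz rule: a cut inside \<open>y\<close> leaves \<open>y'\<close> on its right, a cut
  inside \<open>y'\<close> leaves \<open>y\<close> on its left.\<close>

lemma word_span_mult:
  assumes "word_span y D" "word_span y' D'"
  shows "word_span (y * y') (\<lambda>u v. D u (y' * v) + D' (u * y) v)"
  using assms(1)
proof induction
  case (word w)
  from assms(2) show ?case
  proof induction
    case (word w')
    show ?case
      by (rule word_span_cong[OF word_span.word[of "w @ w'"]]) (use word \<open>set w \<subseteq> _\<close> in \<open>auto simp: word_value_append diff_quot_append\<close>)
  next
    case (add y D y' D')
    show ?case
      by (rule word_span_cong[OF word_span.add[OF add.IH]]) (auto simp: distrib_left distrib_right diff_quot_lin_right)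
  next
    case (scale y D z)
    show ?case
      by (rule word_span_cong[OF word_span.scale[OF scale.IH, of z]])
        (auto simp: sm_mult_right sm_mult_left distrib_left diff_quot_lin_right)
  qed
next
  case (add y1 D1 y2 D2)
  show ?case
    by (rule word_span_cong[OF word_span.add[OF add.IH]]) (auto simp: distrib_left distrib_right word_span_lin[OF assms(2)])
next
  case (scale y D z)
  show ?case
    by (rule word_span_cong[OF word_span.scale[OF scale.IH, of z]])
      (auto simp: sm_mult_right sm_mult_left distrib_left word_span_lin[OF assms(2)])
qed

lemma circ_word:
  assumes "set w \<subseteq> {(d, False), (e, True)}"
  shows "tau (word_value w) = of_real (t ^ (length w div 2) * real (ncp (map (\<lambda>l. \<not> snd l) w)))"
proof -
  have "word_value w = prod_list (map (\<lambda>b. if b then d else e) (map (\<lambda>l. \<not> snd l) w))"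
    using assms by (induction w) auto
  then show ?thesis using circ[of "map (\<lambda>l. \<not> snd l) w"] by simp
qed

text \<open>One summand per cut, in the shape of the recursion for \<open>ncp\<close>.\<close>

lemma diff_quot_eq_sum:
  "diff_quot w u v = (\<Sum>j<length w. if snd (w ! j) then tau (u * word_value (take j w)) * tau (word_value (drop (Suc j) w) * v) else 0)"
proof (induction w arbitrary: u)
  case (Cons l w)
  show ?case
    by (auto simp add: Cons.IH sum.lessThan_Suc_shift mult.assoc simp del: sum.lessThan_Suc intro!: sum.cong)
qed simp

text \<open>In a non-crossing pairing the leading \<open>d\<close> has some later \<open>e\<close>
  as partner, and this pair separates the rest into the two pieces between which the difference
  quotient cuts.\<close>

lemma word_span_good: "word_span y D \<Longrightarrow> tau (d * y) = complex_of_real t * D 1 1"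
proof (induction rule: word_span.induct)
  case (word w)
  define s where "s = map (\<lambda>l. \<not> snd l) w"
  have "tau (d * word_value w) = tau (word_value ((d, False) # w))" by simp
  also have "\<dots> = of_real (t ^ (Suc (length w) div 2) * real (ncp (True # s)))"
    by (subst circ_word) (use word in \<open>auto simp: s_def\<close>)
  also have "\<dots> = (\<Sum>j<length w. of_real (t ^ (Suc (length w) div 2) *
     (if snd (w ! j) then real (ncp (take j s)) * real (ncp (drop (Suc j) s)) else 0)))"
    by (auto simp: s_def sum_distrib_left intro!: sum.cong)
  also have "\<dots> = (\<Sum>j<length w. t * (if snd (w ! j) then tau (word_value (take j w)) * tau (word_value (drop (Suc j) w)) else 0))"
  proof (rule sum.cong)
    fix j assume "j \<in> {..<length w}"
    then have j: "j < length w" by simp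
    have s1: "set (take j w) \<subseteq> {(d, False), (e, True)}" "set (drop (Suc j) w) \<subseteq> {(d, False), (e, True)}"
      using word by (auto dest: in_set_takeD in_set_dropD)
    show "of_real (t ^ (Suc (length w) div 2) *
        (if snd (w ! j) then real (ncp (take j s)) * real (ncp (drop (Suc j) s)) else 0)) =
      t * (if snd (w ! j) then tau (word_value (take j w)) * tau (word_value (drop (Suc j) w)) else 0)"
    \<comment> \<open>The exponents of \<open>t\<close> add up only if both pieces have even length.
      Otherwise one of the pieces has no pairing, and both sides are 0.\<close>
    proof (cases "even j \<and> even (length w - Suc j)")
      case True
      then have "Suc (length w) div 2 = Suc (j div 2 + (length w - Suc j) div 2)"
      proof -
        obtain a b where "j = 2 * a" "length w - Suc j = 2 * b"
          using True by (meson evenE)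
        moreover from this have "length w = Suc (2 * a + 2 * b)" using j by simp
        ultimately show ?thesis by simp
      qed
      then show ?thesis using j
        by (auto simp: circ_word[OF s1(1)] circ_word[OF s1(2)] s_def take_map drop_map power_add)
    next
      case False
      then have "ncp (take j s) = 0 \<or> ncp (drop (Suc j) s) = 0"
        using j ncp_odd[of "take j s"] ncp_odd[of "drop (Suc j) s"] by (cases "even j") (auto simp add: s_def)
      then show ?thesis
        by (auto simp: circ_word[OF s1(1)] circ_word[OF s1(2)] s_def take_map drop_map)
    qed
  qed simp
  also have "\<dots> = t * diff_quot w 1 1"
    by (simp add: diff_quot_eq_sum sum_distrib_left cong: if_cong)
  finally show ?case .
qed (simp_all add: distrib_left tau_add sm_mult_right tau_sm)

text \<open>Refines \<open>alternating\<close> by the Leibniz rule: factors from \<open>A\<close>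
  have derivative 0, factors from \<open>B\<close> bring the form attached to them by
  \<open>word_span\<close>.\<close>

inductive normal_form :: "bool \<Rightarrow> 'a \<Rightarrow> ('a \<Rightarrow> 'a \<Rightarrow> complex) \<Rightarrow> bool" where
  A1: "a \<in> A \<Longrightarrow> tau a = 0 \<Longrightarrow> normal_form True a (\<lambda>u v. 0)"
| B1: "word_span b D \<Longrightarrow> tau b = 0 \<Longrightarrow> normal_form False b D"
| A2: "a \<in> A \<Longrightarrow> tau a = 0 \<Longrightarrow> normal_form False y D \<Longrightarrow> normal_form True (a * y) (\<lambda>u v. D (u * a) v)"
| B2: "word_span b Db \<Longrightarrow> tau b = 0 \<Longrightarrow> normal_form True y D \<Longrightarrow> normal_form False (b * y) (\<lambda>u v. Db u (y * v) + D (u * b) v)"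

lemma normal_form_alternating: "normal_form i y D \<Longrightarrow> alternating i y"
  by (induction rule: normal_form.induct) (auto intro: alternating.intros simp: word_span_B)

text \<open>Centring \<open>b\<close> splits \<open>b * y\<close> into an alternating product and a
  multiple of \<open>y\<close>, both of trace 0.\<close>

lemma tau_mult_B_alternating:
  assumes "b \<in> B" "alternating True y"
  shows "tau (b * y) = 0"
proof -
  have "b - sm (tau b) 1 \<in> B"
    using B_add[OF assms(1) B_sm[OF B_one, of "- tau b"]] by (simp add: sm_minus_left)
  then have "alternating False ((b - sm (tau b) 1) * y)"
    by (intro alternating.cons) (auto simp: assms tau_diff tau_sm)
  from tau_alternating[OF this] show ?thesis
    by (simp add: left_diff_distrib tau_diff sm_mult_left tau_sm tau_alternating[OF assms(2)])
qed

text \<open>Every left leg is \<open>u\<close> times an initial piece of the product. If that piece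
  ends inside a factor from \<open>B\<close>, it need not be centred there, which is why
  \<open>tau u = 0\<close> is demanded when the product begins in \<open>B\<close>.\<close>

lemma normal_form_left_zero:
  "normal_form i y D \<Longrightarrow> (\<And>m. alternating i m \<Longrightarrow> tau (u * m) = 0) \<Longrightarrow> (\<not> i \<longrightarrow> tau u = 0) \<Longrightarrow> D u v = 0"
proof (induction arbitrary: u v rule: normal_form.induct)
  case (B1 b D)
  show ?case
  proof (rule word_span_left_zero[OF B1(1)])
    fix b assume "b \<in> B"
    then have "alternating False (b - sm (tau b) 1)"
      using B_add[OF _ B_sm[OF B_one, of "- tau b"]]
      by (intro alternating.single) (auto simp: tau_diff tau_sm sm_minus_left)
    from B1(3)[OF this] B1(4) show "tau (u * b) = 0"
      by (simp add: right_diff_distrib tau_diff sm_mult_right tau_sm)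
  qed
next
  case (A2 a y D)
  show ?case
  proof (rule A2.IH)
    show "tau (u * a * m) = 0" if "alternating False m" for m
      using A2.prems(1)[of "a * m"] that A2.hyps by (auto intro: alternating_A simp: mult.assoc)
    show "\<not> False \<longrightarrow> tau (u * a) = 0"
      using A2.prems(1)[of a] A2.hyps alternating.single[of a True] by auto
  qed
next
  case (B2 b Db y D)
  have "Db u (y * v) = 0"
  proof (rule word_span_left_zero[OF B2(1)])
    fix b assume "b \<in> B"
    then have "alternating False (b - sm (tau b) 1)"
      using B_add[OF _ B_sm[OF B_one, of "- tau b"]]
      by (intro alternating.single) (auto simp: tau_diff tau_sm sm_minus_left)
    from B2.prems(1)[OF this] B2.prems(2) show "tau (u * b) = 0"
      by (simp add: right_diff_distrib tau_diff sm_mult_right tau_sm)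
  qed
  moreover have "D (u * b) v = 0"
  proof (rule B2.IH)
    show "tau (u * b * m) = 0" if "alternating True m" for m
      using B2.prems(1)[of "b * m"] that B2.hyps by (simp add: alternating_B mult.assoc word_span_B)
  qed simp
  ultimately show ?case by simp
qed simp

text \<open>Only a single factor from \<open>B\<close> gives a nontrivial equation. In all other
  cases \<open>d * y\<close> has trace 0 and every cut produces a leg of trace 0.\<close>

lemma normal_form_good: "normal_form i y D \<Longrightarrow> tau (d * y) = complex_of_real t * D 1 1"
proof -
  have d0: "tau d = 0" using circ[of "[True]"] by simp
  assume nf: "normal_form i y D"
  then show ?thesis
  proof cases
    case (B1)
    then show ?thesis by (simp add: word_span_good)
  next
    case (B2 b Db y' D')
    have y': "alternating True y'" using B2 normal_form_alternating by blast
    have "tau (d * (b * y')) = 0"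
      using tau_mult_B_alternating[OF B_mult[OF d_in word_span_B[OF B2(4)]] y'] by (simp add: mult.assoc)
    \<comment> \<open>A cut in the first factor leaves an element of \<open>B\<close> times an
      alternating product on the right; a cut further on, treated next, has the alternating product
      on the left.\<close>
    moreover have "Db 1 (y' * 1) = 0"
      by (rule word_span_right_zero[OF B2(4)]) (simp add: tau_mult_B_alternating y')
    moreover have "D' (1 * b) 1 = 0"
      by (rule normal_form_left_zero[OF B2(6)]) (auto intro: tau_mult_B_alternating word_span_B[OF B2(4)])
    ultimately show ?thesis using B2 by simp
  next
    case A1
    then show ?thesis using normal_form_alternating[OF nf] tau_mult_B_alternating[OF d_in] by simp
  next
    case A2
    then have "D 1 1 = 0"
      by (intro normal_form_left_zero[OF nf]) (auto simp: tau_alternating)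
    moreover have "alternating True y" using normal_form_alternating[OF nf] A2 by simp
    ultimately show ?thesis using tau_mult_B_alternating[OF d_in] by simp
  qed
qed

inductive normal_span :: "'a \<Rightarrow> ('a \<Rightarrow> 'a \<Rightarrow> complex) \<Rightarrow> bool" where
  one: "normal_span 1 (\<lambda>u v. 0)"
| normal_form: "normal_form i y D \<Longrightarrow> normal_span y D"
| add: "normal_span y D \<Longrightarrow> normal_span y' D' \<Longrightarrow> normal_span (y + y') (\<lambda>u v. D u v + D' u v)"
| scale: "normal_span y D \<Longrightarrow> normal_span (sm z y) (\<lambda>u v. z * D u v)"

lemma normal_span_cong: "normal_span y D \<Longrightarrow> y = y' \<Longrightarrow> (\<And>u v. D u v = D' u v) \<Longrightarrow> normal_span y' D'"
  by (metis ext)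

theorem Schwinger_Dyson: "normal_span y D \<Longrightarrow> tau (d * y) = complex_of_real t * D 1 1"
proof (induction rule: normal_span.induct)
  case one
  show ?case using circ[of "[True]"] by simp
qed (simp_all add: normal_form_good distrib_left tau_add sm_mult_right tau_sm)

section \<open>Closure of the normal forms under multiplication\<close>

lemma normal_form_lin:
  assumes "normal_form i y D"
  shows "D (u + u') v = D u v + D u' v" "D (sm z u) v = z * D u v"
  using assms
  by (induction arbitrary: u u' rule: normal_form.induct)
    (auto simp: word_span_lin distrib_right distrib_left sm_mult_left)

lemma normal_form_lin_diff:
  assumes "normal_form i y D"
  shows "D (u - sm z u') v = D u v - z * D u' v"
  using normal_form_lin(1)[OF assms, where u = u and u' = "sm (-z) u'" and v = v]
    normal_form_lin(2)[OF assms, where z = "-z" and u = u' and v = v] by (simp add: sm_minus_left)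

lemma A_center: "a \<in> A \<Longrightarrow> a - sm z 1 \<in> A"
  using A_add[OF _ A_sm[OF A_one, of "- z"]] by (simp add: sm_minus_left)

lemma normal_span_A: assumes "a \<in> A" shows "normal_span a (\<lambda>u v. 0)"
proof -
  have "normal_span (a - sm (tau a) 1) (\<lambda>u v. 0)"
    by (intro normal_span.normal_form[OF normal_form.A1] A_center assms) (simp add: tau_diff tau_sm)
  from normal_span.add[OF this normal_span.scale[OF normal_span.one, of "tau a"]] show ?thesis by simp
qed

lemma normal_span_word_span: assumes "word_span b D" shows "normal_span b D"
proof -
  have "normal_span (b - sm (tau b) 1) D"
    by (intro normal_span.normal_form[OF normal_form.B1] word_span_center assms) (simp add: tau_diff tau_sm)
  from normal_span.add[OF this normal_span.scale[OF normal_span.one, of "tau b"]] show ?thesis by simp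
qed

text \<open>The new factor need not be centred: subtracting its trace gives a longer normal form,
  and the trace itself a multiple of the old one.\<close>

lemma normal_span_A_mult_normal_form:
  assumes "a \<in> A" "normal_form False y D"
  shows "normal_span (a * y) (\<lambda>u v. D (u * a) v)"
proof -
  have "normal_span ((a - sm (tau a) 1) * y) (\<lambda>u v. D (u * (a - sm (tau a) 1)) v)"
    by (intro normal_span.normal_form[OF normal_form.A2] A_center assms) (simp add: tau_diff tau_sm)
  from normal_span.add[OF this normal_span.scale[OF normal_span.normal_form[OF assms(2)], of "tau a"]] show ?thesis
    by (rule normal_span_cong)
      (simp_all add: left_diff_distrib sm_mult_left right_diff_distrib sm_mult_right normal_form_lin_diff[OF assms(2)])
qed

lemma normal_span_word_span_mult_normal_form:
  assumes "word_span b Db" "normal_form True y D"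
  shows "normal_span (b * y) (\<lambda>u v. Db u (y * v) + D (u * b) v)"
proof -
  have "normal_span ((b - sm (tau b) 1) * y) (\<lambda>u v. Db u (y * v) + D (u * (b - sm (tau b) 1)) v)"
    by (intro normal_span.normal_form[OF normal_form.B2] word_span_center assms) (simp add: tau_diff tau_sm)
  from normal_span.add[OF this normal_span.scale[OF normal_span.normal_form[OF assms(2)], of "tau b"]] show ?thesis
    by (rule normal_span_cong)
      (simp_all add: left_diff_distrib sm_mult_left right_diff_distrib sm_mult_right normal_form_lin_diff[OF assms(2)])
qed

lemma normal_span_A_mult: "normal_span y D \<Longrightarrow> a \<in> A \<Longrightarrow> normal_span (a * y) (\<lambda>u v. D (u * a) v)"
proof (induction rule: normal_span.induct)
  case one
  then show ?case by (simp add: normal_span_A)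
next
  case (normal_form i y D)
  from normal_form(1) show ?case
  proof cases
    case (A1)
    then show ?thesis using normal_span_A[OF A_mult[OF normal_form(2)]] by simp
  next
    case (A2 a' y' D')
    show ?thesis
      using normal_span_A_mult_normal_form[OF A_mult[OF normal_form(2) A2(4)] A2(6)] A2 by (simp add: mult.assoc)
  next
    case B1
    then show ?thesis using normal_form by (auto intro: normal_span_A_mult_normal_form)
  next
    case B2
    then show ?thesis using normal_form by (auto intro: normal_span_A_mult_normal_form)
  qed
next
  case (add y D y' D')
  then show ?case by (auto simp: distrib_left intro: normal_span.add)
next
  case (scale y D z)
  then show ?case by (auto simp: sm_mult_right intro: normal_span.scale)
qed

lemma normal_span_word_span_mult: "normal_span y D \<Longrightarrow> word_span b Db \<Longrightarrow> normal_span (b * y) (\<lambda>u v. Db u (y * v) + D (u * b) v)"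
proof (induction rule: normal_span.induct)
  case one
  then show ?case by (simp add: normal_span_word_span)
next
  case (normal_form i y D)
  from normal_form(1) show ?case
  proof cases
    case B1
    then show ?thesis using normal_span_word_span[OF word_span_mult[OF normal_form(2), of y D]] by simp
  next
    case (B2 b' Db' y' D')
    show ?thesis
      by (rule normal_span_cong[OF normal_span_word_span_mult_normal_form[OF word_span_mult[OF normal_form(2) B2(4)] B2(6)]])
        (use B2 in \<open>simp_all add: mult.assoc\<close>)
  next
    case A1
    then show ?thesis using normal_form normal_span_word_span_mult_normal_form[OF normal_form(2), of y D] by simp
  next
    case A2
    then show ?thesis using normal_form by (auto intro: normal_span_word_span_mult_normal_form)
  qed
next
  case (add y D y' D')
  show ?case
    by (rule normal_span_cong[OF normal_span.add[OF add.IH[OF add.prems]]])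
      (auto simp: distrib_left distrib_right word_span_lin[OF add.prems])
next
  case (scale y D z)
  show ?case
    by (rule normal_span_cong[OF normal_span.scale[OF scale.IH[OF scale.prems], of z]])
      (auto simp: sm_mult_right sm_mult_left distrib_left word_span_lin[OF scale.prems])
qed

lemma normal_span_d_mult: "normal_span y D \<Longrightarrow> normal_span (d * y) (\<lambda>u v. D (u * d) v)"
  using normal_span_word_span_mult[of y D d, OF _ word_span_cong[OF word_span.word[of "[(d, False)]"], of d "\<lambda>u v. 0"]] by simp

lemma normal_span_e_mult: "normal_span y D \<Longrightarrow> normal_span (e * y) (\<lambda>u v. tau u * tau (y * v) + D (u * e) v)"
  using normal_span_word_span_mult[of y D e, OF _ word_span_cong[OF word_span.word[of "[(e, True)]"], of e "\<lambda>u v. tau u * tau v"]] by simp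

lemma normal_span_lin:
  assumes "normal_span y D"
  shows "D (u + u') v = D u v + D u' v" "D (sm z u) v = z * D u v"
  using assms by (induction rule: normal_span.induct) (auto simp: normal_form_lin algebra_simps)

lemma normal_span_lin_diff:
  assumes "normal_span y D"
  shows "D (u - u') v = D u v - D u' v"
  using normal_span_lin(1)[OF assms, where v = v and u = u and u' = "sm (-1) u'"] normal_span_lin(2)[OF assms, where z = "-1" and u = u' and v = v] by (simp add: sm_minus_left)

lemma normal_span_minus_d_mult:
  assumes "normal_span y D" "a \<in> A"
  shows "normal_span ((a - d) * y) (\<lambda>u v. D (u * (a - d)) v)"
  by (rule normal_span_cong[OF normal_span.add[OF normal_span_A_mult[OF assms] normal_span.scale[OF normal_span_d_mult[OF assms(1)], of "-1"]]])
    (simp_all add: sm_minus_left left_diff_distrib right_diff_distrib normal_span_lin_diff[OF assms(1)])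

text \<open>The derivative of \<open>a - e\<close> is minus the elementary tensor of two units: the
  cut at this factor leaves \<open>u\<close> on the left and \<open>y * v\<close> on the
  right.\<close>

lemma normal_span_minus_e_mult:
  assumes "normal_span y D" "a \<in> A"
  shows "normal_span ((a - e) * y) (\<lambda>u v. D (u * (a - e)) v - tau u * tau (y * v))"
  by (rule normal_span_cong[OF normal_span.add[OF normal_span_A_mult[OF assms] normal_span.scale[OF normal_span_e_mult[OF assms(1)], of "-1"]]])
    (simp_all add: sm_minus_left left_diff_distrib right_diff_distrib normal_span_lin_diff[OF assms(1)])

text \<open>Each of the n occurrences of \<open>a' - e\<close> is one cut. The k-th has k full
  factors on its left, and the remainder on its right begins with \<open>a - d\<close>.\<close>

lemma normal_span_power_ed:
  assumes "a \<in> A" "a' \<in> A" "f \<in> A"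
  shows "normal_span (((a' - e) * (a - d)) ^ n * f)
    (\<lambda>u v. - (\<Sum>k<n. tau (u * ((a' - e) * (a - d)) ^ k) *
        tau ((a - d) * ((a' - e) * (a - d)) ^ (n - Suc k) * f * v)))"
proof (induction n)
  case 0
  show ?case using normal_span_A[OF assms(3)] by simp
next
  case (Suc n)
  show ?case
    by (rule normal_span_cong[OF normal_span_minus_e_mult[OF normal_span_minus_d_mult[OF Suc assms(1)] assms(2)]])
      (simp_all add: mult.assoc sum.lessThan_Suc_shift del: sum.lessThan_Suc)
qed

lemma normal_span_power_de:
  assumes "a \<in> A" "a' \<in> A" "f \<in> A"
  shows "normal_span (((a' - d) * (a - e)) ^ n * f)
    (\<lambda>u v. - (\<Sum>k<n. tau (u * ((a' - d) * (a - e)) ^ k * (a' - d)) *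
        tau (((a' - d) * (a - e)) ^ (n - Suc k) * f * v)))"
proof (induction n)
  case 0
  show ?case using normal_span_A[OF assms(3)] by simp
next
  case (Suc n)
  show ?case
    by (rule normal_span_cong[OF normal_span_minus_d_mult[OF normal_span_minus_e_mult[OF Suc assms(1)] assms(2)]])
      (simp_all add: mult.assoc sum.lessThan_Suc_shift del: sum.lessThan_Suc)
qed

section \<open>Moment identities for powers of the product\<close>

lemma moment_ed:
  assumes "a \<in> A" "a' \<in> A" "f \<in> A"
  defines "P \<equiv> (a' - e) * (a - d)"
  shows "tau (d * (P ^ n * f)) = - t * (\<Sum>k<n. tau (P ^ k) * tau ((a - d) * P ^ (n - Suc k) * f))"
  using Schwinger_Dyson[OF normal_span_power_ed[OF assms(1-3)], of n] by (simp add: P_def)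

lemma moment_de:
  assumes "a \<in> A" "a' \<in> A" "f \<in> A"
  defines "P \<equiv> (a' - d) * (a - e)"
  shows "tau (d * ((a - e) * P ^ n * f)) = - t * (\<Sum>k\<le>n. tau (P ^ k) * tau (P ^ (n - k) * f))"
proof -
  have "tau (d * ((a - e) * (P ^ n * f))) =
      t * (- (\<Sum>k<n. tau (1 * (a - e) * P ^ k * (a' - d)) * tau (P ^ (n - Suc k) * f * 1))
         - tau 1 * tau (P ^ n * f * 1))"
    using Schwinger_Dyson[OF normal_span_minus_e_mult[OF normal_span_power_de[OF assms(1-3), of n] assms(1)]]
    by (simp add: P_def)
  \<comment> \<open>By traciality the trailing \<open>a' - d\<close> moves to the front and
    completes one more power. The cut at the leading \<open>a - e\<close> then supplies the summand
    k = 0.\<close>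
  also have "tau (1 * (a - e) * P ^ k * (a' - d)) = tau (P ^ Suc k)" for k
    using tau_comm[of "(a - e) * P ^ k" "a' - d"] by (simp add: P_def mult.assoc)
  then have "(\<Sum>k<n. tau (1 * (a - e) * P ^ k * (a' - d)) * tau (P ^ (n - Suc k) * f * 1)) =
     (\<Sum>k<n. tau (P ^ Suc k) * tau (P ^ (n - Suc k) * f))"
    by simp
  also have "t * (- \<dots> - tau 1 * tau (P ^ n * f * 1)) = - t * (\<Sum>k<Suc n. tau (P ^ k) * tau (P ^ (n - k) * f))"
    by (simp add: sum.lessThan_Suc_shift algebra_simps del: sum.lessThan_Suc power_Suc)
  finally show ?thesis by (simp add: mult.assoc lessThan_Suc_atMost)
qed

end

subsection \<open>Hausdorff's moment problem\<close>

text \<open>Falling factorials are preferred to (j / N)^n because the Bernstein weights integrate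
  their ratio exactly.\<close>

lemma binomial_falling_ratio:
  assumes "j \<le> N" "n \<le> N"
  shows "real (N choose j) * (\<Prod>i<n. (real j - real i) / (real N - real i)) =
    (if n \<le> j then real ((N - n) choose (j - n)) else 0)"
  using assms(2)
proof (induction n)
  case (Suc n)
  have IH: "real (N choose j) * (\<Prod>i<n. (real j - real i) / (real N - real i)) =
    (if n \<le> j then real ((N - n) choose (j - n)) else 0)"
    using Suc by simp
  have "real (N choose j) * (\<Prod>i<Suc n. (real j - real i) / (real N - real i)) =
    (if n \<le> j then real ((N - n) choose (j - n)) else 0) * ((real j - real n) / (real N - real n))"
    by (simp only: prod.lessThan_Suc mult.assoc[symmetric] IH)
  also have "\<dots> = (if Suc n \<le> j then real ((N - Suc n) choose (j - Suc n)) else 0)"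
  proof (cases "Suc n \<le> j")
    case True
    have e: "j - n = Suc (j - Suc n)" "N - n = Suc (N - Suc n)" using True Suc.prems by auto
    have "Suc (j - Suc n) * (Suc (N - Suc n) choose Suc (j - Suc n)) =
        Suc (N - Suc n) * ((N - Suc n) choose (j - Suc n))"
      by (rule Suc_times_binomial)
    then have "(j - n) * ((N - n) choose (j - n)) = (N - n) * ((N - Suc n) choose (j - Suc n))"
      by (simp only: e[symmetric])
    then have "real (j - n) * real ((N - n) choose (j - n)) = real (N - n) * real ((N - Suc n) choose (j - Suc n))"
      by (metis of_nat_mult)
    then have "(real j - real n) * real ((N - n) choose (j - n)) = (real N - real n) * real ((N - Suc n) choose (j - Suc n))"
      using True Suc.prems by (simp add: of_nat_diff)
    moreover have "real N - real n > 0" using Suc.prems by simp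
    ultimately show ?thesis using True by (simp add: field_simps)
  next
    case False
    then show ?thesis by (cases "n = j") auto
  qed
  finally show ?case .
qed simp

text \<open>\<open>D k m\<close> plays the role of \<open>\<integral> x ^ k (1 - x) ^ m\<close>.\<close>

locale hausdorff =
  fixes D :: "nat \<Rightarrow> nat \<Rightarrow> real"
  assumes D_nonneg: "D k m \<ge> 0" and D_split: "D k m = D k (Suc m) + D (Suc k) m" and D_00: "D 0 0 = 1"
begin

text \<open>The expansion of (x + (1 - x))^N = 1 inserted into the integrand x^a (1 - x)^b.\<close>

lemma D_expand: "D a b = (\<Sum>k\<le>N. real (N choose k) * D (a + k) (b + (N - k)))"
proof (induction N arbitrary: a b)
  case (Suc N)
  have "(\<Sum>k\<le>Suc N. real (Suc N choose k) * D (a + k) (b + (Suc N - k))) =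
     D a (b + Suc N) + (\<Sum>k\<le>N. real (Suc N choose Suc k) * D (a + Suc k) (b + (N - k)))"
    by (simp add: sum.atMost_Suc_shift del: sum.atMost_Suc binomial_Suc_Suc)
  also have "\<dots> = D a (b + Suc N) + (\<Sum>k\<le>N. real (N choose Suc k) * D (a + Suc k) (b + (N - k)))
     + (\<Sum>k\<le>N. real (N choose k) * D (Suc a + k) (b + (N - k)))"
    by (simp add: sum.distrib algebra_simps)
  also have "D a (b + Suc N) + (\<Sum>k\<le>N. real (N choose Suc k) * D (a + Suc k) (b + (N - k)))
     = (\<Sum>k\<le>Suc N. real (N choose k) * D (a + k) (b + (Suc N - k)))"
    by (simp add: sum.atMost_Suc_shift del: sum.atMost_Suc)
  also have "\<dots> = (\<Sum>k\<le>N. real (N choose k) * D (a + k) (Suc b + (N - k)))"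
    by (auto intro!: sum.cong simp: Suc_diff_le)
  also have "\<dots> + (\<Sum>k\<le>N. real (N choose k) * D (Suc a + k) (b + (N - k))) = D a b"
    using D_split[of a b] Suc.IH[of a "Suc b"] Suc.IH[of "Suc a" b] by (simp only:)
  finally show ?case by simp
qed simp

text \<open>The mass at k / N of the N-th Bernstein approximation: the would-be integral of the
  Bernstein polynomial with index k.\<close>

definition weight :: "nat \<Rightarrow> nat \<Rightarrow> real" where
  "weight N k = (if k \<le> N then real (N choose k) * D k (N - k) else 0)"

lemma weight_nonneg: "weight N k \<ge> 0"
  by (simp add: weight_def D_nonneg)

lemma weight_sum: "(\<Sum>k\<le>N. weight N k) = 1"
  using D_expand[of 0 0 N] by (simp add: weight_def D_00)

lemma weight_moment:
  assumes "n \<le> N"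
  shows "(\<Sum>k\<le>N. weight N k * (\<Prod>i<n. (real k - real i) / (real N - real i))) = D n 0"
proof -
  have "(\<Sum>k\<le>N. weight N k * (\<Prod>i<n. (real k - real i) / (real N - real i))) =
     (\<Sum>k\<le>N. (if n \<le> k then real ((N - n) choose (k - n)) else 0) * D k (N - k))"
  proof (rule sum.cong)
    fix k assume "k \<in> {..N}"
    then show "weight N k * (\<Prod>i<n. (real k - real i) / (real N - real i)) =
      (if n \<le> k then real ((N - n) choose (k - n)) else 0) * D k (N - k)"
      by (simp add: weight_def binomial_falling_ratio[OF _ assms, symmetric] mult_ac)
  qed simp
  also have "\<dots> = (\<Sum>k\<in>{n..N}. real ((N - n) choose (k - n)) * D k (N - k))"
    by (rule sum.mono_neutral_cong_right) auto
  also have "\<dots> = (\<Sum>k\<in>{0..N-n}. real ((N - n) choose k) * D (n + k) (N - n - k))"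
    by (rule sum.reindex_bij_witness[of _ "\<lambda>k. k + n" "\<lambda>k. k - n"]) (use assms in auto)
  also have "\<dots> = D n 0"
    using D_expand[of n 0 "N - n"] by (simp add: atLeast0AtMost)
  finally show ?thesis .
qed

lemma weight_moment_limit:
  "(\<lambda>N. \<Sum>k\<le>N. weight N k * (real k / real N) ^ n) \<longlonglongrightarrow> D n 0"
proof -
  have lim: "(\<lambda>N. real n * (real n / (real N - real n))) \<longlonglongrightarrow> 0"
    by real_asymp
  have bound: "\<bar>(\<Sum>k\<le>N. weight N k * (real k / real N) ^ n) - D n 0\<bar> \<le> real n * (real n / (real N - real n))"
    if N: "N > 2 * n + 1" for N
  proof -
    have *: "\<bar>(real k / real N) ^ n - (\<Prod>i<n. (real k - real i) / (real N - real i))\<bar>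
        \<le> real n * (real n / (real N - real n))" if "k \<le> N" for k
    proof -
      \<comment> \<open>All factors have modulus at most 1, so products differ by no more than the
        sum of the differences of their factors.\<close>
      have "\<bar>(\<Prod>i<n. real k / real N) - (\<Prod>i<n. (real k - real i) / (real N - real i))\<bar>
          \<le> (\<Sum>i<n. \<bar>real k / real N - (real k - real i) / (real N - real i)\<bar>)"
      proof -
        have "\<bar>(real k - real i) / (real N - real i)\<bar> \<le> 1" if "i < n" for i
          using that N \<open>k \<le> N\<close> by (simp add: abs_le_iff)
        then show ?thesis
          unfolding real_norm_def[symmetric]
          by (intro norm_prod_diff) (use \<open>k \<le> N\<close> N in \<open>auto simp: divide_le_eq\<close>)
      qed
      also have "\<dots> \<le> (\<Sum>i<n. real n / (real N - real n))"
      proof (rule sum_mono)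
        fix i assume "i \<in> {..<n}"
        then have i: "i < n" by simp
        have "real k / real N - (real k - real i) / (real N - real i) = (real i / (real N - real i)) * ((real N - real k) / real N)"
          using i N by (simp add: field_simps)
        also have "\<bar>\<dots>\<bar> \<le> real i / (real N - real i) * 1"
        proof -
          have "0 \<le> (real N - real k) / real N" "(real N - real k) / real N \<le> 1" "0 \<le> real i / (real N - real i)"
            using i N \<open>k \<le> N\<close> by (auto simp: divide_le_eq)
          then show ?thesis by (metis abs_mult abs_of_nonneg mult_left_mono)
        qed
        also have "\<dots> \<le> real n / (real N - real n)"
          using i N by (simp add: frac_le)
        finally show "\<bar>real k / real N - (real k - real i) / (real N - real i)\<bar> \<le> real n / (real N - real n)" .
      qed
      finally show ?thesis by simp
    qed
    have "(\<Sum>k\<le>N. weight N k * (real k / real N) ^ n) - D n 0 =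
       (\<Sum>k\<le>N. weight N k * ((real k / real N) ^ n - (\<Prod>i<n. (real k - real i) / (real N - real i))))"
      using weight_moment[of n N] N by (simp add: right_diff_distrib sum_subtractf)
    also have "\<bar>\<dots>\<bar> \<le> (\<Sum>k\<le>N. weight N k * (real n * (real n / (real N - real n))))"
    proof (rule order_trans[OF sum_abs], rule sum_mono)
      fix k assume "k \<in> {..N}"
      then show "\<bar>weight N k * ((real k / real N) ^ n - (\<Prod>i<n. (real k - real i) / (real N - real i)))\<bar>
          \<le> weight N k * (real n * (real n / (real N - real n)))"
        unfolding abs_mult abs_of_nonneg[OF weight_nonneg] by (intro mult_left_mono * weight_nonneg) simp
    qed
    also have "\<dots> = real n * (real n / (real N - real n))"
      by (simp only: sum_distrib_right[symmetric] weight_sum mult_1_left)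
    finally show ?thesis .
  qed
  have "(\<lambda>N. (\<Sum>k\<le>N. weight N k * (real k / real N) ^ n) - D n 0) \<longlonglongrightarrow> 0"
    by (rule Lim_null_comparison[OF _ lim])
      (use bound in \<open>auto intro!: eventually_sequentiallyI[of "2 * n + 2"]\<close>)
  then show ?thesis by (simp add: LIM_zero_iff)
qed

definition bernstein :: "nat \<Rightarrow> real measure" where
  "bernstein N = distr (measure_pmf (embed_pmf (weight N))) borel (\<lambda>k. real k / real N)"

lemma pmf_weight: "pmf (embed_pmf (weight N)) k = weight N k"
proof (rule pmf_embed_pmf)
  have "(\<integral>\<^sup>+ x. ennreal (weight N x) \<partial>count_space UNIV) = (\<Sum>k\<le>N. ennreal (weight N k))"
    by (rule nn_integral_count_space') (auto simp: weight_def)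
  also have "\<dots> = 1"
    by (simp add: sum_ennreal weight_nonneg weight_sum)
  finally show "(\<integral>\<^sup>+ x. ennreal (weight N x) \<partial>count_space UNIV) = 1" .
qed (rule weight_nonneg)

lemma bernstein_integral:
  fixes f :: "real \<Rightarrow> real"
  assumes [measurable]: "f \<in> borel_measurable borel"
  shows "(\<integral>x. f x \<partial>bernstein N) = (\<Sum>k\<le>N. weight N k * f (real k / real N))"
proof -
  have "(\<integral>x. f x \<partial>bernstein N) = (\<integral>k. f (real k / real N) \<partial>measure_pmf (embed_pmf (weight N)))"
    unfolding bernstein_def by (subst integral_distr) auto
  also have "\<dots> = (\<Sum>k\<le>N. f (real k / real N) * pmf (embed_pmf (weight N)) k)"
    by (rule integral_measure_pmf_real) (auto simp: set_pmf_iff pmf_weight weight_def split: if_splits)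
  finally show ?thesis by (simp add: pmf_weight mult_ac)
qed

lemma bernstein_dist: "real_distribution (bernstein N)"
  unfolding bernstein_def
  by (intro real_distribution.intro real_distribution_axioms.intro measure_pmf.prob_space_distr) auto

lemma bernstein_tight: "tight bernstein"
  unfolding tight_def
proof (intro conjI allI impI)
  fix \<epsilon> :: real assume "\<epsilon> > 0"
  \<comment> \<open>Tightness is stated for intervals open on the left, and there may be mass at
    0.\<close>
  have "measure (bernstein N) {-1<..1} = 1" for N
  proof -
    interpret real_distribution "bernstein N" by (rule bernstein_dist)
    have "measure (bernstein N) {-1<..1} = (\<integral>x. indicator {-1<..1} x \<partial>bernstein N)" by simp
    also have "\<dots> = (\<Sum>k\<le>N. weight N k * indicator {-1<..1} (real k / real N))"
      by (rule bernstein_integral) simp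
    also have "\<dots> = (\<Sum>k\<le>N. weight N k)"
    proof (rule sum.cong)
      fix k assume "k \<in> {..N}"
      then have "0 \<le> real k / real N" "real k / real N \<le> 1"
        by (cases "N = 0"; simp add: divide_le_eq)+
      then have "real k / real N \<in> {-1<..1}"
        unfolding greaterThanAtMost_iff by linarith
      then show "weight N k * indicator {-1<..1} (real k / real N) = weight N k" by simp
    qed simp
    finally show ?thesis by (simp add: weight_sum)
  qed
  then show "\<exists>a b. a < b \<and> (\<forall>n. 1 - \<epsilon> < measure (bernstein n) {a<..b})"
    using \<open>\<epsilon> > 0\<close> by (intro exI[of _ "-1"] exI[of _ 1]) auto
qed (rule bernstein_dist)

theorem moment_measure:
  "\<exists>\<nu>. prob_space \<nu> \<and> sets \<nu> = sets borel \<and> (AE x in \<nu>. x \<in> {0..1}) \<and>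
     (\<forall>n. integrable \<nu> (\<lambda>x. x ^ n) \<and> (\<integral>x. x ^ n \<partial>\<nu>) = D n 0)"
proof -
  obtain r M where r: "strict_mono r" and M: "real_distribution M"
    and conv: "weak_conv_m (bernstein \<circ> id \<circ> r) M"
    using tight_imp_convergent_subsubsequence[OF bernstein_tight strict_mono_id] by blast
  interpret M: real_distribution M by (rule M)
  have cont: "(\<lambda>n. \<integral>x. f x \<partial>bernstein (r n)) \<longlonglongrightarrow> (\<integral>x. f x \<partial>M)"
    if "\<And>x. isCont f x" "\<And>x. norm (f x) \<le> B" for f :: "real \<Rightarrow> real" and B
    using weak_conv_imp_integral_bdd_continuous_conv[of "bernstein \<circ> id \<circ> r" M f B] conv M that bernstein_dist
    by (simp add: comp_def)
  \<comment> \<open>Weak convergence only tests bounded continuous functions. Clamping to the unit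
    interval makes the powers such, and the truncated distance from x to \<open>cl x\<close> detects
    mass outside the interval.\<close>
  define cl :: "real \<Rightarrow> real" where "cl x = max 0 (min 1 x)" for x
  have cl_id: "cl (real k / real N) = real k / real N" if "k \<le> N" for k N
  proof -
    have "0 \<le> real k / real N" "real k / real N \<le> 1"
      using that by (cases "N = 0"; simp add: divide_le_eq)+
    then show ?thesis unfolding cl_def by linarith
  qed
  have cl_meas [measurable]: "cl \<in> borel_measurable borel" unfolding cl_def by measurable
  have "(\<lambda>n. \<integral>x. min 1 \<bar>x - cl x\<bar> \<partial>bernstein (r n)) \<longlonglongrightarrow> (\<integral>x. min 1 \<bar>x - cl x\<bar> \<partial>M)"
    by (rule cont[of _ 1]) (auto simp: cl_def intro!: continuous_intros)
  moreover have "(\<integral>x. min 1 \<bar>x - cl x\<bar> \<partial>bernstein N) = 0" for N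
    by (subst bernstein_integral) (auto simp: cl_id)
  ultimately have "(\<integral>x. min 1 \<bar>x - cl x\<bar> \<partial>M) = 0"
    using LIMSEQ_unique[OF _ tendsto_const] by fastforce
  moreover have "integrable M (\<lambda>x. min 1 \<bar>x - cl x\<bar>)"
    by (rule M.integrable_const_bound[of _ 1]) auto
  ultimately have "AE x in M. min 1 \<bar>x - cl x\<bar> = 0"
    by (subst (asm) integral_nonneg_eq_0_iff_AE) auto
  then have AE01: "AE x in M. x \<in> {0..1}"
    by eventually_elim (auto simp: cl_def min_def max_def split: if_splits)
  have AEcl: "AE x in M. x ^ n = cl x ^ n" for n
    using AE01 by eventually_elim (auto simp: cl_def)
  have int: "integrable M (\<lambda>x. cl x ^ n)" for n
    by (rule M.integrable_const_bound[of _ 1]) (auto simp: cl_def abs_le_iff power_le_one intro: order_trans[of _ 0])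
  have "(\<integral>x. x ^ n \<partial>M) = D n 0" for n
  proof -
    have "(\<lambda>k. \<integral>x. cl x ^ n \<partial>bernstein (r k)) \<longlonglongrightarrow> (\<integral>x. cl x ^ n \<partial>M)"
      by (rule cont[of _ 1]) (auto simp: cl_def power_abs[symmetric] power_le_one intro!: continuous_intros)
    moreover have "(\<integral>x. cl x ^ n \<partial>bernstein N) = (\<Sum>k\<le>N. weight N k * (real k / real N) ^ n)" for N
      by (subst bernstein_integral) (auto simp: cl_id)
    ultimately have "(\<integral>x. cl x ^ n \<partial>M) = D n 0"
      using LIMSEQ_unique LIMSEQ_subseq_LIMSEQ[OF weight_moment_limit[of n] r] by (fastforce simp: comp_def)
    moreover have "(\<integral>x. x ^ n \<partial>M) = (\<integral>x. cl x ^ n \<partial>M)"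
      by (rule integral_cong_AE) (use AEcl in auto)
    ultimately show ?thesis by simp
  qed
  moreover have "integrable M (\<lambda>x. x ^ n)" for n
    by (subst integrable_cong_AE[OF _ _ AEcl[of n]]) (auto simp: int)
  ultimately show ?thesis
    using M.prob_space_axioms AE01 by (intro exI[of _ M]) auto
qed

end

section \<open>Existence of the spectral distribution\<close>

context star_prob
begin

text \<open>A weak form of P <= 1, drawn from moments alone. Put a(n) = tau(y P^n y). Cauchy-Schwarz
  gives a(n)^2 <= a(0) a(2n), so a(1) > a(0) would force a(2^k) to grow like q^(2^k) with q > 1; but
  moving \<open>y\<close> around the trace bounds a(n)^2 independently of n.\<close>

lemma power_P_bounded:
  assumes sa: "st y = y" and bd: "\<And>n. Re (tau ((st X * X) ^ n)) \<le> 1"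
  shows "Re (tau (y * (st X * X) * y)) \<le> Re (tau (y * y))"
proof (rule ccontr)
  define P where "P = st X * X"
  have stP: "st (P ^ n) = P ^ n" for n by (simp add: P_def st_power st_mult)
  define a where "a n = Re (tau (y * P ^ n * y))" for n
  have a_sq: "(a n)\<^sup>2 \<le> a 0 * a (2 * n)" for n
  proof -
    have "(a n)\<^sup>2 \<le> (cmod (tau (st y * (P ^ n * y))))\<^sup>2"
      by (simp add: a_def sa mult.assoc abs_le_square_iff[symmetric] abs_Re_le_cmod)
    also have "\<dots> \<le> Re (tau (st y * y)) * Re (tau (st (P ^ n * y) * (P ^ n * y)))"
      by (rule Cauchy_Schwarz)
    also have "st (P ^ n * y) * (P ^ n * y) = y * P ^ (2 * n) * y"
      by (simp add: st_mult stP sa mult.assoc mult_2 power_add)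
    finally show ?thesis by (simp add: a_def sa)
  qed
  define K where "K = Re (tau (st (y * y) * (y * y)))"
  have a_bd: "(a n)\<^sup>2 \<le> K" for n
  proof -
    have "tau (y * P ^ n * y) = tau (st (y * y) * P ^ n)"
      using tau_comm[of "y * P ^ n" y] by (simp add: st_mult sa mult.assoc)
    then have "(a n)\<^sup>2 \<le> (cmod (tau (st (y * y) * P ^ n)))\<^sup>2"
      by (simp add: a_def abs_le_square_iff[symmetric] abs_Re_le_cmod)
    also have "\<dots> \<le> K * Re (tau (st (P ^ n) * P ^ n))"
      unfolding K_def by (rule Cauchy_Schwarz)
    also have "\<dots> \<le> K * 1"
    proof (rule mult_left_mono)
      have "st (P ^ n) * P ^ n = P ^ (2 * n)" by (simp only: stP mult_2 power_add)
      then show "Re (tau (st (P ^ n) * P ^ n)) \<le> 1" using bd[of "2 * n"] by (simp add: P_def)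
      show "0 \<le> K" unfolding K_def by (rule tau_pos)
    qed
    finally show ?thesis by simp
  qed
  assume "\<not> ?thesis"
  then have gt: "a 1 > a 0" by (simp add: a_def P_def)
  have a0: "a 0 \<ge> 0" using tau_pos[of y] by (simp add: a_def sa)
  have "a 0 \<noteq> 0" using a_sq[of 1] gt by auto
  then have a0: "a 0 > 0" using a0 by simp
  define q where "q = a 1 / a 0"
  have q: "q > 1" using gt a0 by (simp add: q_def)
  have grow: "a (2 ^ k) \<ge> a 0 * q ^ (2 ^ k)" for k
  proof (induction k)
    case 0
    show ?case using a0 by (simp add: q_def)
  next
    case (Suc k)
    have "(a 0 * q ^ (2 ^ k))\<^sup>2 \<le> (a (2 ^ k))\<^sup>2"
      using Suc a0 q by (intro power_mono) auto
    also have "\<dots> \<le> a 0 * a (2 ^ Suc k)" using a_sq[of "2 ^ k"] by simp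
    finally have "a 0 * (a 0 * q ^ (2 ^ Suc k)) \<le> a 0 * a (2 ^ Suc k)"
      by (simp add: power2_eq_square power_add mult_2 mult_ac)
    then show ?case using a0 by simp
  qed
  obtain n where n: "(1 + K) / a 0 < q ^ n" using real_arch_pow[OF q] by blast
  have "q ^ n \<le> q ^ (2 ^ n)" using q by (intro power_increasing) (auto intro: less_imp_le[OF less_exp])
  then have "1 + K < a 0 * q ^ (2 ^ n)" using n a0 by (simp add: field_simps) (smt (verit) mult_left_mono)
  then have big: "1 + K < a (2 ^ n)" using grow[of n] by linarith
  have "K \<ge> 0" unfolding K_def by (rule tau_pos)
  then have "(1 + K) * 1 \<le> a (2 ^ n) * a (2 ^ n)"
    using big by (intro mult_mono) auto
  then show False using a_bd[of "2 ^ n"] by (simp add: power2_eq_square)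
qed

text \<open>Four parity cases. Even exponents give a square y y; an odd power of P gives the square
  of X y; an odd power of 1 - P is \<open>power_P_bounded\<close>. If both are odd, multiplying by P
  + (1 - P) = 1 leads back to the two mixed cases.\<close>

lemma tau_power_pos:
  assumes bd: "\<And>n. Re (tau ((st X * X) ^ n)) \<le> 1"
  defines "P \<equiv> st X * X"
  shows "Re (tau (P ^ k * (1 - P) ^ m)) \<ge> 0"
proof -
  define Q where "Q = 1 - P"
  have PQ: "P * Q = Q * P" by (simp add: Q_def algebra_simps)
  have comm: "P ^ i * Q ^ j = Q ^ j * P ^ i" for i j
    using PQ by (metis power_commuting_commutes)
  have stP: "st (P ^ n) = P ^ n" for n by (simp add: P_def st_power st_mult)
  have stQ: "st (Q ^ n) = Q ^ n" for n by (simp add: Q_def P_def st_power st_mult st_diff)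
  define y where "y i j = P ^ i * Q ^ j" for i j
  have sty: "st (y i j) = y i j" for i j by (simp add: y_def st_mult stP stQ comm)
  have yy: "y i j * y i' j' = y (i + i') (j + j')" for i j i' j'
  proof -
    have "y i j * y i' j' = P ^ i * (Q ^ j * P ^ i') * Q ^ j'" by (simp add: y_def mult.assoc)
    also have "\<dots> = P ^ i * (P ^ i' * Q ^ j) * Q ^ j'" by (simp only: comm)
    finally show ?thesis by (simp add: y_def power_add mult.assoc)
  qed
  have y1: "P = y 1 0" "Q = y 0 1" by (simp_all add: y_def)
  have even_even: "Re (tau (y (2 * i) (2 * j))) \<ge> 0" for i j
    using tau_pos[of "y i j"] by (simp add: sty yy mult_2)
  have odd_even: "Re (tau (y (Suc (2 * i)) (2 * j))) \<ge> 0" for i j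
  proof -
    have "st (X * y i j) * (X * y i j) = y i j * P * y i j"
      by (simp add: st_mult sty P_def mult.assoc)
    also have "\<dots> = y (Suc (2 * i)) (2 * j)"
      by (subst y1) (simp add: yy mult_2)
    finally show ?thesis using tau_pos[of "X * y i j"] by simp
  qed
  have even_odd: "Re (tau (y (2 * i) (Suc (2 * j)))) \<ge> 0" for i j
  proof -
    have "y (2 * i) (Suc (2 * j)) = y i j * Q * y i j" by (subst y1) (simp add: yy mult_2)
    also have "\<dots> = y i j * y i j - y i j * P * y i j" by (simp add: Q_def algebra_simps)
    finally show ?thesis
      using power_P_bounded[OF sty bd, of i j] by (simp add: tau_diff P_def)
  qed
  have split: "y i j = y (Suc i) j + y i (Suc j)" for i j
  proof -
    have "y i j = P * y i j + Q * y i j" by (simp add: Q_def algebra_simps)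
    then show ?thesis by (simp add: y1 yy)
  qed
  have odd_odd: "Re (tau (y (Suc (2 * i)) (Suc (2 * j)))) \<ge> 0" for i j
    using even_odd[of "Suc i" j] odd_even[of i "Suc j"]
    by (subst split) (simp add: tau_add)
  have "Re (tau (y k m)) \<ge> 0"
    by (cases "even k"; cases "even m"; elim evenE oddE)
      (use even_even odd_even even_odd odd_odd in auto)
  then show ?thesis by (simp add: y_def Q_def)
qed

lemma spec_dist_exists: "\<exists>\<nu>. spec_dist tau (st T * T) \<nu>"
proof -
  obtain C where C: "\<And>n. Re (tau ((st T * T) ^ n)) \<le> C ^ n" using tau_growth[of T] by blast
  have "C \<ge> 0" using C[of 1] tau_pos[of T] by simp
  \<comment> \<open>\<open>C\<close> may be 0, and the rescaling divides by
    \<open>R\<close>.\<close>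
  define R where "R = C + 1"
  have R: "R > 0" using \<open>C \<ge> 0\<close> by (simp add: R_def)
  have CR: "Re (tau ((st T * T) ^ n)) \<le> R ^ n" for n
    by (rule order_trans[OF C]) (use \<open>C \<ge> 0\<close> in \<open>auto simp: R_def intro: power_mono\<close>)
  define X where "X = sm (of_real (1 / sqrt R)) T"
  define P where "P = st X * X"
  have rr: "complex_of_real (1 / sqrt R) * complex_of_real (1 / sqrt R) = of_real (1 / R)"
    using R by (simp del: of_real_divide of_real_mult add: of_real_mult[symmetric])
  have P: "P = sm (of_real (1 / R)) (st T * T)"
    by (simp only: P_def X_def st_sm sm_mult_left sm_mult_right sm_sm complex_cnj_complex_of_real rr)
  have Pn: "P ^ n = sm (of_real (1 / R ^ n)) ((st T * T) ^ n)" for n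
  proof (induction n)
    case (Suc n)
    show ?case
      unfolding power_Suc Suc by (simp add: P sm_mult_left sm_mult_right sm_sm mult.commute[of "complex_of_real R"])
  qed simp
  have bd: "Re (tau (P ^ n)) \<le> 1" for n
    using CR[of n] R by (simp add: Pn tau_sm divide_le_eq flip: of_real_power)
  interpret hausdorff "\<lambda>k m. Re (tau (P ^ k * (1 - P) ^ m))"
  proof
    show "0 \<le> Re (tau (P ^ k * (1 - P) ^ m))" for k m
      using tau_power_pos[of X] bd by (simp add: P_def)
    show "Re (tau (P ^ k * (1 - P) ^ m)) =
        Re (tau (P ^ k * (1 - P) ^ Suc m)) + Re (tau (P ^ Suc k * (1 - P) ^ m))" for k m
    proof -
      have "P ^ Suc k * (1 - P) ^ m = P ^ k * (P * (1 - P) ^ m)" by (simp only: power_Suc2 mult.assoc)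
      then have "P ^ k * (1 - P) ^ Suc m + P ^ Suc k * (1 - P) ^ m = P ^ k * (1 - P) ^ m"
        by (simp add: algebra_simps)
      then show ?thesis by (metis tau_add plus_complex.sel(1))
    qed
  qed simp
  obtain \<nu> where \<nu>: "prob_space \<nu>" "sets \<nu> = sets borel" "AE x in \<nu>. x \<in> {0..1}"
     "\<And>n. integrable \<nu> (\<lambda>x. x ^ n)" "\<And>n. (\<integral>x. x ^ n \<partial>\<nu>) = Re (tau (P ^ n * (1 - P) ^ 0))"
    using moment_measure by blast
  have real: "tau (P ^ n) = of_real (Re (tau (P ^ n)))" for n
  proof -
    have "st (P ^ n) = P ^ n" by (simp add: P_def st_power st_mult)
    then have "cnj (tau (P ^ n)) = tau (P ^ n)" by (metis tau_st)
    then show ?thesis by (simp add: complex_eq_iff)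
  qed
  interpret \<nu>: prob_space \<nu> by (rule \<nu>)
  have m: "(\<lambda>x. R * x) \<in> measurable \<nu> borel"
    by (subst measurable_cong_sets[OF \<nu>(2) refl]) simp
  define \<rho> where "\<rho> = distr \<nu> borel (\<lambda>x. R * x)"
  interpret \<rho>: prob_space \<rho> unfolding \<rho>_def by (rule \<nu>.prob_space_distr[OF m])
  have "AE x in \<rho>. x \<in> {0..R}"
    unfolding \<rho>_def using \<nu>(3) R by (subst AE_distr_iff[OF m]) (auto simp: mult_le_cancel_left1)
  then have "measure \<rho> {0..R} = 1"
    by (subst \<rho>.prob_eq_1) (auto simp: \<rho>_def)
  moreover have "integrable \<rho> (\<lambda>x. x ^ n)" for n
    unfolding \<rho>_def by (subst integrable_distr_eq[OF m]) (auto simp: power_mult_distrib \<nu>(4))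
  moreover have "complex_of_real (\<integral>x. x ^ n \<partial>\<rho>) = tau ((st T * T) ^ n)" for n
  proof -
    have "(\<integral>x. x ^ n \<partial>\<rho>) = R ^ n * (\<integral>x. x ^ n \<partial>\<nu>)"
      unfolding \<rho>_def by (subst integral_distr[OF m]) (auto simp: power_mult_distrib)
    then have "complex_of_real (\<integral>x. x ^ n \<partial>\<rho>) = of_real (R ^ n) * tau (P ^ n)"
      using real[of n] by (simp add: \<nu>(5))
    also have "\<dots> = tau ((st T * T) ^ n)" using R by (simp add: Pn tau_sm)
    finally show ?thesis .
  qed
  ultimately have "spec_dist tau (st T * T) \<rho>"
    unfolding spec_dist_def using \<rho>.prob_space_axioms by (auto simp: \<rho>_def)
  then show ?thesis by blast
qed

end

subsection \<open>Integrals depending on a parameter\<close>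

text \<open>Dominated convergence for difference quotients: on a ball, which is convex, the mean
  value inequality bounds all of them by the constant \<open>B\<close>. The field is left general to
  cover real and complex parameters.\<close>

lemma has_field_derivative_integral_param:
  fixes f f' :: "'z::{real_normed_field, banach, second_countable_topology} \<Rightarrow> 'x \<Rightarrow> 'z"
  assumes fin: "finite_measure M" and U: "open U" "z0 \<in> U"
    and int: "\<And>z. z \<in> U \<Longrightarrow> integrable M (f z)"
    and meas: "f' z0 \<in> borel_measurable M"
    and der: "AE x in M. \<forall>z\<in>U. ((\<lambda>z. f z x) has_field_derivative f' z x) (at z)"
    and bd: "AE x in M. \<forall>z\<in>U. norm (f' z x) \<le> B"
  shows "((\<lambda>z. \<integral>x. f z x \<partial>M) has_field_derivative (\<integral>x. f' z0 x \<partial>M)) (at z0)"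
proof -
  interpret finite_measure M by (rule fin)
  obtain e where e: "e > 0" "ball z0 e \<subseteq> U" using U openE by blast
  define V where "V = ball z0 e"
  have V: "open V" "z0 \<in> V" "V \<subseteq> U" "convex V" using e by (auto simp: V_def)
  have "((\<lambda>z. ((\<integral>x. f z x \<partial>M) - (\<integral>x. f z0 x \<partial>M)) / (z - z0)) \<longlongrightarrow> (\<integral>x. f' z0 x \<partial>M)) (at z0 within V)"
  proof (rule tendsto_at_iff_sequentially[THEN iffD2], intro allI impI)
    fix X assume X: "\<forall>i. X i \<in> V - {z0}" "X \<longlonglongrightarrow> z0"
    have XV: "X i \<in> V" "X i \<noteq> z0" "X i \<in> U" for i using X(1) V(3) by blast+
    have "(\<lambda>i. \<integral>x. (f (X i) x - f z0 x) / (X i - z0) \<partial>M) \<longlonglongrightarrow> (\<integral>x. f' z0 x \<partial>M)"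
    proof (rule integral_dominated_convergence[where w = "\<lambda>_. B" and f = "f' z0"
          and s = "\<lambda>i x. (f (X i) x - f z0 x) / (X i - z0)"])
      show "AE x in M. (\<lambda>i. (f (X i) x - f z0 x) / (X i - z0)) \<longlonglongrightarrow> f' z0 x"
        using der
      proof eventually_elim
        case (elim x)
        then have "((\<lambda>z. f z x) has_field_derivative f' z0 x) (at z0)" using U by blast
        then have "((\<lambda>z. (f z x - f z0 x) / (z - z0)) \<longlongrightarrow> f' z0 x) (at z0 within V)"
          unfolding has_field_derivative_iff at_within_open[OF V(2,1)] .
        then have "((\<lambda>z. (f z x - f z0 x) / (z - z0)) \<circ> X) \<longlonglongrightarrow> f' z0 x"
          by (rule tendsto_at_iff_sequentially[THEN iffD1, rule_format]) (use X in auto)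
        then show ?case by (simp add: comp_def)
      qed
      show "AE x in M. norm ((f (X i) x - f z0 x) / (X i - z0)) \<le> B" for i
        using der bd
      proof eventually_elim
        case (elim x)
        have "norm (f (X i) x - f z0 x) \<le> B * norm (X i - z0)"
          by (rule field_differentiable_bound[OF V(4), where f' = "\<lambda>z. f' z x"])
            (use elim V(2,3) XV in \<open>blast intro: has_field_derivative_at_within\<close>)+
        then show ?case using XV[of i] by (simp add: norm_divide field_simps)
      qed
      show "(\<lambda>x. (f (X i) x - f z0 x) / (X i - z0)) \<in> borel_measurable M" for i
        by (intro borel_measurable_divide borel_measurable_diff borel_measurable_const
            borel_measurable_integrable int XV U)
    qed (use meas in auto)
    moreover have "(\<integral>x. (f (X i) x - f z0 x) / (X i - z0) \<partial>M) =
        ((\<integral>x. f (X i) x \<partial>M) - (\<integral>x. f z0 x \<partial>M)) / (X i - z0)" for i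
      using int[OF XV(3)[of i]] int[OF U(2)] by simp
    ultimately show "((\<lambda>z. ((\<integral>x. f z x \<partial>M) - (\<integral>x. f z0 x \<partial>M)) / (z - z0)) \<circ> X) \<longlonglongrightarrow> (\<integral>x. f' z0 x \<partial>M)"
      unfolding comp_def by (simp only:)
  qed
  then show ?thesis
    unfolding has_field_derivative_iff at_within_open[OF V(2,1)] .
qed

section \<open>Resolvent and logarithmic integrals\<close>

lemma ln_add_bounds:
  fixes s u L :: real
  assumes "0 \<le> s" "s \<le> L" "u > 0"
  shows "ln u \<le> ln (s + u)" "ln (s + u) \<le> ln (L + u)" "ln (s + u) - ln u \<le> L / u"
proof -
  show "ln u \<le> ln (s + u)" "ln (s + u) \<le> ln (L + u)" using assms by auto
  have "(s + u) / u = 1 + s / u" using assms by (simp add: field_simps)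
  then have "ln (s + u) - ln u = ln (1 + s / u)" using assms ln_div[of "s + u" u] by simp
  also have "\<dots> \<le> s / u" using assms by (intro ln_add_one_self_le_self) auto
  also have "\<dots> \<le> L / u" using assms by (simp add: divide_right_mono)
  finally show "ln (s + u) - ln u \<le> L / u" .
qed

text \<open>Serves two purposes: the spectral distribution of P with \<open>s x = x\<close>, and the
  law under \<mu> of the squared distance |\<lambda> - x|^2 or (a - x)^2.\<close>

locale bounded_pos = prob_space M for M :: "real measure" +
  fixes s :: "real \<Rightarrow> real" and L :: real
  assumes s_meas [measurable]: "s \<in> borel_measurable M"
    and s_bd: "AE x in M. 0 \<le> s x \<and> s x \<le> L"
begin

lemma L_nonneg: "L \<ge> 0"
proof (rule ccontr)
  assume "\<not> L \<ge> 0"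
  then have "AE x in M. False" by (intro eventually_mono[OF s_bd]) auto
  then show False by (simp add: AE_False)
qed

definition cres :: "complex \<Rightarrow> complex" where
  "cres u = (\<integral>x. 1 / (of_real (s x) + u) \<partial>M)"

definition res :: "real \<Rightarrow> real" where
  "res u = (\<integral>x. 1 / (s x + u) \<partial>M)"

definition logint :: "real \<Rightarrow> real" where
  "logint u = (\<integral>x. ln (s x + u) \<partial>M)"

lemma geometric_moments:
  fixes r :: complex
  assumes r: "norm r * L \<le> 1 / 2"
  shows "(\<lambda>n. r ^ n * of_real (\<integral>x. s x ^ n \<partial>M)) sums (\<integral>x. 1 / (1 - r * of_real (s x)) \<partial>M)"
proof -
  have bd: "AE x in M. norm (r * of_real (s x)) \<le> 1 / 2"
    using s_bd
  proof eventually_elim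
    case (elim x)
    then have "norm r * \<bar>s x\<bar> \<le> norm r * L" by (intro mult_left_mono) auto
    then show ?case using r by (simp add: norm_mult)
  qed
  have bdn: "AE x in M. norm ((r * of_real (s x)) ^ n) \<le> (1 / 2) ^ n" for n
    using bd by eventually_elim (auto simp: norm_power intro: power_mono)
  have int: "integrable M (\<lambda>x. (r * of_real (s x)) ^ n)" for n
    by (rule integrable_const_bound[OF bdn]) simp
  have "(\<lambda>n. \<integral>x. (r * of_real (s x)) ^ n \<partial>M) sums (\<integral>x. (\<Sum>n. (r * of_real (s x)) ^ n) \<partial>M)"
  proof (rule sums_integral[OF int])
    show "AE x in M. summable (\<lambda>n. norm ((r * of_real (s x)) ^ n))"
      using bd by eventually_elim (auto simp: norm_power intro: summable_geometric)
    show "summable (\<lambda>n. \<integral>x. norm ((r * of_real (s x)) ^ n) \<partial>M)"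
    proof (rule summable_comparison_test[OF _ summable_geometric[of "1/2::real"]])
      have "(\<integral>x. norm ((r * of_real (s x)) ^ n) \<partial>M) \<le> (\<integral>x. (1/2) ^ n \<partial>M)" for n
        by (rule integral_mono_AE[OF integrable_norm[OF int] _ bdn]) simp
      then show "\<exists>N. \<forall>n\<ge>N. norm (\<integral>x. norm ((r * of_real (s x)) ^ n) \<partial>M) \<le> (1/2) ^ n"
        by (auto simp: prob_space)
    qed simp
  qed
  moreover have "(\<integral>x. (\<Sum>n. (r * of_real (s x)) ^ n) \<partial>M) = (\<integral>x. 1 / (1 - r * of_real (s x)) \<partial>M)"
  proof (rule integral_cong_AE)
    show "AE x in M. (\<Sum>n. (r * of_real (s x)) ^ n) = 1 / (1 - r * of_real (s x))"
      using bd by eventually_elim (auto intro: suminf_geometric)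
  qed measurable
  moreover have "(\<integral>x. (r * of_real (s x)) ^ n \<partial>M) = r ^ n * of_real (\<integral>x. s x ^ n \<partial>M)" for n
  proof -
    have "(\<integral>x. (r * of_real (s x)) ^ n \<partial>M) = (\<integral>x. r ^ n * complex_of_real (s x ^ n) \<partial>M)"
      by (simp add: power_mult_distrib)
    also have "\<dots> = r ^ n * of_real (\<integral>x. s x ^ n \<partial>M)"
      by (simp only: integral_mult_right_zero integral_complex_of_real)
    finally show ?thesis .
  qed
  ultimately show ?thesis by simp
qed

lemma cres_integrable:
  fixes u :: complex
  assumes "\<delta> > 0" "AE x in M. \<delta> \<le> norm (of_real (s x) + u)"
  shows "integrable M (\<lambda>x. 1 / (of_real (s x) + u))"
proof (rule integrable_const_bound[of _ "1 / \<delta>"])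
  show "AE x in M. norm (1 / (of_real (s x) + u)) \<le> 1 / \<delta>"
    using assms(2)
  proof eventually_elim
    case (elim x)
    then show ?case
      using assms(1) frac_le[of 1 1 \<delta> "cmod (of_real (s x) + u)"] by (simp add: norm_divide)
  qed
qed measurable

lemma cres_deriv:
  assumes "u0 \<notin> \<real>\<^sub>\<le>\<^sub>0"
  shows "(cres has_field_derivative (\<integral>x. - 1 / (of_real (s x) + u0)\<^sup>2 \<partial>M)) (at u0)"
proof -
  have "infdist u0 \<real>\<^sub>\<le>\<^sub>0 > 0"
    using assms nonpos_Reals_zero_I by (intro infdist_pos_not_in_closed closed_nonpos_Reals_complex) blast+
  \<comment> \<open>With half the distance from the cut, every point of the ball still has distance
    at least \<delta> from all the poles - s x.\<close>
  moreover define \<delta> where "\<delta> = infdist u0 \<real>\<^sub>\<le>\<^sub>0 / 2"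
  ultimately have \<delta>: "\<delta> > 0" "infdist u0 \<real>\<^sub>\<le>\<^sub>0 = 2 * \<delta>" by auto
  have far: "\<delta> \<le> norm (of_real y + u)" if "u \<in> ball u0 \<delta>" "0 \<le> y" for u y
  proof -
    have "of_real (- y) \<in> \<real>\<^sub>\<le>\<^sub>0" using that by (simp add: complex_nonpos_Reals_iff)
    then have "2 * \<delta> \<le> dist u0 (of_real (- y))" using \<delta> infdist_le by metis
    also have "\<dots> \<le> dist u0 u + dist u (of_real (- y))" by (rule dist_triangle)
    also have "dist u (of_real (- y)) = norm (of_real y + u)" by (simp add: dist_norm add.commute)
    finally show ?thesis using that by simp
  qed
  show ?thesis
    unfolding cres_def
  proof (rule has_field_derivative_integral_param[where U = "ball u0 \<delta>" and B = "1 / \<delta>\<^sup>2"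
        and f' = "\<lambda>u x. - 1 / (of_real (s x) + u)\<^sup>2"])
    show "integrable M (\<lambda>x. 1 / (of_real (s x) + u))" if "u \<in> ball u0 \<delta>" for u
      by (rule cres_integrable[OF \<delta>(1)]) (use s_bd far[OF that] in auto)
    show "AE x in M. \<forall>u\<in>ball u0 \<delta>. ((\<lambda>u. 1 / (of_real (s x) + u)) has_field_derivative - 1 / (of_real (s x) + u)\<^sup>2) (at u)"
      using s_bd
    proof eventually_elim
      case (elim x)
      show ?case
      proof
        fix u assume "u \<in> ball u0 \<delta>"
        then have "of_real (s x) + u \<noteq> 0" using far[of u "s x"] elim \<delta> by auto
        then show "((\<lambda>u. 1 / (of_real (s x) + u)) has_field_derivative - 1 / (of_real (s x) + u)\<^sup>2) (at u)"
          by (auto intro!: derivative_eq_intros simp: power2_eq_square field_simps)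
      qed
    qed
    show "AE x in M. \<forall>u\<in>ball u0 \<delta>. norm (- 1 / (of_real (s x) + u)\<^sup>2) \<le> 1 / \<delta>\<^sup>2"
      using s_bd
    proof eventually_elim
      case (elim x)
      show ?case
      proof
        fix u assume "u \<in> ball u0 \<delta>"
        then have "\<delta> \<le> norm (of_real (s x) + u)" using far[of u "s x"] elim by auto
        then have "\<delta>\<^sup>2 \<le> (norm (of_real (s x) + u))\<^sup>2" using \<delta> by (intro power_mono) auto
        then show "norm (- 1 / (of_real (s x) + u)\<^sup>2) \<le> 1 / \<delta>\<^sup>2"
          using \<delta> by (simp add: norm_divide norm_power divide_left_mono frac_le)
      qed
    qed
  qed (use \<delta> finite_measure_axioms in auto)
qed

lemma res_integrable: assumes "u > 0" shows "integrable M (\<lambda>x. 1 / (s x + u))"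
proof (rule integrable_const_bound[of _ "1 / u"])
  show "AE x in M. norm (1 / (s x + u)) \<le> 1 / u"
    using s_bd by eventually_elim (use assms in \<open>auto intro: divide_left_mono\<close>)
qed measurable

lemma cres_of_real: "cres (of_real u) = of_real (res u)"
proof -
  have "cres (of_real u) = (\<integral>x. complex_of_real (1 / (s x + u)) \<partial>M)"
    by (simp add: cres_def)
  then show ?thesis by (simp only: integral_complex_of_real res_def)
qed

lemma res_differentiable: assumes "u0 > 0" shows "res field_differentiable (at u0)"
proof -
  have "(res has_field_derivative (\<integral>x. - 1 / (s x + u0)\<^sup>2 \<partial>M)) (at u0)"
    unfolding res_def
  proof (rule has_field_derivative_integral_param[where U = "{u0 / 2<..}" and B = "1 / (u0 / 2)\<^sup>2"
        and f' = "\<lambda>u x. - 1 / (s x + u)\<^sup>2"])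
    show "AE x in M. \<forall>u\<in>{u0 / 2<..}. ((\<lambda>u. 1 / (s x + u)) has_field_derivative - 1 / (s x + u)\<^sup>2) (at u)"
      using s_bd
    proof eventually_elim
      case (elim x)
      show ?case
      proof
        fix u assume "u \<in> {u0 / 2<..}"
        then have "s x + u \<noteq> 0" using elim assms by auto
        then show "((\<lambda>u. 1 / (s x + u)) has_field_derivative - 1 / (s x + u)\<^sup>2) (at u)"
          by (auto intro!: derivative_eq_intros simp: power2_eq_square field_simps)
      qed
    qed
    show "AE x in M. \<forall>u\<in>{u0 / 2<..}. norm (- 1 / (s x + u)\<^sup>2) \<le> 1 / (u0 / 2)\<^sup>2"
      using s_bd
    proof eventually_elim
      case (elim x)
      show ?case
      proof
        fix u assume u: "u \<in> {u0 / 2<..}"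
        then have "(u0 / 2)\<^sup>2 \<le> (s x + u)\<^sup>2" using elim assms by (intro power_mono) auto
        then show "norm (- 1 / (s x + u)\<^sup>2) \<le> 1 / (u0 / 2)\<^sup>2"
          using assms frac_le[of 1 1 "(u0 / 2)\<^sup>2" "(s x + u)\<^sup>2"] by (simp add: abs_divide)
      qed
    qed
  qed (use assms finite_measure_axioms res_integrable in auto)
  then show ?thesis by (auto simp: field_differentiable_def)
qed

lemma logint_integrable: assumes "u > 0" shows "integrable M (\<lambda>x. ln (s x + u))"
proof (rule integrable_const_bound[of _ "\<bar>ln u\<bar> + \<bar>ln (L + u)\<bar>"])
  show "AE x in M. norm (ln (s x + u)) \<le> \<bar>ln u\<bar> + \<bar>ln (L + u)\<bar>"
    using s_bd
  proof eventually_elim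
    case (elim x)
    then show ?case using ln_add_bounds(1,2)[of "s x" L u] assms unfolding real_norm_def by linarith
  qed
qed measurable

lemma logint_deriv: assumes "u0 > 0" shows "(logint has_field_derivative res u0) (at u0)"
  unfolding res_def logint_def
proof (rule has_field_derivative_integral_param[where U = "{u0 / 2<..}" and B = "1 / (u0 / 2)"
      and f' = "\<lambda>u x. 1 / (s x + u)"])
  show "AE x in M. \<forall>u\<in>{u0 / 2<..}. ((\<lambda>u. ln (s x + u)) has_field_derivative 1 / (s x + u)) (at u)"
    using s_bd by eventually_elim (use assms in \<open>auto intro!: derivative_eq_intros\<close>)
  show "AE x in M. \<forall>u\<in>{u0 / 2<..}. norm (1 / (s x + u)) \<le> 1 / (u0 / 2)"
    using s_bd
  proof eventually_elim
    case (elim x)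
    show ?case
    proof
      fix u assume u: "u \<in> {u0 / 2<..}"
      then have "u0 / 2 \<le> s x + u" "s x + u > 0" using elim assms by auto
      then show "norm (1 / (s x + u)) \<le> 1 / (u0 / 2)"
        using assms frac_le[of 1 1 "u0 / 2" "s x + u"] by simp
    qed
  qed
qed (use assms finite_measure_axioms logint_integrable in auto)

text \<open>Used to fix the constant of integration at infinity.\<close>

lemma logint_asymp:
  assumes "u > 0"
  shows "0 \<le> logint u - ln u" "logint u - ln u \<le> L / u"
proof -
  have "logint u - ln u = (\<integral>x. ln (s x + u) - ln u \<partial>M)"
    using logint_integrable[OF assms] by (simp add: logint_def prob_space)
  moreover have "0 \<le> (\<integral>x. ln (s x + u) - ln u \<partial>M)"
  proof (rule integral_nonneg_AE)
    show "AE x in M. 0 \<le> ln (s x + u) - ln u"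
      using s_bd by (rule eventually_mono) (use ln_add_bounds(1) assms in auto)
  qed
  moreover have "(\<integral>x. ln (s x + u) - ln u \<partial>M) \<le> (\<integral>x. L / u \<partial>M)"
  proof (rule integral_mono_AE)
    show "AE x in M. ln (s x + u) - ln u \<le> L / u"
      using s_bd by (rule eventually_mono) (use ln_add_bounds(3) assms in blast)
  qed (use logint_integrable[OF assms] in auto)
  ultimately show "0 \<le> logint u - ln u" "logint u - ln u \<le> L / u"
    by (auto simp: prob_space)
qed

lemma res_bounds:
  assumes "u > 0"
  shows "0 < res u" "res u \<le> 1 / u"
proof -
  have "1 / (L + u) \<le> res u"
  proof -
    have "(\<integral>x. 1 / (L + u) \<partial>M) \<le> res u"
      unfolding res_def
    proof (rule integral_mono_AE[OF _ res_integrable[OF assms]])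
      show "AE x in M. 1 / (L + u) \<le> 1 / (s x + u)"
        using s_bd by (rule eventually_mono) (use assms in \<open>auto intro!: frac_le\<close>)
    qed simp
    then show ?thesis by (simp add: prob_space)
  qed
  moreover have "0 < 1 / (L + u)" using assms L_nonneg by simp
  ultimately show "0 < res u" by linarith
  have "res u \<le> (\<integral>x. 1 / u \<partial>M)"
    unfolding res_def
  proof (rule integral_mono_AE[OF res_integrable[OF assms]])
    show "AE x in M. 1 / (s x + u) \<le> 1 / u"
      using s_bd by (rule eventually_mono) (use assms in \<open>auto intro!: frac_le\<close>)
  qed simp
  then show "res u \<le> 1 / u" by (simp add: prob_space)
qed

text \<open>Boundedness of \<open>s\<close> gives the difference of the integrands a constant
  positive lower bound, whence strictness.\<close>

lemma res_strict_antimono: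
  assumes "0 < u" "u < u'"
  shows "res u' < res u"
proof -
  have "res u - res u' = (\<integral>x. 1 / (s x + u) - 1 / (s x + u') \<partial>M)"
    using assms res_integrable by (simp add: res_def)
  moreover have "(u' - u) / ((L + u') * (L + u')) = (\<integral>x. (u' - u) / ((L + u') * (L + u')) \<partial>M)"
    by (simp add: prob_space)
  moreover have "\<dots> \<le> (\<integral>x. 1 / (s x + u) - 1 / (s x + u') \<partial>M)"
  proof (rule integral_mono_AE)
    show "AE x in M. (u' - u) / ((L + u') * (L + u')) \<le> 1 / (s x + u) - 1 / (s x + u')"
      using s_bd
    proof eventually_elim
      case (elim x)
      have "1 / (s x + u) - 1 / (s x + u') = (u' - u) / ((s x + u) * (s x + u'))"
        using elim assms by (simp add: field_simps)
      moreover have "(s x + u) * (s x + u') \<le> (L + u') * (L + u')"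
        using elim assms by (intro mult_mono) auto
      ultimately show ?case using elim assms by (auto intro!: divide_left_mono mult_pos_pos)
    qed
  qed (use assms res_integrable in auto)
  moreover have "(u' - u) / ((L + u') * (L + u')) > 0"
    using assms L_nonneg by (intro divide_pos_pos mult_pos_pos) auto
  ultimately show ?thesis by linarith
qed

end

subsection \<open>The subordination equation\<close>

text \<open>For the generating functions M k and Q k of p and q at \<zeta>, the convolutions become
  products: \<kappa> M(k) = p(0,k) + \<zeta> Q(k) and \<kappa> Q(k) = M(k+1). Eliminating Q leaves a
  recursion in k alone, whose iteration is a power series in \<zeta> / \<kappa>^2.\<close>

lemma moment_recursion_sums:
  fixes p q :: "nat \<Rightarrow> nat \<Rightarrow> complex" and \<zeta> t C L :: real
  assumes rec1: "\<And>n k. p (Suc n) k = q n k + of_real t * (\<Sum>j\<le>n. p j 0 * p (n - j) k)"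
    and rec2: "\<And>n k. q n k = p n (Suc k) + of_real t * (\<Sum>j<n. p j 0 * q (n - Suc j) k)"
    and bd: "\<And>n k. norm (p n k) \<le> C ^ n * L ^ k"
    and C: "C \<ge> 1" and L: "L \<ge> 1" and t: "t > 0"
    and \<zeta>: "\<bar>\<zeta>\<bar> * C \<le> 1 / 8" "\<bar>\<zeta>\<bar> * t \<le> 1 / 8" "\<bar>\<zeta>\<bar> * L \<le> 1 / 8"
  defines "m \<equiv> (\<Sum>n. p n 0 * of_real \<zeta> ^ n)"
  defines "\<kappa> \<equiv> 1 - of_real t * of_real \<zeta> * m"
  shows "\<kappa> \<noteq> 0" "norm (of_real \<zeta> / \<kappa>\<^sup>2) * L \<le> 1 / 2"
    "(\<lambda>k. (of_real \<zeta> / \<kappa>\<^sup>2) ^ k * p 0 k) sums (\<kappa> * m)"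
proof -
  define z where "z = complex_of_real \<zeta>"
  have nz: "norm z = \<bar>\<zeta>\<bar>" by (simp add: z_def)
  have pbd: "norm (p n k * z ^ n) \<le> L ^ k * (1 / 8) ^ n" for n k
  proof -
    have "norm (p n k * z ^ n) \<le> (C ^ n * L ^ k) * \<bar>\<zeta>\<bar> ^ n"
      unfolding norm_mult norm_power nz by (intro mult_right_mono bd) auto
    also have "\<dots> = L ^ k * (\<bar>\<zeta>\<bar> * C) ^ n" by (simp add: power_mult_distrib mult_ac)
    also have "\<dots> \<le> L ^ k * (1 / 8) ^ n"
      using \<zeta> C L by (intro mult_left_mono power_mono) auto
    finally show ?thesis .
  qed
  have psum: "summable (\<lambda>n. norm (p n k * z ^ n))" for k
    by (rule summable_comparison_test'[of "\<lambda>n. L ^ k * (1 / 8) ^ n" 0])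
      (use pbd in \<open>auto intro!: summable_mult summable_geometric\<close>)
  \<comment> \<open>The convolution has n + 1 summands. Absorbing this factor into 2^n costs half of
    the decay, 1/4 instead of 1/8.\<close>
  have qbd: "norm (q n k * z ^ n) \<le> (C + t) * L ^ k * (1 / 4) ^ n" for n k
  proof -
    have "norm (q n k) = norm (p (Suc n) k - of_real t * (\<Sum>j\<le>n. p j 0 * p (n - j) k))"
      using rec1[of n k] by simp
    also have "\<dots> \<le> norm (p (Suc n) k) + norm (of_real t * (\<Sum>j\<le>n. p j 0 * p (n - j) k))"
      by (rule norm_triangle_ineq4)
    also have "\<dots> \<le> C ^ Suc n * L ^ k + t * (\<Sum>j\<le>n. C ^ n * L ^ k)"
    proof (rule add_mono[OF bd])
      have "norm (\<Sum>j\<le>n. p j 0 * p (n - j) k) \<le> (\<Sum>j\<le>n. C ^ n * L ^ k)"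
      proof (rule sum_norm_le)
        fix j assume "j \<in> {..n}"
        have "norm (p j 0 * p (n - j) k) \<le> (C ^ j * L ^ 0) * (C ^ (n - j) * L ^ k)"
          unfolding norm_mult by (intro mult_mono bd) (use C L in auto)
        also have "\<dots> = C ^ n * L ^ k" using \<open>j \<in> {..n}\<close> by (simp flip: power_add)
        finally show "norm (p j 0 * p (n - j) k) \<le> C ^ n * L ^ k" .
      qed
      then show "norm (of_real t * (\<Sum>j\<le>n. p j 0 * p (n - j) k)) \<le> t * (\<Sum>j\<le>n. C ^ n * L ^ k)"
        using t by (simp only: norm_mult norm_of_real) (simp add: mult_left_mono)
    qed
    also have "\<dots> = (C + t * real (Suc n)) * (C ^ n * L ^ k)" by (simp add: algebra_simps)
    also have "\<dots> \<le> ((C + t) * 2 ^ n) * (C ^ n * L ^ k)"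
    proof (rule mult_right_mono)
      have "real (Suc n) \<le> 2 ^ n" using less_exp[of n] by (metis Suc_leI of_nat_le_iff of_nat_numeral of_nat_power)
      moreover have "(1::real) \<le> 2 ^ n" by simp
      ultimately show "C + t * real (Suc n) \<le> (C + t) * 2 ^ n"
        unfolding distrib_right using C t by (intro add_mono mult_left_mono) auto
    qed (use C L in auto)
    finally have "norm (q n k * z ^ n) \<le> ((C + t) * 2 ^ n) * (C ^ n * L ^ k) * \<bar>\<zeta>\<bar> ^ n"
      unfolding norm_mult norm_power nz by (intro mult_right_mono) auto
    also have "\<dots> = (C + t) * L ^ k * (2 * (\<bar>\<zeta>\<bar> * C)) ^ n" by (simp add: power_mult_distrib mult_ac)
    also have "\<dots> \<le> (C + t) * L ^ k * (1 / 4) ^ n"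
      using \<zeta> C L t by (intro mult_left_mono power_mono) auto
    finally show ?thesis .
  qed
  have qsum: "summable (\<lambda>n. norm (q n k * z ^ n))" for k
    by (rule summable_comparison_test'[of "\<lambda>n. (C + t) * L ^ k * (1 / 4) ^ n" 0])
      (use qbd in \<open>auto intro!: summable_mult summable_geometric\<close>)
  define M where "M k = (\<Sum>n. p n k * z ^ n)" for k
  define Q where "Q k = (\<Sum>n. q n k * z ^ n)" for k
  have mM: "m = M 0" by (simp add: m_def M_def z_def)
  have Ms: "(\<lambda>n. p n k * z ^ n) sums M k" and Qs: "(\<lambda>n. q n k * z ^ n) sums Q k" for k
    unfolding M_def Q_def
    by (rule summable_sums[OF summable_norm_cancel[OF psum]], rule summable_sums[OF summable_norm_cancel[OF qsum]])
  have E1: "M k = p 0 k + z * (Q k + of_real t * (M 0 * M k))" for k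
  proof -
    have "(\<lambda>n. \<Sum>j\<le>n. (p j 0 * z ^ j) * (p (n - j) k * z ^ (n - j))) sums (M 0 * M k)"
      unfolding M_def by (rule Cauchy_product_sums[OF psum psum])
    then have "(\<lambda>n. z * (q n k * z ^ n + of_real t * (\<Sum>j\<le>n. (p j 0 * z ^ j) * (p (n - j) k * z ^ (n - j)))))
       sums (z * (Q k + of_real t * (M 0 * M k)))"
      by (intro sums_mult sums_add Qs)
    also have "(\<lambda>n. z * (q n k * z ^ n + of_real t * (\<Sum>j\<le>n. (p j 0 * z ^ j) * (p (n - j) k * z ^ (n - j)))))
      = (\<lambda>n. p (Suc n) k * z ^ Suc n)"
    proof
      fix n
      have "(\<Sum>j\<le>n. (p j 0 * z ^ j) * (p (n - j) k * z ^ (n - j))) = (\<Sum>j\<le>n. p j 0 * p (n - j) k) * z ^ n"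
        unfolding sum_distrib_right by (rule sum.cong) (auto simp: mult_ac simp flip: power_add)
      then show "z * (q n k * z ^ n + of_real t * (\<Sum>j\<le>n. (p j 0 * z ^ j) * (p (n - j) k * z ^ (n - j))))
         = p (Suc n) k * z ^ Suc n"
        by (simp add: rec1 algebra_simps)
    qed
    finally have "(\<lambda>n. p n k * z ^ n) sums (p 0 k + z * (Q k + of_real t * (M 0 * M k)))"
      by (subst (asm) sums_Suc_iff) (simp add: add.commute)
    then show ?thesis by (rule sums_unique2[OF Ms])
  qed
  have E2: "Q k = M (Suc k) + z * (of_real t * (M 0 * Q k))" for k
  proof -
    define h where "h n = of_real t * (\<Sum>j<n. p j 0 * q (n - Suc j) k) * z ^ n" for n
    have "(\<lambda>n. \<Sum>j\<le>n. (p j 0 * z ^ j) * (q (n - j) k * z ^ (n - j))) sums (M 0 * Q k)"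
      unfolding M_def Q_def by (rule Cauchy_product_sums[OF psum qsum])
    then have "(\<lambda>n. z * (of_real t * (\<Sum>j\<le>n. (p j 0 * z ^ j) * (q (n - j) k * z ^ (n - j)))))
       sums (z * (of_real t * (M 0 * Q k)))"
      by (intro sums_mult)
    also have "(\<lambda>n. z * (of_real t * (\<Sum>j\<le>n. (p j 0 * z ^ j) * (q (n - j) k * z ^ (n - j))))) = (\<lambda>n. h (Suc n))"
    proof
      fix n
      have "(\<Sum>j\<le>n. (p j 0 * z ^ j) * (q (n - j) k * z ^ (n - j))) = (\<Sum>j\<le>n. p j 0 * q (n - j) k) * z ^ n"
        unfolding sum_distrib_right by (rule sum.cong) (auto simp: mult_ac simp flip: power_add)
      then show "z * (of_real t * (\<Sum>j\<le>n. (p j 0 * z ^ j) * (q (n - j) k * z ^ (n - j)))) = h (Suc n)"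
        by (simp add: h_def lessThan_Suc_atMost del: sum.lessThan_Suc sum.atMost_Suc)
    qed
    finally have "h sums (z * (of_real t * (M 0 * Q k)))"
      by (subst (asm) sums_Suc_iff) (simp add: h_def)
    then have "(\<lambda>n. p n (Suc k) * z ^ n + h n) sums (M (Suc k) + z * (of_real t * (M 0 * Q k)))"
      by (intro sums_add Ms)
    moreover have "p n (Suc k) * z ^ n + h n = q n k * z ^ n" for n
      using rec2[of n k] by (simp add: h_def distrib_right)
    ultimately have "(\<lambda>n. q n k * z ^ n) sums (M (Suc k) + z * (of_real t * (M 0 * Q k)))" by simp
    then show ?thesis by (rule sums_unique2[OF Qs])
  qed
  have Mbd: "norm (M k) \<le> 2 * L ^ k" for k
  proof -
    have gs: "(\<lambda>n. L ^ k * (1 / 8) ^ n) sums (L ^ k * (1 / (1 - 1 / 8)))"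
      by (intro sums_mult geometric_sums) simp
    have "norm (M k) \<le> (\<Sum>n. L ^ k * (1 / 8) ^ n)"
      unfolding M_def by (rule norm_suminf_le) (use gs sums_summable pbd psum in auto)
    also have "\<dots> = L ^ k * (1 / (1 - 1 / 8))" using gs by (rule sums_unique[symmetric])
    also have "\<dots> \<le> 2 * L ^ k" using L by simp
    finally show ?thesis .
  qed
  have \<kappa>: "\<kappa> = 1 - z * (of_real t * M 0)" by (simp add: \<kappa>_def z_def mM mult_ac)
  have "norm (z * (of_real t * M 0)) \<le> \<bar>\<zeta>\<bar> * (t * 2)"
    unfolding norm_mult nz norm_of_real using Mbd[of 0] t by (intro mult_left_mono) (auto intro: mult_left_mono)
  then have "norm (z * (of_real t * M 0)) \<le> 1 / 2" using \<zeta> by (simp add: mult.assoc[symmetric])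
  \<comment> \<open>The constant 1/8 is tuned for this: |\<kappa>| >= 1/2 makes |\<zeta> /
    \<kappa>^2| at most 4 |\<zeta>|, and 4 |\<zeta>| L is at most 1/2.\<close>
  then have \<kappa>n: "norm \<kappa> \<ge> 1 / 2"
    unfolding \<kappa> using norm_triangle_ineq2[of 1 "z * (of_real t * M 0)"] by simp
  then show \<kappa>0: "\<kappa> \<noteq> 0" by auto
  define r where "r = z / \<kappa>\<^sup>2"
  have "(1/2)\<^sup>2 \<le> (norm \<kappa>)\<^sup>2" using \<kappa>n by (intro power_mono) auto
  then have "norm r \<le> \<bar>\<zeta>\<bar> / (1/4)"
    unfolding r_def norm_divide norm_power nz by (intro divide_left_mono) (auto simp: power2_eq_square \<kappa>0)
  then have "norm r * L \<le> (\<bar>\<zeta>\<bar> / (1/4)) * L" using L by (intro mult_right_mono) auto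
  then have rL: "norm r * L \<le> 1 / 2" using \<zeta> by simp
  then show "norm (of_real \<zeta> / \<kappa>\<^sup>2) * L \<le> 1 / 2" by (simp add: r_def z_def)
  have step: "\<kappa> * M k = p 0 k + r * (\<kappa> * M (Suc k))" for k
  proof -
    have "\<kappa> * Q k = Q k - z * (of_real t * (M 0 * Q k))" by (simp add: \<kappa> algebra_simps)
    then have "\<kappa> * Q k = M (Suc k)" using E2[of k] by (metis add_diff_cancel_right')
    moreover have "\<kappa> * M k = M k - z * (of_real t * (M 0 * M k))" by (simp add: \<kappa> algebra_simps)
    then have "\<kappa> * M k = p 0 k + z * Q k" using E1[of k] by (metis add_diff_cancel_right' add.assoc distrib_left)
    ultimately show ?thesis using \<kappa>0
      by (simp add: r_def power2_eq_square field_simps)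
  qed
  have part: "\<kappa> * M 0 = (\<Sum>k<N. r ^ k * p 0 k) + r ^ N * (\<kappa> * M N)" for N
  proof (induction N)
    case (Suc N)
    then show ?case using step[of N] by (simp add: algebra_simps)
  qed simp
  have "(\<lambda>N. r ^ N * (\<kappa> * M N)) \<longlonglongrightarrow> 0"
  proof (rule Lim_null_comparison)
    have "norm (r ^ N * (\<kappa> * M N)) \<le> (2 * norm \<kappa>) * (1/2) ^ N" for N
    proof -
      have "norm (r ^ N * (\<kappa> * M N)) \<le> norm r ^ N * (norm \<kappa> * (2 * L ^ N))"
        unfolding norm_mult norm_power by (intro mult_left_mono Mbd) auto
      also have "\<dots> = (2 * norm \<kappa>) * (norm r * L) ^ N" by (simp add: power_mult_distrib mult_ac)
      also have "\<dots> \<le> (2 * norm \<kappa>) * (1/2) ^ N"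
        using rL L by (intro mult_left_mono power_mono) auto
      finally show ?thesis .
    qed
    then show "\<forall>\<^sub>F N in sequentially. norm (r ^ N * (\<kappa> * M N)) \<le> (2 * norm \<kappa>) * (1/2) ^ N" by simp
    show "(\<lambda>N. (2 * norm \<kappa>) * (1/2) ^ N) \<longlonglongrightarrow> 0"
      by (intro tendsto_mult_right_zero LIMSEQ_power_zero) simp
  qed
  then have "(\<lambda>N. \<kappa> * M 0 - r ^ N * (\<kappa> * M N)) \<longlonglongrightarrow> \<kappa> * M 0 - 0"
    by (intro tendsto_diff tendsto_const)
  moreover have "\<kappa> * M 0 - r ^ N * (\<kappa> * M N) = (\<Sum>k<N. r ^ k * p 0 k)" for N using part[of N] by simp
  ultimately show "(\<lambda>k. (of_real \<zeta> / \<kappa>\<^sup>2) ^ k * p 0 k) sums (\<kappa> * m)"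
    by (simp add: sums_def mM r_def z_def)
qed

locale subord = N: bounded_pos \<nu> "\<lambda>x. x" R + K: bounded_pos \<mu> s L
  for \<nu> \<mu> s R L +
  fixes t \<eta>0 :: real
  assumes t: "t > 0" and \<eta>0: "\<eta>0 \<ge> 0"
    and large: "\<eta> > \<eta>0 \<Longrightarrow> \<eta> * N.res (\<eta>\<^sup>2) =
      (\<eta> + t * (\<eta> * N.res (\<eta>\<^sup>2))) * K.res ((\<eta> + t * (\<eta> * N.res (\<eta>\<^sup>2)))\<^sup>2)"
begin

definition "g \<eta> = \<eta> * N.res (\<eta>\<^sup>2)"
definition "w \<eta> = \<eta> + t * g \<eta>"

lemma square_not_nonpos: "Re z > 0 \<Longrightarrow> z\<^sup>2 \<notin> \<real>\<^sub>\<le>\<^sub>0"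
  by (auto simp: complex_nonpos_Reals_iff power2_eq_square mult_le_0_iff)

text \<open>For x >= 0 the real part of z / (x + z^2) has the sign of Re z (x + |z|^2). Consequently
  z + t g(z) stays in the right half plane, and its square avoids the cut of the resolvent of
  \<mu>.\<close>

lemma Re_cres_pos:
  assumes "Re z > 0"
  shows "Re (z * N.cres (z\<^sup>2)) \<ge> 0"
proof -
  have *: "Re (z / (of_real x + z\<^sup>2)) \<ge> 0" if "x \<ge> 0" for x
  proof -
    have "Re (z * cnj (of_real x + z\<^sup>2)) = Re z * (x + (cmod z)\<^sup>2)"
      unfolding cmod_power2 by (simp add: power2_eq_square algebra_simps)
    then show ?thesis using assms that by (simp only: Re_complex_div_ge_0) simp
  qed
  have pos: "AE x in \<nu>. Re (z / (of_real x + z\<^sup>2)) \<ge> 0"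
    using N.s_bd by (rule eventually_mono) (use * in auto)
  have "z * N.cres (z\<^sup>2) = (\<integral>x. z * (1 / (of_real x + z\<^sup>2)) \<partial>\<nu>)"
    unfolding N.cres_def by (rule integral_mult_right_zero[symmetric])
  then have eq: "z * N.cres (z\<^sup>2) = (\<integral>x. z / (of_real x + z\<^sup>2) \<partial>\<nu>)" by simp
  show ?thesis
  proof (cases "integrable \<nu> (\<lambda>x. z / (of_real x + z\<^sup>2))")
    case True
    then have "Re (z * N.cres (z\<^sup>2)) = (\<integral>x. Re (z / (of_real x + z\<^sup>2)) \<partial>\<nu>)"
      unfolding eq by simp
    then show ?thesis using integral_nonneg_AE[OF pos] by simp
  next
    case False
    \<comment> \<open>The Bochner integral of a non-integrable function is 0.\<close>
    then show ?thesis unfolding eq by (simp add: not_integrable_integral_eq)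
  qed
qed

lemma subordination:
  assumes "\<eta> > 0"
  shows "g \<eta> = w \<eta> * K.res ((w \<eta>)\<^sup>2)"
proof -
  define G where "G z = z * N.cres (z\<^sup>2)" for z
  define W where "W z = z + of_real t * G z" for z
  define F where "F z = G z - W z * K.cres ((W z)\<^sup>2)" for z
  define S where "S = {z. Re z > 0}"
  have S: "open S" "connected S" unfolding S_def
    by (simp_all add: open_halfspace_Re_gt convex_connected convex_halfspace_Re_gt)
  have Nh: "N.cres holomorphic_on - \<real>\<^sub>\<le>\<^sub>0" and Kh: "K.cres holomorphic_on - \<real>\<^sub>\<le>\<^sub>0"
    using N.cres_deriv K.cres_deriv
    by (auto simp: holomorphic_on_def field_differentiable_def intro: has_field_derivative_at_within)
  have Gh: "G holomorphic_on S"
    unfolding G_def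
    by (intro holomorphic_intros holomorphic_on_compose_gen[OF _ Nh, unfolded comp_def])
      (auto simp: S_def square_not_nonpos)
  have WS: "W z \<in> S" if "z \<in> S" for z
    using Re_cres_pos[of z] that t by (simp add: S_def W_def G_def) (smt (verit) mult_nonneg_nonneg)
  have Wh: "W holomorphic_on S" unfolding W_def by (intro holomorphic_intros Gh)
  have Fh: "F holomorphic_on S"
    unfolding F_def
    by (intro holomorphic_intros Gh Wh holomorphic_on_compose_gen[OF _ Kh, unfolded comp_def])
      (use WS in \<open>auto simp: S_def square_not_nonpos\<close>)
  have Gr: "G (of_real y) = of_real (g y)" for y
    by (simp add: G_def g_def N.cres_of_real[symmetric])
  have Wr: "W (of_real y) = of_real (w y)" for y by (simp add: W_def w_def Gr)
  have Fr: "F (of_real y) = of_real (g y - w y * K.res ((w y)\<^sup>2))" for y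
    by (simp add: F_def Gr Wr K.cres_of_real[symmetric])
  have "F (of_real \<eta>) = 0"
  proof (rule analytic_continuation[OF Fh S])
    show "of_real (\<eta>0 + 1) \<in> S" "of_real \<eta> \<in> S" using \<eta>0 assms by (auto simp: S_def)
    show "of_real ` {\<eta>0<..} \<subseteq> S" using \<eta>0 by (auto simp: S_def)
    show "F z = 0" if "z \<in> of_real ` {\<eta>0<..}" for z
      using that large by (auto simp: Fr g_def w_def)
    show "complex_of_real (\<eta>0 + 1) islimpt of_real ` {\<eta>0<..}"
      unfolding islimpt_approachable
    proof (intro allI impI)
      fix e :: real assume "e > 0"
      then show "\<exists>x'\<in>complex_of_real ` {\<eta>0<..}. x' \<noteq> of_real (\<eta>0 + 1) \<and> dist x' (of_real (\<eta>0 + 1)) < e"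
        by (intro bexI[of _ "of_real (\<eta>0 + 1 + e / 2)"]) (auto simp: dist_norm simp flip: of_real_add of_real_diff)
    qed
  qed
  then show ?thesis unfolding Fr of_real_eq_0_iff by simp
qed

lemma g_pos: "\<eta> > 0 \<Longrightarrow> g \<eta> > 0" and g_le: "\<eta> > 0 \<Longrightarrow> g \<eta> \<le> 1 / \<eta>"
proof -
  assume \<eta>: "\<eta> > 0"
  show "g \<eta> > 0" unfolding g_def using N.res_bounds[of "\<eta>\<^sup>2"] \<eta> by simp
  have "\<eta> * N.res (\<eta>\<^sup>2) \<le> \<eta> * (1 / \<eta>\<^sup>2)"
    using N.res_bounds[of "\<eta>\<^sup>2"] \<eta> by (intro mult_left_mono) auto
  then show "g \<eta> \<le> 1 / \<eta>" using \<eta> by (simp add: g_def power2_eq_square)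
qed

lemma w_ge: "\<eta> > 0 \<Longrightarrow> w \<eta> > \<eta>"
  using g_pos t by (simp add: w_def)

lemma g_differentiable:
  assumes "\<eta> > 0" shows "\<exists>g'. (g has_field_derivative g') (at \<eta>)"
proof -
  obtain r' where r': "(N.res has_field_derivative r') (at (\<eta>\<^sup>2))"
    using N.res_differentiable[of "\<eta>\<^sup>2"] assms by (auto simp: field_differentiable_def)
  have "((\<lambda>x. N.res (x\<^sup>2)) has_field_derivative r' * (2 * \<eta>)) (at \<eta>)"
    by (rule DERIV_chain2[where g = "\<lambda>x. x\<^sup>2", OF r']) (auto intro!: derivative_eq_intros)
  from DERIV_mult[OF DERIV_ident this] show ?thesis unfolding g_def by blast
qed

text \<open>With w' = 1 + t g', subordination turns the derivative of the difference into 2 g - (2 g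
  (1 + t g') - 2 t g g') = 0, and the difference vanishes at infinity.\<close>

lemma logint_formula:
  assumes "\<eta> > 0"
  shows "N.logint (\<eta>\<^sup>2) = K.logint ((w \<eta>)\<^sup>2) - t * (g \<eta>)\<^sup>2"
proof -
  define D where "D x = N.logint (x\<^sup>2) - (K.logint ((w x)\<^sup>2) - t * (g x)\<^sup>2)" for x
  have D': "(D has_field_derivative 0) (at x)" if x: "x > 0" for x
  proof -
    obtain g' where g': "(g has_field_derivative g') (at x)" using g_differentiable[OF x] by blast
    have w': "(w has_field_derivative 1 + t * g') (at x)"
      unfolding w_def by (auto intro!: derivative_eq_intros g')
    have wx: "w x > 0" using w_ge[OF x] x by simp
    have 1: "((\<lambda>x. N.logint (x\<^sup>2)) has_field_derivative N.res (x\<^sup>2) * (2 * x)) (at x)"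
      by (rule DERIV_chain2[OF N.logint_deriv]) (use x in \<open>auto intro!: derivative_eq_intros\<close>)
    have 2: "((\<lambda>x. K.logint ((w x)\<^sup>2)) has_field_derivative K.res ((w x)\<^sup>2) * (2 * w x * (1 + t * g'))) (at x)"
      by (rule DERIV_chain2[OF K.logint_deriv]) (use wx in \<open>auto intro!: derivative_eq_intros w'\<close>)
    have 3: "((\<lambda>x. t * (g x)\<^sup>2) has_field_derivative t * (2 * g x * g')) (at x)"
      by (auto intro!: derivative_eq_intros g')
    have "(D has_field_derivative N.res (x\<^sup>2) * (2 * x) - (K.res ((w x)\<^sup>2) * (2 * w x * (1 + t * g')) - t * (2 * g x * g'))) (at x)"
      unfolding D_def by (intro DERIV_diff 1 2 3)
    moreover have "N.res (x\<^sup>2) * (2 * x) = 2 * g x" by (simp add: g_def)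
    moreover have "K.res ((w x)\<^sup>2) * (2 * w x * (1 + t * g')) = 2 * g x * (1 + t * g')"
      using subordination[OF x] by (simp add: mult_ac)
    moreover have "2 * g x - (2 * g x * (1 + t * g') - t * (2 * g x * g')) = 0" by (simp add: algebra_simps)
    ultimately show ?thesis by (simp only:)
  qed
  have const: "D x = D y" if "x > 0" "y > 0" for x y
  proof -
    have "\<exists>c. \<forall>x\<in>{0<..}. D x = c"
      by (rule has_field_derivative_zero_constant) (auto intro: has_field_derivative_at_within D')
    then show ?thesis using that by auto
  qed
  \<comment> \<open>Each logarithmic integral is close to the logarithm of its shift, with errors R
    / x^2 and L / x^2. The two shifts differ by the factor (1 + t res)^2, which costs 2 t / x^2, and
    the term t g^2 costs t / x^2.\<close>
  have bound: "\<bar>D x\<bar> \<le> (R + L + 3 * t) / x\<^sup>2" if x: "x > 0" for x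
  proof -
    have wx: "w x > x" by (rule w_ge[OF x])
    have a: "0 \<le> N.logint (x\<^sup>2) - ln (x\<^sup>2)" "N.logint (x\<^sup>2) - ln (x\<^sup>2) \<le> R / x\<^sup>2"
      using N.logint_asymp[of "x\<^sup>2"] x by auto
    have b: "0 \<le> K.logint ((w x)\<^sup>2) - ln ((w x)\<^sup>2)" "K.logint ((w x)\<^sup>2) - ln ((w x)\<^sup>2) \<le> L / (w x)\<^sup>2"
      using K.logint_asymp[of "(w x)\<^sup>2"] x wx by auto
    have b': "L / (w x)\<^sup>2 \<le> L / x\<^sup>2"
      using K.L_nonneg x wx by (intro divide_left_mono power_mono) auto
    have c: "ln ((w x)\<^sup>2) - ln (x\<^sup>2) = 2 * ln (1 + t * N.res (x\<^sup>2))"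
    proof -
      have "w x / x = 1 + t * N.res (x\<^sup>2)" using x by (simp add: w_def g_def field_simps)
      moreover have "ln (w x / x) = ln (w x) - ln x" using x wx ln_div[of "w x" x] by simp
      ultimately show ?thesis using x wx by (simp add: ln_realpow)
    qed
    have c1: "0 \<le> ln (1 + t * N.res (x\<^sup>2))" "ln (1 + t * N.res (x\<^sup>2)) \<le> t * N.res (x\<^sup>2)"
      using N.res_bounds[of "x\<^sup>2"] x t by (auto intro!: ln_add_one_self_le_self)
    have c2: "t * N.res (x\<^sup>2) \<le> t / x\<^sup>2"
      using N.res_bounds[of "x\<^sup>2"] x t mult_left_mono[of "N.res (x\<^sup>2)" "1 / x\<^sup>2" t] by simp
    have "(g x)\<^sup>2 \<le> (1 / x)\<^sup>2" using g_le[OF x] g_pos[OF x] by (intro power_mono) auto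
    then have "t * (g x)\<^sup>2 \<le> t * (1 / x)\<^sup>2" using t by (intro mult_left_mono) auto
    then have d: "0 \<le> t * (g x)\<^sup>2" "t * (g x)\<^sup>2 \<le> t / x\<^sup>2" using t by (auto simp: power_divide)
    have "(R + L + 3 * t) / x\<^sup>2 = R / x\<^sup>2 + L / x\<^sup>2 + 3 * (t / x\<^sup>2)" by (simp add: add_divide_distrib)
    moreover have "0 \<le> R / x\<^sup>2" "0 \<le> L / x\<^sup>2" "0 \<le> t / x\<^sup>2" using N.L_nonneg K.L_nonneg t by auto
    ultimately show ?thesis
      using a b b' c c1 c2 d unfolding D_def by linarith
  qed
  have "D \<eta> = 0"
  proof -
    have "((\<lambda>x. D x) \<longlongrightarrow> 0) at_top"
    proof (rule Lim_null_comparison)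
      show "\<forall>\<^sub>F x in at_top. norm (D x) \<le> (R + L + 3 * t) / x\<^sup>2"
        using eventually_gt_at_top[of 0] by eventually_elim (simp add: bound)
      show "((\<lambda>x. (R + L + 3 * t) / x\<^sup>2) \<longlongrightarrow> 0) at_top" by real_asymp
    qed
    moreover have "((\<lambda>x. D x) \<longlongrightarrow> D \<eta>) at_top"
      by (rule tendsto_eventually, rule eventually_mono[OF eventually_gt_at_top[of 0]]) (rule const[OF _ assms])
    ultimately show ?thesis using tendsto_unique[of at_top] by force
  qed
  then show ?thesis by (simp add: D_def)
qed

lemma logint_limit:
  assumes s0: "s0 > 0" "K.res s0 = 1 / t"
  shows "((\<lambda>\<eta>. N.logint (\<eta>\<^sup>2)) \<longlongrightarrow> K.logint s0 - s0 / t) (at_right 0)"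
proof -
  \<comment> \<open>Subordination solved for the resolvent of \<mu>. The right-hand side is below 1
    / t, the value at \<open>s0\<close>, so by monotonicity w^2 exceeds \<open>s0\<close>.\<close>
  have eq: "K.res ((w \<eta>)\<^sup>2) = (1 - \<eta> / w \<eta>) / t" if \<eta>: "\<eta> > 0" for \<eta>
  proof -
    have "w \<eta> = \<eta> + t * (w \<eta> * K.res ((w \<eta>)\<^sup>2))"
      using subordination[OF \<eta>] w_def[of \<eta>] by simp
    then show ?thesis using w_ge[OF \<eta>] \<eta> t by (simp add: field_simps)
  qed
  have w_lower: "(w \<eta>)\<^sup>2 > s0" if \<eta>: "\<eta> > 0" for \<eta>
  proof (rule ccontr)
    assume "\<not> s0 < (w \<eta>)\<^sup>2"
    moreover have w0: "w \<eta> > 0" using w_ge[OF \<eta>] \<eta> by simp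
    ultimately have "K.res s0 \<le> K.res ((w \<eta>)\<^sup>2)"
      using K.res_strict_antimono[of "(w \<eta>)\<^sup>2" s0] by (cases "(w \<eta>)\<^sup>2 = s0") auto
    then have "1 / t \<le> (1 - \<eta> / w \<eta>) / t" using eq[OF \<eta>] s0 by simp
    moreover have "\<eta> / w \<eta> > 0" using w0 \<eta> by simp
    ultimately show False using t by (simp add: field_simps)
  qed
  have w2: "((\<lambda>\<eta>. (w \<eta>)\<^sup>2) \<longlongrightarrow> s0) (at_right 0)"
  proof (rule order_tendstoI)
    show "\<forall>\<^sub>F \<eta> in at_right 0. a < (w \<eta>)\<^sup>2" if "a < s0" for a
      using eventually_at_right_less[of 0] by eventually_elim (use w_lower that in force)
    fix s1 assume s1: "s1 > s0"
    \<comment> \<open>If w^2 were at least \<open>s1\<close>, then \<eta> / w would be at least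
      \<delta>, which is impossible for small \<eta> because w stays above sqrt
      \<open>s0\<close>.\<close>
    define \<delta> where "\<delta> = 1 - t * K.res s1"
    have "\<delta> > 0" using K.res_strict_antimono[OF s0(1) s1] s0 t by (simp add: \<delta>_def field_simps)
    then have "\<delta> * sqrt s0 > 0" using s0 by simp
    then have "\<forall>\<^sub>F \<eta> in at_right 0. \<eta> < \<delta> * sqrt s0" by (rule order_tendstoD[OF tendsto_ident_at])
    then show "\<forall>\<^sub>F \<eta> in at_right 0. (w \<eta>)\<^sup>2 < s1"
      using eventually_at_right_less[of 0]
    proof eventually_elim
      case (elim \<eta>)
      show ?case
      proof (rule ccontr)
        assume "\<not> (w \<eta>)\<^sup>2 < s1"
        then have "K.res ((w \<eta>)\<^sup>2) \<le> K.res s1"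
          using K.res_strict_antimono[of s1 "(w \<eta>)\<^sup>2"] s0 s1 by (cases "(w \<eta>)\<^sup>2 = s1") auto
        then have "1 - \<eta> / w \<eta> \<le> t * K.res s1" using eq[of \<eta>] elim t by (simp add: field_simps)
        then have "\<delta> \<le> \<eta> / w \<eta>" by (simp add: \<delta>_def)
        moreover have w0: "w \<eta> > 0" using w_ge[of \<eta>] elim by simp
        ultimately have "\<delta> * w \<eta> \<le> \<eta>" by (simp add: field_simps)
        moreover have "sqrt s0 \<le> w \<eta>" using w_lower[of \<eta>] elim w0 by (intro real_le_lsqrt) auto
        ultimately show False using elim \<open>\<delta> > 0\<close> mult_left_mono[of "sqrt s0" "w \<eta>" \<delta>] by linarith
      qed
    qed
  qed
  have wlim: "(w \<longlongrightarrow> sqrt s0) (at_right 0)"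
  proof (rule Lim_transform_eventually[OF tendsto_real_sqrt[OF w2]])
    show "\<forall>\<^sub>F \<eta> in at_right 0. sqrt ((w \<eta>)\<^sup>2) = w \<eta>"
      using eventually_at_right_less[of 0] by eventually_elim (use w_ge in force)
  qed
  have "((\<lambda>\<eta>. (w \<eta> - \<eta>)\<^sup>2 / t) \<longlongrightarrow> (sqrt s0 - 0)\<^sup>2 / t) (at_right 0)"
    by (intro tendsto_intros wlim) (use t in auto)
  moreover have "t * (g \<eta>)\<^sup>2 = (w \<eta> - \<eta>)\<^sup>2 / t" for \<eta>
    using t by (simp add: w_def power_mult_distrib power2_eq_square)
  ultimately have tg: "((\<lambda>\<eta>. t * (g \<eta>)\<^sup>2) \<longlongrightarrow> s0 / t) (at_right 0)" using s0 by simp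
  have "isCont K.logint s0" using K.logint_deriv[OF s0(1)] by (rule DERIV_isCont)
  then have "((\<lambda>\<eta>. K.logint ((w \<eta>)\<^sup>2)) \<longlongrightarrow> K.logint s0) (at_right 0)"
    using w2 by (rule isCont_tendsto_compose)
  then have "((\<lambda>\<eta>. K.logint ((w \<eta>)\<^sup>2) - t * (g \<eta>)\<^sup>2) \<longlongrightarrow> K.logint s0 - s0 / t) (at_right 0)"
    using tg by (rule tendsto_diff)
  then show ?thesis
  proof (rule Lim_transform_eventually)
    show "\<forall>\<^sub>F \<eta> in at_right 0. K.logint ((w \<eta>)\<^sup>2) - t * (g \<eta>)\<^sup>2 = N.logint (\<eta>\<^sup>2)"
      using eventually_at_right_less[of 0] by eventually_elim (simp add: logint_formula)
  qed
qed

end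

subsection \<open>The limit of the regularized logarithm\<close>

text \<open>At \<zeta> = - 1 / \<eta>^2 the generating function m is \<eta> g, hence \<kappa> = w /
  \<eta> and \<zeta> / \<kappa>^2 = - 1 / w^2. Both moment series thus become resolvent integrals,
  and \<kappa> m = w g yields the equation after division by w.\<close>

lemma subord_large:
  fixes p q :: "nat \<Rightarrow> nat \<Rightarrow> complex" and t C R L :: real
  assumes "bounded_pos \<nu> (\<lambda>x. x) R" "bounded_pos \<mu> s L"
    and rec1: "\<And>n k. p (Suc n) k = q n k + of_real t * (\<Sum>j\<le>n. p j 0 * p (n - j) k)"
    and rec2: "\<And>n k. q n k = p n (Suc k) + of_real t * (\<Sum>j<n. p j 0 * q (n - Suc j) k)"
    and bd: "\<And>n k. norm (p n k) \<le> C ^ n * L ^ k"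
    and p\<nu>: "\<And>n. p n 0 = of_real (\<integral>x. x ^ n \<partial>\<nu>)"
    and p\<mu>: "\<And>k. p 0 k = of_real (\<integral>x. s x ^ k \<partial>\<mu>)"
    and C: "C \<ge> 1" and L: "L \<ge> 1" and t: "t > 0"
  shows "subord \<nu> \<mu> s R L t (8 * (C + L + R + t))"
proof -
  interpret N: bounded_pos \<nu> "\<lambda>x. x" R by fact
  interpret K: bounded_pos \<mu> s L by fact
  show ?thesis
  proof
    show "t > 0" "0 \<le> 8 * (C + L + R + t)" using t C L N.L_nonneg by auto
    fix \<eta> :: real assume \<eta>: "\<eta> > 8 * (C + L + R + t)"
    define \<zeta> where "\<zeta> = - 1 / \<eta>\<^sup>2"
    define Y where "Y = C + L + R + t"
    have Y: "Y \<ge> 1" using C L t N.L_nonneg unfolding Y_def by linarith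
    have \<eta>Y: "\<eta> > 8 * Y" using \<eta> by (simp only: Y_def)
    have \<eta>1: "\<eta> > 1" using \<eta>Y Y by simp
    have \<eta>2: "\<eta>\<^sup>2 \<ge> \<eta>" using \<eta>1 by (simp add: power2_eq_square)
    \<comment> \<open>Since \<eta> > 1, the square dominates \<eta>, so a threshold linear in the
      four constants suffices.\<close>
    have small: "\<bar>\<zeta>\<bar> * y \<le> 1 / 8" if "y \<le> Y" for y
    proof -
      have "8 * y \<le> \<eta>\<^sup>2" using that \<eta>Y \<eta>2 by simp
      then show ?thesis using \<eta>1 by (simp add: \<zeta>_def field_simps)
    qed
    have sC: "\<bar>\<zeta>\<bar> * C \<le> 1 / 8" and st: "\<bar>\<zeta>\<bar> * t \<le> 1 / 8" and sL: "\<bar>\<zeta>\<bar> * L \<le> 1 / 8" and sR: "\<bar>\<zeta>\<bar> * R \<le> 1 / 8"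
      by (rule small, use C L t N.L_nonneg in \<open>simp add: Y_def\<close>)+
    define m where "m = (\<Sum>n. p n 0 * complex_of_real \<zeta> ^ n)"
    define \<kappa> where "\<kappa> = 1 - of_real t * of_real \<zeta> * m"
    note ms = moment_recursion_sums[OF rec1 rec2 bd C L t sC st sL, folded m_def, folded \<kappa>_def]
    define y where "y = N.res (\<eta>\<^sup>2)"
    define w where "w = \<eta> + t * (\<eta> * y)"
    have y0: "y > 0" unfolding y_def using N.res_bounds[of "\<eta>\<^sup>2"] \<eta>1 by simp
    have w0: "w > 0" unfolding w_def using y0 \<eta>1 t by (intro add_pos_pos mult_pos_pos) auto
    have "(\<lambda>n. of_real \<zeta> ^ n * of_real (\<integral>x. x ^ n \<partial>\<nu>)) sums (\<integral>x. 1 / (1 - of_real \<zeta> * complex_of_real x) \<partial>\<nu>)"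
      by (rule N.geometric_moments) (use sR in simp)
    then have "m = (\<integral>x. 1 / (1 - of_real \<zeta> * complex_of_real x) \<partial>\<nu>)"
      unfolding m_def p\<nu> by (simp add: mult.commute sums_iff)
    also have "\<dots> = (\<integral>x. complex_of_real (\<eta>\<^sup>2 * (1 / (x + \<eta>\<^sup>2))) \<partial>\<nu>)"
    proof (rule integral_cong_AE)
      show "AE x in \<nu>. 1 / (1 - of_real \<zeta> * complex_of_real x) = complex_of_real (\<eta>\<^sup>2 * (1 / (x + \<eta>\<^sup>2)))"
        using N.s_bd
      proof eventually_elim
        case (elim x)
        have "1 / (1 - \<zeta> * x) = \<eta>\<^sup>2 * (1 / (x + \<eta>\<^sup>2))"
          using \<eta>1 elim by (simp add: \<zeta>_def divide_simps add_nonneg_eq_0_iff)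
        then have "complex_of_real (1 / (1 - \<zeta> * x)) = complex_of_real (\<eta>\<^sup>2 * (1 / (x + \<eta>\<^sup>2)))" by (simp only:)
        then show ?case by simp
      qed
    qed (use N.s_meas in measurable)
    also have "\<dots> = of_real (\<eta>\<^sup>2 * y)"
      unfolding integral_complex_of_real integral_mult_right_zero y_def N.res_def ..
    finally have m: "m = of_real (\<eta>\<^sup>2 * y)" .
    have \<kappa>: "\<kappa> = of_real (w / \<eta>)"
    proof -
      have "w / \<eta> = 1 - t * \<zeta> * (\<eta>\<^sup>2 * y)" using \<eta>1 by (simp add: w_def \<zeta>_def field_simps)
      then show ?thesis unfolding \<kappa>_def m by simp
    qed
    have r: "complex_of_real \<zeta> / \<kappa>\<^sup>2 = of_real (- 1 / w\<^sup>2)"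
    proof -
      have "\<zeta> / (w / \<eta>)\<^sup>2 = - 1 / w\<^sup>2" using \<eta>1 w0 by (simp add: \<zeta>_def field_simps)
      then show ?thesis unfolding \<kappa> by (metis of_real_divide of_real_power)
    qed
    have "(\<lambda>k. of_real (- 1 / w\<^sup>2) ^ k * of_real (\<integral>x. s x ^ k \<partial>\<mu>)) sums
        (\<integral>x. 1 / (1 - complex_of_real (- 1 / w\<^sup>2) * of_real (s x)) \<partial>\<mu>)"
      by (rule K.geometric_moments) (use ms(2) r in simp)
    then have "\<kappa> * m = (\<integral>x. 1 / (1 - complex_of_real (- 1 / w\<^sup>2) * of_real (s x)) \<partial>\<mu>)"
      using sums_unique2[OF ms(3)] unfolding r p\<mu> by blast
    also have "\<dots> = (\<integral>x. complex_of_real (w\<^sup>2 * (1 / (s x + w\<^sup>2))) \<partial>\<mu>)"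
    proof (rule integral_cong_AE)
      show "AE x in \<mu>. 1 / (1 - complex_of_real (- 1 / w\<^sup>2) * of_real (s x)) = complex_of_real (w\<^sup>2 * (1 / (s x + w\<^sup>2)))"
        using K.s_bd
      proof eventually_elim
        case (elim x)
        have "1 / (1 - (- 1 / w\<^sup>2) * s x) = w\<^sup>2 * (1 / (s x + w\<^sup>2))"
          using w0 elim by (simp add: divide_simps add_nonneg_eq_0_iff)
        then have "complex_of_real (1 / (1 - (- 1 / w\<^sup>2) * s x)) = complex_of_real (w\<^sup>2 * (1 / (s x + w\<^sup>2)))" by (simp only:)
        then show ?case by simp
      qed
    qed (use K.s_meas in measurable)
    also have "\<dots> = of_real (w\<^sup>2 * K.res (w\<^sup>2))"
      unfolding integral_complex_of_real integral_mult_right_zero K.res_def ..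
    finally have "complex_of_real (w / \<eta> * (\<eta>\<^sup>2 * y)) = of_real (w\<^sup>2 * K.res (w\<^sup>2))"
      unfolding \<kappa> m by simp
    then have "w / \<eta> * (\<eta>\<^sup>2 * y) = w\<^sup>2 * K.res (w\<^sup>2)" by (simp only: of_real_eq_iff)
    then have "w * (\<eta> * y) = w * (w * K.res (w\<^sup>2))" using \<eta>1 by (simp add: power2_eq_square mult_ac)
    then have "\<eta> * y = w * K.res (w\<^sup>2)" using w0 by simp
    then show "\<eta> * N.res (\<eta>\<^sup>2) = (\<eta> + t * (\<eta> * N.res (\<eta>\<^sup>2))) * K.res ((\<eta> + t * (\<eta> * N.res (\<eta>\<^sup>2)))\<^sup>2)"
      by (simp only: w_def y_def)
  qed
qed

section \<open>The integral equation for \<open>v_fun\<close>\<close>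

locale compact_measure = prob_space \<mu> for \<mu> :: "real measure" +
  fixes B t :: real
  assumes sets_mu [measurable_cong]: "sets \<mu> = sets borel" and mu_bd: "AE x in \<mu>. \<bar>x\<bar> \<le> B"
    and t: "t > 0"
begin

lemma B_nonneg: "B \<ge> 0"
proof (rule ccontr)
  assume "\<not> B \<ge> 0"
  then have "AE x in \<mu>. False" by (intro eventually_mono[OF mu_bd]) auto
  then show False by (simp add: AE_False)
qed

lemma bounded_pos_shift:
  assumes "L \<ge> (\<bar>a\<bar> + B)\<^sup>2 + b\<^sup>2"
  shows "bounded_pos \<mu> (\<lambda>x. (a - x)\<^sup>2 + b\<^sup>2) L"
proof
  show "AE x in \<mu>. 0 \<le> (a - x)\<^sup>2 + b\<^sup>2 \<and> (a - x)\<^sup>2 + b\<^sup>2 \<le> L"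
    using mu_bd
  proof eventually_elim
    case (elim x)
    then have "\<bar>a - x\<bar> \<le> \<bar>a\<bar> + B" by linarith
    then have "(a - x)\<^sup>2 \<le> (\<bar>a\<bar> + B)\<^sup>2" using power_mono[of "\<bar>a - x\<bar>" _ 2] by simp
    then show ?case using assms by auto
  qed
qed measurable

definition vint :: "real \<Rightarrow> real \<Rightarrow> real" where
  "vint a y = (\<integral>x. 1 / ((a - x)\<^sup>2 + y\<^sup>2) \<partial>\<mu>)"

lemma bounded_pos_a: "bounded_pos \<mu> (\<lambda>x. (a - x)\<^sup>2) ((\<bar>a\<bar> + B)\<^sup>2)"
  using bounded_pos_shift[of a 0] by simp

lemma vint_res: "vint a y = bounded_pos.res \<mu> (\<lambda>x. (a - x)\<^sup>2) (y\<^sup>2)"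
  using bounded_pos.res_def[OF bounded_pos_a] by (simp add: vint_def)

lemma vint_strict: assumes "0 < y" "y < y'" shows "vint a y' < vint a y"
  unfolding vint_res
  by (rule bounded_pos.res_strict_antimono[OF bounded_pos_a]) (use assms in \<open>auto intro: power_strict_mono\<close>)

lemma v_fun_eq:
  assumes "y > 0" "vint a y = 1 / t"
  shows "v_fun \<mu> t a = y"
  unfolding v_fun_def
proof (rule cInf_eq_minimum)
  show "y \<in> {b. 0 < b \<and> (\<integral>x. 1 / ((a - x)\<^sup>2 + b\<^sup>2) \<partial>\<mu>) \<le> 1 / t}"
    using assms by (simp add: vint_def)
  fix b assume "b \<in> {b. 0 < b \<and> (\<integral>x. 1 / ((a - x)\<^sup>2 + b\<^sup>2) \<partial>\<mu>) \<le> 1 / t}"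
  then have b: "0 < b" "vint a b \<le> vint a y" using assms by (auto simp: vint_def)
  show "y \<le> b"
  proof (rule ccontr)
    assume "\<not> y \<le> b"
    then show False using vint_strict[of b y a] b by simp
  qed
qed

text \<open>By continuity at the positive infimum: a value above 1 / t would hold on a whole
  neighbourhood and move the infimum to the right, a value below 1 / t would move it to the
  left.\<close>

lemma vint_v_fun:
  assumes "v_fun \<mu> t a > 0"
  shows "vint a (v_fun \<mu> t a) = 1 / t"
proof -
  define v where "v = v_fun \<mu> t a"
  define S where "S = {b. 0 < b \<and> vint a b \<le> 1 / t}"
  have vS: "v = Inf S" by (simp add: v_def v_fun_def S_def vint_def)
  have v: "v > 0" using assms by (simp add: v_def)
  have bdd: "bdd_below S" by (rule bdd_belowI[of _ 0]) (auto simp: S_def)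
  \<comment> \<open>The resolvent at \<open>t\<close> never exceeds 1 / t, so the infimum is over a
    nonempty set.\<close>
  have "sqrt t \<in> S"
    using t bounded_pos.res_bounds(2)[OF bounded_pos_a, of t a] by (simp add: S_def vint_res)
  then have ne: "S \<noteq> {}" by blast
  have cont: "(vint a \<longlongrightarrow> vint a v) (nhds v)"
  proof -
    have "isCont (bounded_pos.res \<mu> (\<lambda>x. (a - x)\<^sup>2)) (v\<^sup>2)"
      using bounded_pos.res_differentiable[OF bounded_pos_a, of "v\<^sup>2" a] v
        field_differentiable_imp_continuous_at by auto
    then have "isCont (\<lambda>y. bounded_pos.res \<mu> (\<lambda>x. (a - x)\<^sup>2) (y\<^sup>2)) v"
      by (rule isCont_o2[where f = "\<lambda>y. y\<^sup>2", rotated]) simp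
    then have "isCont (vint a) v" unfolding vint_res[abs_def] .
    then show ?thesis unfolding isCont_def by (simp only: tendsto_at_iff_tendsto_nhds)
  qed
  have "vint a v \<le> 1 / t"
  proof (rule ccontr)
    assume "\<not> vint a v \<le> 1 / t"
    then have "\<forall>\<^sub>F y in nhds v. vint a y > 1 / t"
      using order_tendstoD(1)[OF cont, of "1 / t"] by simp
    then obtain e where e: "e > 0" "\<And>y. dist y v < e \<Longrightarrow> vint a y > 1 / t"
      by (auto simp: eventually_nhds_metric)
    obtain y where y: "y \<in> S" "y < v + e" using cInf_lessD[OF ne, of "v + e"] e vS by auto
    have "v \<le> y" using cInf_lower[OF y(1) bdd] vS by simp
    then have "dist y v < e" using y by (simp add: dist_real_def)
    then show False using e(2)[of y] y by (simp add: S_def)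
  qed
  moreover have "vint a v \<ge> 1 / t"
  proof (rule ccontr)
    assume "\<not> vint a v \<ge> 1 / t"
    then have "\<forall>\<^sub>F y in nhds v. vint a y < 1 / t"
      using order_tendstoD(2)[OF cont, of "1 / t"] by simp
    then obtain e where e: "e > 0" "\<And>y. dist y v < e \<Longrightarrow> vint a y < 1 / t"
      by (auto simp: eventually_nhds_metric)
    define y where "y = v - min (e / 2) (v / 2)"
    have "dist y v < e" "y > 0" "y < v" using e v by (auto simp: y_def dist_real_def)
    then have "y \<in> S" using e(2)[of y] by (simp add: S_def)
    then show False using cInf_lower[OF _ bdd] vS \<open>y < v\<close> by fastforce
  qed
  ultimately show ?thesis by (simp add: v_def)
qed

end

section \<open>From the Brownian motion to the limit formula\<close>

lemma star_alg_diff: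
  "star_prob sm st tau \<Longrightarrow> x \<in> star_alg sm st S \<Longrightarrow> y \<in> star_alg sm st S \<Longrightarrow> x - y \<in> star_alg sm st S"
  using star_alg.add[OF _ star_alg.smult[of y sm st S "-1"]] star_prob.minus_eq_sm[of sm st tau y]
  by (metis diff_conv_add_uminus)

context star_prob
begin

text \<open>Both orders occur in \<open>log_limit\<close>: one recursion extracts
  \<open>c t\<close>, the other its adjoint.\<close>

lemma free_circularI:
  assumes bm: "free_circ_BM_free_from sm st tau c x0" and t: "t > 0"
  shows "free_circular sm st tau (star_alg sm st {x0}) (star_alg sm st {c t}) (c t) (st (c t)) t"
    and "free_circular sm st tau (star_alg sm st {x0}) (star_alg sm st {c t}) (st (c t)) (c t) t"
proof -
  have c0: "c 0 = 0" and circ: "circular tau st (c t) t"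
    using bm t unfolding free_circ_BM_free_from_def by (force, metis diff_zero less_eq_real_def order_refl)
  \<comment> \<open>The time grid 0, t has a single increment, which is \<open>c t\<close> because
    \<open>c 0 = 0\<close>.\<close>
  have "free_family tau
         (\<lambda>i. case i of None \<Rightarrow> star_alg sm st {x0}
                     | Some k \<Rightarrow> star_alg sm st {c ([0, t] ! Suc k) - c ([0, t] ! k)})
         (insert None (Some ` {k. Suc k < length [0, t]}))"
    by (rule bm[unfolded free_circ_BM_free_from_def, THEN conjunct2, THEN conjunct2, rule_format]) (use t in auto)
  then have ff: "free_family tau
         (\<lambda>i. case i of None \<Rightarrow> star_alg sm st {x0}
                     | Some k \<Rightarrow> star_alg sm st {c ([0, t] ! Suc k) - c ([0, t] ! k)})
         {None, Some 0}" by (simp add: less_Suc_eq_0_disj)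
  have free: "free_family tau (\<lambda>i. if i then star_alg sm st {x0} else star_alg sm st {c t}) UNIV"
    unfolding free_family_def
  proof (intro allI impI, elim conjE)
    fix "is" :: "bool list" and xs
    assume a: "is \<noteq> []" "length xs = length is"
      "\<forall>k. Suc k < length is \<longrightarrow> is ! k \<noteq> is ! Suc k"
      "\<forall>k<length is. xs ! k \<in> (if is ! k then star_alg sm st {x0} else star_alg sm st {c t}) \<and> tau (xs ! k) = 0"
    define js where "js = map (\<lambda>i. if i then None else Some (0::nat)) is"
    have "js \<noteq> [] \<and> length xs = length js \<and> set js \<subseteq> {None, Some 0} \<and>
       (\<forall>k. Suc k < length js \<longrightarrow> js ! k \<noteq> js ! Suc k) \<and>
       (\<forall>k < length js. xs ! k \<in> (case js ! k of None \<Rightarrow> star_alg sm st {x0}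
                     | Some k \<Rightarrow> star_alg sm st {c ([0, t] ! Suc k) - c ([0, t] ! k)}) \<and> tau (xs ! k) = 0)"
      using a c0 by (auto simp: js_def)
    then show "tau (prod_list xs) = 0" by (rule ff[unfolded free_family_def, THEN spec, THEN spec, THEN mp])
  qed
  have w1: "tau (prod_list (map (\<lambda>b. if b then c t else st (c t)) w)) =
      complex_of_real (t ^ (length w div 2) * real (ncp w))" for w
    using circ by (simp add: circular_def)
  have w2: "tau (prod_list (map (\<lambda>b. if b then st (c t) else c t) w)) =
      complex_of_real (t ^ (length w div 2) * real (ncp w))" for w
  proof -
    have "map (\<lambda>b. if b then st (c t) else c t) w = map (\<lambda>b. if b then c t else st (c t)) (map Not w)"
      by simp
    then show ?thesis using w1[of "map Not w"] by (simp only: ncp_map_Not length_map)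
  qed
  show "free_circular sm st tau (star_alg sm st {x0}) (star_alg sm st {c t}) (c t) (st (c t)) t"
    and "free_circular sm st tau (star_alg sm st {x0}) (star_alg sm st {c t}) (st (c t)) (c t) t"
    by (intro free_circular.intro[OF star_prob_axioms] free_circular_axioms.intro;
        (rule free w1 w2 star_alg.one |
          rule star_alg.add star_alg.mult star_alg.smult star_alg.gen star_alg.star;
            (assumption | simp | rule star_alg.gen; simp)))+
qed

lemma log_limit:
  assumes sa: "st x0 = x0"
    and cm: "compact_measure \<mu> B t"
    and mu_dist: "\<forall>n. tau (x0 ^ n) = complex_of_real (\<integral>x. x ^ n \<partial>\<mu>)"
    and bm: "free_circ_BM_free_from sm st tau c x0"
    and lam_in: "lam \<in> Lambda_set \<mu> t"
  shows "((\<lambda>eps. S_fun sm st tau x0 c t lam eps) \<longlongrightarrow>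
            (\<integral>x. ln ((Re lam - x)\<^sup>2 + (v_fun \<mu> t (Re lam))\<^sup>2) \<partial>\<mu>)
              - ((v_fun \<mu> t (Re lam))\<^sup>2 - (Im lam)\<^sup>2) / t) (at_right 0)"
proof -
  interpret compact_measure \<mu> B t by (rule cm)
  define A0 where "A0 = sm lam 1 - x0"
  define T where "T = A0 - c t"
  define P where "P = st T * T"
  define F where "F k = (st A0 * A0) ^ k" for k
  define A where "A = star_alg sm st {x0}"
  interpret D: free_circular sm st tau A "star_alg sm st {c t}" "c t" "st (c t)" t
    unfolding A_def by (rule free_circularI[OF bm t])
  interpret E: free_circular sm st tau A "star_alg sm st {c t}" "st (c t)" "c t" t
    unfolding A_def by (rule free_circularI[OF bm t])
  have A0: "A0 \<in> A" unfolding A_def A0_def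
    by (intro star_alg_diff[OF star_prob_axioms] star_alg.intros) simp
  have stA0: "st A0 \<in> A" using A0 unfolding A_def by (rule star_alg.star)
  have FA: "F k \<in> A" for k
    by (induction k) (auto simp: F_def D.A_one intro!: D.A_mult A0 stA0)
  have Tc: "A0 - c t = T" "st A0 - st (c t) = st T" by (simp_all add: T_def st_diff)
  define p where "p n k = tau (P ^ n * F k)" for n k
  \<comment> \<open>The intermediate moments: the leading \<open>st T\<close> of P has been replaced
    by \<open>st A0\<close>, which traciality carries to the right end. The recursion
    \<open>rec1\<close> expands this \<open>st T\<close>, and \<open>rec2\<close> the following
    \<open>T\<close>.\<close>
  define q where "q n k = tau (T * P ^ n * (F k * st A0))" for n k
  have rec1: "p (Suc n) k = q n k + of_real t * (\<Sum>j\<le>n. p j 0 * p (n - j) k)" for n k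
  proof -
    have "p (Suc n) k = tau (st A0 * (T * P ^ n * F k)) - tau (st (c t) * (T * P ^ n * F k))"
      by (simp add: p_def P_def Tc(2)[symmetric] mult.assoc left_diff_distrib tau_diff)
    also have "tau (st A0 * (T * P ^ n * F k)) = q n k"
      by (subst tau_comm) (simp add: q_def mult.assoc)
    also have "tau (st (c t) * (T * P ^ n * F k)) = - t * (\<Sum>j\<le>n. tau (P ^ j) * tau (P ^ (n - j) * F k))"
      using E.moment_de[OF A0 stA0 FA, of n k] unfolding Tc P_def by simp
    finally show ?thesis by (simp add: p_def F_def)
  qed
  have rec2: "q n k = p n (Suc k) + of_real t * (\<Sum>j<n. p j 0 * q (n - Suc j) k)" for n k
  proof -
    have "q n k = tau (A0 * (P ^ n * (F k * st A0))) - tau (c t * (P ^ n * (F k * st A0)))"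
      by (simp add: q_def Tc(1)[symmetric] mult.assoc left_diff_distrib tau_diff)
    also have "tau (A0 * (P ^ n * (F k * st A0))) = p n (Suc k)"
      by (subst tau_comm) (simp add: p_def F_def mult.assoc power_Suc2 del: power_Suc)
    also have "tau (c t * (P ^ n * (F k * st A0))) =
        - t * (\<Sum>j<n. tau (P ^ j) * tau (T * P ^ (n - Suc j) * (F k * st A0)))"
      using D.moment_ed[OF A0 stA0 D.A_mult[OF FA stA0], of n k] unfolding Tc P_def by simp
    finally show ?thesis by (simp add: p_def q_def F_def)
  qed
  obtain C1 where C1: "\<And>n. Re (tau ((st T * T) ^ n)) \<le> C1 ^ n" using tau_growth[of T] by blast
  obtain L1 where L1: "\<And>n. Re (tau ((st A0 * A0) ^ n)) \<le> L1 ^ n" using tau_growth[of A0] by blast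
  define s where "s x = (Re lam - x)\<^sup>2 + (Im lam)\<^sup>2" for x
  define C where "C = \<bar>C1\<bar> + 1"
  define L where "L = \<bar>L1\<bar> + 1 + ((\<bar>Re lam\<bar> + B)\<^sup>2 + (Im lam)\<^sup>2)"
  have C: "C \<ge> 1" "\<bar>C1\<bar> \<le> C" and L: "L \<ge> 1" "\<bar>L1\<bar> \<le> L" by (auto simp: C_def L_def add_nonneg_nonneg)
  have bd: "norm (p n k) \<le> C ^ n * L ^ k" for n k
  proof -
    have stP: "st (P ^ n) = P ^ n" and stF: "st (F k) = F k" by (simp_all add: P_def F_def st_power st_mult)
    have "(norm (p n k))\<^sup>2 \<le> Re (tau (P ^ n * P ^ n)) * Re (tau (F k * F k))"
      using Cauchy_Schwarz[of "P ^ n" "F k"] by (simp add: stP stF p_def)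
    also have "\<dots> \<le> C ^ (n + n) * L ^ (k + k)"
    proof (rule mult_mono)
      have "Re (tau (P ^ (n + n))) \<le> \<bar>C1 ^ (n + n)\<bar>" using C1[of "n + n"] by (simp add: P_def)
      also have "\<dots> \<le> C ^ (n + n)" unfolding power_abs using C by (intro power_mono) auto
      finally show "Re (tau (P ^ n * P ^ n)) \<le> C ^ (n + n)" by (simp only: power_add)
      have "Re (tau (F (k + k))) \<le> \<bar>L1 ^ (k + k)\<bar>" using L1[of "k + k"] by (simp add: F_def)
      also have "\<dots> \<le> L ^ (k + k)" unfolding power_abs using L by (intro power_mono) auto
      finally show "Re (tau (F k * F k)) \<le> L ^ (k + k)" by (simp only: power_add F_def)
      show "0 \<le> Re (tau (F k * F k))" using tau_pos[of "F k"] by (simp add: stF)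
    qed (use C in simp)
    also have "\<dots> = (C ^ n * L ^ k)\<^sup>2" by (simp add: power_add power2_eq_square mult_ac)
    finally show ?thesis by (rule power2_le_imp_le) (use C L in simp)
  qed
  have K: "bounded_pos \<mu> s L"
    unfolding s_def by (rule bounded_pos_shift) (simp add: L_def)
  interpret K: bounded_pos \<mu> s L by (rule K)
  \<comment> \<open>The extra power of \<open>x0\<close> makes the induction on \<open>k\<close>
    work, as one more factor of \<open>F\<close> is a quadratic polynomial in
    \<open>x0\<close>.\<close>
  have mom: "tau (x0 ^ n * F k) = of_real (\<integral>x. x ^ n * s x ^ k \<partial>\<mu>)" for n k
  proof (induction k arbitrary: n)
    case 0
    show ?case using mu_dist by (simp add: F_def)
  next
    case (Suc k)
    have int: "integrable \<mu> (\<lambda>x. x ^ n * s x ^ k)" for n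
    proof (rule integrable_const_bound[of _ "B ^ n * L ^ k"])
      show "AE x in \<mu>. norm (x ^ n * s x ^ k) \<le> B ^ n * L ^ k"
        using mu_bd K.s_bd
      proof eventually_elim
        case (elim x)
        show ?case unfolding norm_mult norm_power
          using elim B_nonneg L by (intro mult_mono power_mono) auto
      qed
    qed (unfold s_def, measurable)
    have st_A0: "st A0 = sm (cnj lam) 1 - x0" by (simp add: A0_def st_diff st_sm sa)
    have "st A0 * A0 = sm (cnj lam * lam) 1 - sm (cnj lam + lam) x0 + x0 * x0"
      unfolding st_A0 unfolding A0_def
      by (simp add: left_diff_distrib right_diff_distrib sm_mult_left sm_mult_right sm_sm sm_add_left sm_diff
          mult.commute[of lam])
    also have "cnj lam * lam = of_real ((Re lam)\<^sup>2 + (Im lam)\<^sup>2)"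
      by (simp add: complex_eq_iff power2_eq_square)
    also have "cnj lam + lam = of_real (2 * Re lam)" by (simp add: complex_eq_iff)
    finally have "x0 ^ n * (st A0 * A0) = sm (of_real ((Re lam)\<^sup>2 + (Im lam)\<^sup>2)) (x0 ^ n)
        - sm (of_real (2 * Re lam)) (x0 ^ Suc n) + x0 ^ Suc (Suc n)"
      by (simp only: right_diff_distrib distrib_left sm_mult_right mult_1_right power_Suc2 mult.assoc)
    then have "x0 ^ n * (st A0 * A0) * F k = (sm (of_real ((Re lam)\<^sup>2 + (Im lam)\<^sup>2)) (x0 ^ n)
        - sm (of_real (2 * Re lam)) (x0 ^ Suc n) + x0 ^ Suc (Suc n)) * F k"
      by (simp only:)
    then have AA: "x0 ^ n * F (Suc k) = sm (of_real ((Re lam)\<^sup>2 + (Im lam)\<^sup>2)) (x0 ^ n * F k)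
        - sm (of_real (2 * Re lam)) (x0 ^ Suc n * F k) + x0 ^ Suc (Suc n) * F k"
      by (simp only: F_def power_Suc[of "st A0 * A0"] left_diff_distrib distrib_right sm_mult_left mult.assoc)
    have "tau (x0 ^ n * F (Suc k)) = of_real (((Re lam)\<^sup>2 + (Im lam)\<^sup>2) * (\<integral>x. x ^ n * s x ^ k \<partial>\<mu>)
        - (2 * Re lam) * (\<integral>x. x ^ Suc n * s x ^ k \<partial>\<mu>) + (\<integral>x. x ^ Suc (Suc n) * s x ^ k \<partial>\<mu>))"
      unfolding AA tau_add tau_diff tau_sm Suc.IH by simp
    also have "((Re lam)\<^sup>2 + (Im lam)\<^sup>2) * (\<integral>x. x ^ n * s x ^ k \<partial>\<mu>)
        - (2 * Re lam) * (\<integral>x. x ^ Suc n * s x ^ k \<partial>\<mu>) + (\<integral>x. x ^ Suc (Suc n) * s x ^ k \<partial>\<mu>) =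
       (\<integral>x. ((Re lam)\<^sup>2 + (Im lam)\<^sup>2) * (x ^ n * s x ^ k) - (2 * Re lam) * (x ^ Suc n * s x ^ k)
          + x ^ Suc (Suc n) * s x ^ k \<partial>\<mu>)"
      using int[of n] int[of "Suc n"] int[of "Suc (Suc n)"]
      by (simp only: Bochner_Integration.integral_add Bochner_Integration.integral_diff integral_mult_right_zero
          Bochner_Integration.integrable_diff integrable_mult_right)
    also have "(\<lambda>x. ((Re lam)\<^sup>2 + (Im lam)\<^sup>2) * (x ^ n * s x ^ k) - (2 * Re lam) * (x ^ Suc n * s x ^ k)
          + x ^ Suc (Suc n) * s x ^ k) = (\<lambda>x. x ^ n * s x ^ Suc k)"
      by (simp add: fun_eq_iff s_def power2_eq_square algebra_simps)
    finally show ?case .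
  qed
  \<comment> \<open>Any spectral distribution would do: only its moments and its bounded support
    enter below.\<close>
  define \<nu> where "\<nu> = (SOME \<nu>. spec_dist tau P \<nu>)"
  have \<nu>: "spec_dist tau P \<nu>"
    unfolding \<nu>_def P_def by (rule someI_ex[OF spec_dist_exists])
  then obtain R where R: "measure \<nu> {0..R} = 1" unfolding spec_dist_def by blast
  have \<nu>p: "prob_space \<nu>" and \<nu>s: "sets \<nu> = sets borel"
    and \<nu>m: "\<And>n. complex_of_real (\<integral>x. x ^ n \<partial>\<nu>) = tau (P ^ n)"
    using \<nu> unfolding spec_dist_def by auto
  interpret \<nu>: prob_space \<nu> by (rule \<nu>p)
  have N: "bounded_pos \<nu> (\<lambda>x. x) R"
  proof
    show "AE x in \<nu>. 0 \<le> x \<and> x \<le> R"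
      using R by (subst (asm) \<nu>.prob_eq_1) (auto simp: \<nu>s)
    show "(\<lambda>x. x) \<in> borel_measurable \<nu>" by (subst measurable_cong_sets[OF \<nu>s refl]) simp
  qed
  interpret subord \<nu> \<mu> s R L t "8 * (C + L + R + t)"
  proof (rule subord_large[OF N K rec1 rec2 bd _ _ C(1) L(1) t])
    show "p n 0 = of_real (\<integral>x. x ^ n \<partial>\<nu>)" for n by (simp add: p_def F_def \<nu>m)
    show "p 0 k = of_real (\<integral>x. s x ^ k \<partial>\<mu>)" for k using mom[of 0 k] by (simp add: p_def)
  qed
  define v where "v = v_fun \<mu> t (Re lam)"
  have v: "\<bar>Im lam\<bar> < v" using lam_in by (simp add: Lambda_set_def v_def)
  \<comment> \<open>Chosen so that \<open>s x + s0\<close> is (a - x)^2 + v^2; the resolvent at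
    \<open>s0\<close> is then the integral that \<open>v_fun\<close> sets equal to 1 / t.\<close>
  define s0 where "s0 = v\<^sup>2 - (Im lam)\<^sup>2"
  have "\<bar>Im lam\<bar>\<^sup>2 < v\<^sup>2" using v by (intro power_strict_mono) auto
  then have s0: "s0 > 0" by (simp add: s0_def)
  have ss: "s x + s0 = (Re lam - x)\<^sup>2 + v\<^sup>2" for x by (simp add: s_def s0_def)
  have "K.res s0 = vint (Re lam) v" by (simp add: K.res_def ss vint_def)
  also have "\<dots> = 1 / t" unfolding v_def by (rule vint_v_fun) (use v in \<open>simp add: v_def\<close>)
  finally have "((\<lambda>\<eta>. N.logint (\<eta>\<^sup>2)) \<longlongrightarrow> K.logint s0 - s0 / t) (at_right 0)"
    by (rule logint_limit[OF s0])
  moreover have "filterlim sqrt (at_right 0) (at_right 0)" by real_asymp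
  ultimately have "((\<lambda>eps. N.logint ((sqrt eps)\<^sup>2)) \<longlongrightarrow> K.logint s0 - s0 / t) (at_right 0)"
    by (rule filterlim_compose)
  moreover have "\<forall>\<^sub>F eps in at_right 0. N.logint ((sqrt eps)\<^sup>2) = S_fun sm st tau x0 c t lam eps"
    using eventually_at_right_less[of 0]
  proof eventually_elim
    case (elim eps)
    have "S_fun sm st tau x0 c t lam eps = (\<integral>x. ln (x + eps) \<partial>\<nu>)"
      by (simp add: S_fun_def Let_def tau_log_def \<nu>_def P_def T_def A0_def)
    then show ?case using elim by (simp add: N.logint_def)
  qed
  ultimately have "((\<lambda>eps. S_fun sm st tau x0 c t lam eps) \<longlongrightarrow> K.logint s0 - s0 / t) (at_right 0)"
    by (rule Lim_transform_eventually)
  then show ?thesis unfolding K.logint_def ss by (simp only: s0_def v_def)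
qed

end

subsection \<open>Analyticity of the boundary\<close>

context compact_measure
begin

lemma integrable_continuous_mu:
  fixes f :: "real \<Rightarrow> 'b::{banach, second_countable_topology}"
  assumes "continuous_on UNIV f"
  shows "integrable \<mu> f"
proof -
  have "bounded (f ` {-B..B})"
    by (intro compact_imp_bounded compact_continuous_image continuous_on_subset[OF assms]) auto
  then obtain K where K: "\<And>x. x \<in> {-B..B} \<Longrightarrow> norm (f x) \<le> K" unfolding bounded_iff by blast
  show ?thesis
  proof (rule integrable_const_bound[of _ K])
    show "AE x in \<mu>. norm (f x) \<le> K"
      using mu_bd by (rule eventually_mono) (auto intro!: K)
    show "f \<in> borel_measurable \<mu>"
      using borel_measurable_continuous_onI[OF assms] by (simp add: measurable_cong_sets[OF sets_mu refl])
  qed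
qed

definition cauchy :: "complex \<Rightarrow> complex" where
  "cauchy z = (\<integral>x. 1 / (z - of_real x) \<partial>\<mu>)"

definition logpot :: "complex \<Rightarrow> complex" where
  "logpot z = (\<integral>x. Ln (z - of_real x) \<partial>\<mu>)"

lemma upper_nonzero: "Im z > 0 \<Longrightarrow> z - of_real x \<noteq> 0"
  by (auto simp: complex_eq_iff)

lemma upper_nonpos: "Im z > 0 \<Longrightarrow> z - of_real x \<notin> \<real>\<^sub>\<le>\<^sub>0"
  by (auto simp: complex_nonpos_Reals_iff)

lemma cauchy_integrable: "Im z > 0 \<Longrightarrow> integrable \<mu> (\<lambda>x. 1 / (z - of_real x))"
  by (rule integrable_continuous_mu) (auto intro!: continuous_intros simp: upper_nonzero)

lemma upper_bound:
  assumes "y > 0" "Im z > y"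
  shows "norm (1 / (z - of_real x)) \<le> 1 / y"
proof -
  have "y \<le> \<bar>Im (z - of_real x)\<bar>" using assms by simp
  also have "\<dots> \<le> norm (z - of_real x)" by (rule abs_Im_le_cmod)
  finally show ?thesis using assms frac_le[of 1 1 y "norm (z - of_real x)"] by (simp add: norm_divide)
qed

lemma logpot_deriv:
  assumes "Im z0 > 0"
  shows "(logpot has_field_derivative cauchy z0) (at z0)"
  unfolding logpot_def cauchy_def
proof (rule has_field_derivative_integral_param[where U = "{z. Im z > Im z0 / 2}" and B = "1 / (Im z0 / 2)"
      and f' = "\<lambda>z x. 1 / (z - of_real x)"])
  show "open {z. Im z > Im z0 / 2}" by (rule open_halfspace_Im_gt)
  show "integrable \<mu> (\<lambda>x. Ln (z - of_real x))" if "z \<in> {z. Im z > Im z0 / 2}" for z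
    by (rule integrable_continuous_mu) (use that assms in \<open>auto intro!: continuous_intros simp: complex_nonpos_Reals_iff\<close>)
  show "(\<lambda>x. 1 / (z0 - complex_of_real x)) \<in> borel_measurable \<mu>"
    by (rule borel_measurable_integrable[OF cauchy_integrable[OF assms]])
  show "AE x in \<mu>. \<forall>z\<in>{z. Im z0 / 2 < Im z}. ((\<lambda>z. Ln (z - of_real x)) has_field_derivative 1 / (z - of_real x)) (at z)"
  proof (intro AE_I2 ballI)
    fix x z assume "z \<in> {z. Im z0 / 2 < Im z}"
    then have "z - of_real x \<notin> \<real>\<^sub>\<le>\<^sub>0" using assms by (intro upper_nonpos) auto
    then show "((\<lambda>z. Ln (z - of_real x)) has_field_derivative 1 / (z - of_real x)) (at z)"
      by (auto intro!: derivative_eq_intros simp: field_simps)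
  qed
  show "AE x in \<mu>. \<forall>z\<in>{z. Im z0 / 2 < Im z}. norm (1 / (z - of_real x)) \<le> 1 / (Im z0 / 2)"
  proof (intro AE_I2 ballI)
    fix x z assume "z \<in> {z. Im z0 / 2 < Im z}"
    then show "norm (1 / (z - complex_of_real x)) \<le> 1 / (Im z0 / 2)" by (intro upper_bound) (use assms in auto)
  qed
qed (use assms finite_measure_axioms in auto)

lemma cauchy_deriv:
  assumes "Im z0 > 0"
  shows "(cauchy has_field_derivative (\<integral>x. - (1 / (z0 - of_real x))\<^sup>2 \<partial>\<mu>)) (at z0)"
  unfolding cauchy_def
proof (rule has_field_derivative_integral_param[where U = "{z. Im z > Im z0 / 2}" and B = "(1 / (Im z0 / 2))\<^sup>2"
      and f' = "\<lambda>z x. - (1 / (z - of_real x))\<^sup>2"])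
  show "open {z. Im z > Im z0 / 2}" by (rule open_halfspace_Im_gt)
  show "integrable \<mu> (\<lambda>x. 1 / (z - of_real x))" if "z \<in> {z. Im z > Im z0 / 2}" for z
    by (rule cauchy_integrable) (use that assms in auto)
  show "(\<lambda>x. - (1 / (z0 - complex_of_real x))\<^sup>2) \<in> borel_measurable \<mu>"
    using borel_measurable_integrable[OF cauchy_integrable[OF assms]] by measurable
  show "AE x in \<mu>. \<forall>z\<in>{z. Im z0 / 2 < Im z}. ((\<lambda>z. 1 / (z - of_real x)) has_field_derivative - (1 / (z - of_real x))\<^sup>2) (at z)"
  proof (intro AE_I2 ballI)
    fix x z assume "z \<in> {z. Im z0 / 2 < Im z}"
    then have "z - of_real x \<noteq> 0" using assms by (intro upper_nonzero) auto
    then show "((\<lambda>z. 1 / (z - of_real x)) has_field_derivative - (1 / (z - of_real x))\<^sup>2) (at z)"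
      by (auto intro!: derivative_eq_intros simp: power2_eq_square)
  qed
  show "AE x in \<mu>. \<forall>z\<in>{z. Im z0 / 2 < Im z}. norm (- (1 / (z - of_real x))\<^sup>2) \<le> (1 / (Im z0 / 2))\<^sup>2"
  proof (intro AE_I2 ballI)
    fix x z assume "z \<in> {z. Im z0 / 2 < Im z}"
    then have "norm (1 / (z - complex_of_real x)) \<le> 1 / (Im z0 / 2)" by (intro upper_bound) (use assms in auto)
    then show "norm (- (1 / (z - complex_of_real x))\<^sup>2) \<le> (1 / (Im z0 / 2))\<^sup>2"
      unfolding norm_minus_cancel norm_power by (intro power_mono) auto
  qed
qed (use assms finite_measure_axioms in auto)

lemma cauchy_parts:
  assumes "Im z > 0"
  shows "Re (cauchy z) = (\<integral>x. (Re z - x) / ((Re z - x)\<^sup>2 + (Im z)\<^sup>2) \<partial>\<mu>)"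
    and "Im (cauchy z) = - (Im z * vint (Re z) (Im z))"
proof -
  have "Re (cauchy z) = (\<integral>x. Re (1 / (z - of_real x)) \<partial>\<mu>)"
    unfolding cauchy_def using cauchy_integrable[OF assms] by simp
  then show "Re (cauchy z) = (\<integral>x. (Re z - x) / ((Re z - x)\<^sup>2 + (Im z)\<^sup>2) \<partial>\<mu>)"
    by (simp add: Re_divide)
  have "Im (cauchy z) = (\<integral>x. Im (1 / (z - of_real x)) \<partial>\<mu>)"
    unfolding cauchy_def using cauchy_integrable[OF assms] by simp
  also have "\<dots> = (\<integral>x. (- Im z) * (1 / ((Re z - x)\<^sup>2 + (Im z)\<^sup>2)) \<partial>\<mu>)"
    by (simp add: Im_divide)
  also have "\<dots> = - (Im z * vint (Re z) (Im z))"
    by (simp only: integral_mult_right_zero vint_def)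
  finally show "Im (cauchy z) = - (Im z * vint (Re z) (Im z))" .
qed

lemma vint_integrable: "y > 0 \<Longrightarrow> integrable \<mu> (\<lambda>x. 1 / ((a - x)\<^sup>2 + y\<^sup>2))"
  by (rule integrable_continuous_mu) (auto intro!: continuous_intros simp: add_nonneg_eq_0_iff)

lemma logpot_Re:
  assumes "Im z > 0"
  shows "2 * Re (logpot z) = (\<integral>x. ln ((Re z - x)\<^sup>2 + (Im z)\<^sup>2) \<partial>\<mu>)"
proof -
  have "integrable \<mu> (\<lambda>x. Ln (z - of_real x))"
    by (rule integrable_continuous_mu) (use assms in \<open>auto intro!: continuous_intros simp: complex_nonpos_Reals_iff\<close>)
  then have "2 * Re (logpot z) = (\<integral>x. 2 * Re (Ln (z - of_real x)) \<partial>\<mu>)"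
    unfolding logpot_def by simp
  also have "(\<lambda>x. 2 * Re (Ln (z - of_real x))) = (\<lambda>x. ln ((Re z - x)\<^sup>2 + (Im z)\<^sup>2))"
  proof
    fix x
    have nz: "z - of_real x \<noteq> 0" using upper_nonzero[OF assms] .
    have "2 * Re (Ln (z - of_real x)) = 2 * ln (norm (z - of_real x))" by (subst Re_Ln[OF nz]) (rule refl)
    also have "\<dots> = ln ((norm (z - of_real x))\<^sup>2)" using nz by (simp add: ln_realpow)
    also have "(norm (z - of_real x))\<^sup>2 = (Re z - x)\<^sup>2 + (Im z)\<^sup>2" by (simp add: cmod_power2)
    finally show "2 * Re (Ln (z - of_real x)) = ln ((Re z - x)\<^sup>2 + (Im z)\<^sup>2)" .
  qed
  finally show ?thesis .
qed

text \<open>Biane's map, which sends the graph of \<open>v_fun\<close> into the real line.\<close>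

definition H :: "complex \<Rightarrow> complex" where
  "H z = z + of_real t * cauchy z"

text \<open>The imaginary part of H(z) is Im z (1 - t vint(Re z, Im z)), so a real value puts z on
  the graph of \<open>v_fun\<close>. For the real part, a - x is split under the integral and the
  first summand is evaluated with the same equation.\<close>

lemma H_real:
  assumes "Im z > 0" "Im (H z) = 0"
  shows "v_fun \<mu> t (Re z) = Im z"
    and "Re (H z) = 2 * Re z - t * (\<integral>x. x / ((Re z - x)\<^sup>2 + (Im z)\<^sup>2) \<partial>\<mu>)"
proof -
  have "Im z - t * (Im z * vint (Re z) (Im z)) = 0"
    using assms cauchy_parts(2)[OF assms(1)] by (simp add: H_def)
  then have "Im z * (1 - t * vint (Re z) (Im z)) = 0" by (simp add: algebra_simps)
  then have vi: "vint (Re z) (Im z) = 1 / t" using assms t by (simp add: field_simps)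
  then show "v_fun \<mu> t (Re z) = Im z" by (rule v_fun_eq[OF assms(1)])
  have int: "integrable \<mu> (\<lambda>x. x / ((Re z - x)\<^sup>2 + (Im z)\<^sup>2))"
    by (rule integrable_continuous_mu) (use assms in \<open>auto intro!: continuous_intros simp: add_nonneg_eq_0_iff\<close>)
  have "Re (cauchy z) = (\<integral>x. Re z * (1 / ((Re z - x)\<^sup>2 + (Im z)\<^sup>2)) - x / ((Re z - x)\<^sup>2 + (Im z)\<^sup>2) \<partial>\<mu>)"
    unfolding cauchy_parts(1)[OF assms(1)] by (simp add: diff_divide_distrib)
  also have "\<dots> = Re z * vint (Re z) (Im z) - (\<integral>x. x / ((Re z - x)\<^sup>2 + (Im z)\<^sup>2) \<partial>\<mu>)"
    unfolding vint_def using int vint_integrable[OF assms(1), of "Re z"]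
    by (subst Bochner_Integration.integral_diff) (simp_all only: integral_mult_right_zero integrable_mult_right)
  finally have "Re (cauchy z) = Re z / t - (\<integral>x. x / ((Re z - x)\<^sup>2 + (Im z)\<^sup>2) \<partial>\<mu>)" using vi by simp
  then show "Re (H z) = 2 * Re z - t * (\<integral>x. x / ((Re z - x)\<^sup>2 + (Im z)\<^sup>2) \<partial>\<mu>)"
    using t by (simp add: H_def right_diff_distrib)
qed

lemma H_deriv:
  assumes "Im z > 0"
  shows "(H has_field_derivative 1 - of_real t * (\<integral>x. (1 / (z - of_real x))\<^sup>2 \<partial>\<mu>)) (at z)"
  unfolding H_def by (auto intro!: derivative_eq_intros cauchy_deriv[OF assms])

lemma H_holomorphic: "H holomorphic_on {z. Im z > 0}"
  using H_deriv by (auto simp: holomorphic_on_def field_differentiable_def intro: has_field_derivative_at_within)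

text \<open>On the graph, 1 is t times the integral of 1 / |z - x|^2. Hence the real part of H' is t
  times the integral of 1 / |z - x|^2 - Re (1 / (z - x)^2) = 2 (Im z)^2 / |z - x|^4, which compact
  support bounds away from 0.\<close>

lemma Re_deriv_H_pos:
  assumes "Im z > 0" "vint (Re z) (Im z) = 1 / t"
  shows "Re (deriv H z) > 0"
proof -
  have cont: "continuous_on UNIV (\<lambda>x. (1 / (z - complex_of_real x))\<^sup>2)"
    using assms(1) by (auto intro!: continuous_intros)
  define I where "I = (\<integral>x. Re ((1 / (z - complex_of_real x))\<^sup>2) \<partial>\<mu>)"
  have int1: "integrable \<mu> (\<lambda>x. Re ((1 / (z - complex_of_real x))\<^sup>2))"
    using integrable_continuous_mu[OF cont] by simp
  have "Re (deriv H z) = 1 - t * Re (\<integral>x. (1 / (z - of_real x))\<^sup>2 \<partial>\<mu>)"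
    using DERIV_imp_deriv[OF H_deriv[OF assms(1)]] by simp
  also have "Re (\<integral>x. (1 / (z - complex_of_real x))\<^sup>2 \<partial>\<mu>) = I"
    unfolding I_def using integrable_continuous_mu[OF cont] by simp
  finally have 1: "Re (deriv H z) = 1 - t * I" .
  define L where "L = (\<bar>Re z\<bar> + B)\<^sup>2 + (Im z)\<^sup>2"
  have L: "L > 0" using assms by (simp add: L_def add_nonneg_pos)
  have "(\<integral>x. 2 * (Im z)\<^sup>2 / L\<^sup>2 \<partial>\<mu>) \<le> (\<integral>x. 1 / ((Re z - x)\<^sup>2 + (Im z)\<^sup>2) - Re ((1 / (z - complex_of_real x))\<^sup>2) \<partial>\<mu>)"
  proof (rule integral_mono_AE)
    show "AE x in \<mu>. 2 * (Im z)\<^sup>2 / L\<^sup>2 \<le> 1 / ((Re z - x)\<^sup>2 + (Im z)\<^sup>2) - Re ((1 / (z - complex_of_real x))\<^sup>2)"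
      using mu_bd
    proof eventually_elim
      case (elim x)
      define D where "D = (Re z - x)\<^sup>2 + (Im z)\<^sup>2"
      have D: "D > 0" using assms by (simp add: D_def add_nonneg_pos)
      have "\<bar>Re z - x\<bar> \<le> \<bar>Re z\<bar> + B" using elim by linarith
      then have "(Re z - x)\<^sup>2 \<le> (\<bar>Re z\<bar> + B)\<^sup>2" using power_mono[of "\<bar>Re z - x\<bar>" _ 2] by simp
      then have DL: "D \<le> L" by (simp add: D_def L_def)
      have p1: "Re (1 / (z - of_real x)) = (Re z - x) / D" "Im (1 / (z - of_real x)) = - Im z / D"
        by (simp_all add: Re_divide Im_divide D_def)
      have "Re ((1 / (z - complex_of_real x))\<^sup>2) = ((Re z - x) / D)\<^sup>2 - (Im z / D)\<^sup>2"
        by (simp only: power2_eq_square times_complex.sel p1 minus_divide_left[symmetric] minus_mult_minus)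
      moreover have "1 / D - (((Re z - x) / D)\<^sup>2 - (Im z / D)\<^sup>2) = (D - (Re z - x)\<^sup>2 + (Im z)\<^sup>2) / D\<^sup>2"
      proof -
        have "1 / D = D / D\<^sup>2" using D by (simp add: power2_eq_square)
        then show ?thesis unfolding power_divide by (simp add: diff_divide_distrib add_divide_distrib)
      qed
      ultimately have "1 / D - Re ((1 / (z - complex_of_real x))\<^sup>2) = (D - (Re z - x)\<^sup>2 + (Im z)\<^sup>2) / D\<^sup>2"
        by (simp only:)
      also have "\<dots> = 2 * (Im z)\<^sup>2 / D\<^sup>2" by (simp add: D_def)
      finally have "1 / D - Re ((1 / (z - complex_of_real x))\<^sup>2) = 2 * (Im z)\<^sup>2 / D\<^sup>2" .
      moreover have "2 * (Im z)\<^sup>2 / L\<^sup>2 \<le> 2 * (Im z)\<^sup>2 / D\<^sup>2"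
        using D DL by (intro divide_left_mono power_mono mult_pos_pos zero_less_power) auto
      ultimately show ?case by (simp add: D_def)
    qed
  qed (use int1 vint_integrable[OF assms(1)] in auto)
  also have "\<dots> = 1 / t - I"
    using int1 vint_integrable[OF assms(1), of "Re z"] assms(2) by (simp add: I_def vint_def)
  finally have "2 * (Im z)\<^sup>2 / L\<^sup>2 \<le> 1 / t - I" by (simp add: prob_space)
  moreover have "2 * (Im z)\<^sup>2 / L\<^sup>2 > 0" using assms L by simp
  ultimately have "I < 1 / t" by linarith
  then have "t * I < 1" using t by (simp add: field_simps)
  then show ?thesis using 1 by simp
qed

text \<open>The local inverse \<psi> of H parametrizes the graph by the real value r. To parametrize
  it by the abscissa instead, the real part of \<psi> on the real line must be inverted, and it is
  first extended holomorphically so that its inverse is holomorphic too.\<close>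

lemma boundary_parametrization:
  assumes "y0 > 0" "vint a0 y0 = 1 / t"
  obtains \<delta> r Z where "\<delta> > 0" "r holomorphic_on ball (of_real a0) \<delta>" "Z holomorphic_on ball (of_real a0) \<delta>"
    "\<And>a. \<bar>a - a0\<bar> < \<delta> \<Longrightarrow> Im (r (of_real a)) = 0 \<and> Re (Z (of_real a)) = a \<and> Im (Z (of_real a)) > 0
        \<and> H (Z (of_real a)) = r (of_real a)"
proof -
  define z0 where "z0 = Complex a0 y0"
  have z0: "Im z0 > 0" "vint (Re z0) (Im z0) = 1 / t" using assms by (auto simp: z0_def)
  define S where "S = {z. Im z > 0}"
  have S: "open S" "z0 \<in> S" using z0 by (auto simp: S_def open_halfspace_Im_gt)
  have Hh: "H holomorphic_on S" using H_holomorphic by (simp add: S_def)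
  have dH: "Re (deriv H z0) > 0" by (rule Re_deriv_H_pos[OF z0])
  then have dH0: "deriv H z0 \<noteq> 0" by auto
  then obtain \<rho>0 where \<rho>0: "\<rho>0 > 0" "ball z0 \<rho>0 \<subseteq> S" "open (H ` ball z0 \<rho>0)" "inj_on H (ball z0 \<rho>0)"
    using has_complex_derivative_locally_invertible[OF Hh S(2,1)] by blast
  define V where "V = H ` ball z0 \<rho>0"
  obtain \<psi> where \<psi>: "\<psi> holomorphic_on V" "\<And>z. z \<in> ball z0 \<rho>0 \<Longrightarrow> deriv H z * deriv \<psi> (H z) = 1"
     "\<And>z. z \<in> ball z0 \<rho>0 \<Longrightarrow> \<psi> (H z) = z"
    using holomorphic_has_inverse[OF holomorphic_on_subset[OF Hh \<rho>0(2)] open_ball \<rho>0(4)] unfolding V_def by blast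
  have \<psi>V: "\<psi> w \<in> ball z0 \<rho>0" "H (\<psi> w) = w" if "w \<in> V" for w
    using that \<psi>(3) by (auto simp: V_def)
  define r0 where "r0 = H z0"
  have r0V: "r0 \<in> V" using \<rho>0(1) by (auto simp: V_def r0_def)
  have r0_real: "cnj r0 = r0"
    using cauchy_parts(2)[OF z0(1)] z0(2) t by (simp add: r0_def H_def complex_eq_iff)
  obtain e where e: "e > 0" "ball r0 e \<subseteq> V" using \<rho>0(3) r0V openE unfolding V_def by blast
  have cnj_ball: "cnj w \<in> ball r0 d" if "w \<in> ball r0 d" for w d
  proof -
    have "dist r0 (cnj w) = norm (cnj (r0 - w))" by (simp add: dist_norm r0_real)
    also have "\<dots> = dist r0 w" by (simp only: complex_mod_cnj dist_norm)
    finally show ?thesis using that by simp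
  qed
  \<comment> \<open>For real w this is the real part of \<psi>(w), but it is holomorphic in
    w.\<close>
  define \<rho> where "\<rho> w = (\<psi> w + cnj (\<psi> (cnj w))) / 2" for w
  have \<psi>_deriv: "(\<psi> has_field_derivative deriv \<psi> w) (at w)" if "w \<in> ball r0 e" for w
    using \<psi>(1) e that by (intro holomorphic_derivI[of _ "ball r0 e"]) (auto intro: holomorphic_on_subset)
  have \<rho>_deriv: "(\<rho> has_field_derivative (deriv \<psi> w + cnj (deriv \<psi> (cnj w))) / 2) (at w)" if "w \<in> ball r0 e" for w
  proof -
    have "((\<lambda>w. cnj (\<psi> (cnj w))) has_field_derivative cnj (deriv \<psi> (cnj w))) (at w)"
      using has_field_derivative_cnj_cnj[OF \<psi>_deriv[OF cnj_ball[OF that]]] by (simp add: comp_def)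
    from DERIV_cdivide[OF DERIV_add[OF \<psi>_deriv[OF that] this], of 2] show ?thesis
      unfolding \<rho>_def .
  qed
  have \<rho>h: "\<rho> holomorphic_on ball r0 e"
    unfolding holomorphic_on_def field_differentiable_def using \<rho>_deriv has_field_derivative_at_within by blast
  have r0e: "r0 \<in> ball r0 e" using e by simp
  have "deriv \<rho> r0 = of_real (Re (deriv \<psi> r0))"
    using DERIV_imp_deriv[OF \<rho>_deriv[OF r0e]] by (simp add: r0_real complex_eq_iff)
  \<comment> \<open>A reciprocal has a real part of the same sign; this is where positivity of Re
    H', and not just H' \<noteq> 0, is needed.\<close>
  moreover have "Re (deriv \<psi> r0) > 0"
  proof -
    have m: "deriv H z0 * deriv \<psi> r0 = 1" using \<psi>(2)[of z0] \<rho>0(1) by (simp add: r0_def)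
    then have "deriv \<psi> r0 = 1 / deriv H z0" 
      using dH0 by (simp add: nonzero_eq_divide_eq mult.commute)
    then have "Re (deriv \<psi> r0) = Re (deriv H z0) / ((Re (deriv H z0))\<^sup>2 + (Im (deriv H z0))\<^sup>2)"
      by (simp add: Re_divide)
    moreover have "(Re (deriv H z0))\<^sup>2 + (Im (deriv H z0))\<^sup>2 > 0" using dH by (simp add: add_pos_nonneg)
    ultimately show ?thesis using dH by simp
  qed
  ultimately have "deriv \<rho> r0 \<noteq> 0" by simp
  then obtain e2 where e2: "e2 > 0" "ball r0 e2 \<subseteq> ball r0 e" "open (\<rho> ` ball r0 e2)" "inj_on \<rho> (ball r0 e2)"
    using has_complex_derivative_locally_invertible[OF \<rho>h r0e open_ball] by blast
  obtain r where r: "r holomorphic_on (\<rho> ` ball r0 e2)" "\<And>w. w \<in> ball r0 e2 \<Longrightarrow> r (\<rho> w) = w"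
    by (rule holomorphic_has_inverse[OF holomorphic_on_subset[OF \<rho>h e2(2)] open_ball e2(4)], rule that) (assumption | blast)+
  have \<psi>r0: "\<psi> r0 = z0" using \<psi>(3)[of z0] \<rho>0(1) by (simp add: r0_def)
  then have "\<rho> r0 = of_real a0" by (simp add: \<rho>_def r0_real z0_def complex_eq_iff)
  then have "of_real a0 \<in> \<rho> ` ball r0 e2" using e2(1) by (metis centre_in_ball image_eqI)
  then obtain \<delta> where \<delta>: "\<delta> > 0" "ball (of_real a0) \<delta> \<subseteq> \<rho> ` ball r0 e2" using e2(3) openE by blast
  have rb: "r \<alpha> \<in> ball r0 e2" "\<rho> (r \<alpha>) = \<alpha>" if "\<alpha> \<in> ball (of_real a0) \<delta>" for \<alpha>
    using that \<delta>(2) r(2) by (auto simp: image_iff subset_iff)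
  have rV: "r \<alpha> \<in> V" if "\<alpha> \<in> ball (of_real a0) \<delta>" for \<alpha>
    using rb(1)[OF that] e2(2) e(2) by blast
  have rh: "r holomorphic_on ball (of_real a0) \<delta>" by (rule holomorphic_on_subset[OF r(1) \<delta>(2)])
  show ?thesis
  proof (rule that[of \<delta> r "\<lambda>\<alpha>. \<psi> (r \<alpha>)"])
    show "\<delta> > 0" by (rule \<delta>)
    show "r holomorphic_on ball (of_real a0) \<delta>" by (rule rh)
    show "(\<lambda>\<alpha>. \<psi> (r \<alpha>)) holomorphic_on ball (of_real a0) \<delta>"
      by (rule holomorphic_on_compose_gen[OF rh \<psi>(1), unfolded comp_def]) (use rV in auto)
    fix a assume "\<bar>a - a0\<bar> < \<delta>"
    then have a: "complex_of_real a \<in> ball (of_real a0) \<delta>"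
      by (simp add: dist_norm abs_minus_commute flip: of_real_diff)
    define w where "w = r (of_real a)"
    have w: "w \<in> ball r0 e2" "\<rho> w = of_real a" "w \<in> V" unfolding w_def by (rule rb[OF a] rV[OF a])+
    \<comment> \<open>Reflection symmetry together with injectivity of \<rho> forces the preimage of
      a real point to be real.\<close>
    have "\<rho> (cnj w) = cnj (\<rho> w)" by (simp add: \<rho>_def add.commute)
    then have "\<rho> (cnj w) = \<rho> w" using w(2) by simp
    then have real: "cnj w = w" using inj_onD[OF e2(4) _ cnj_ball[OF w(1)] w(1)] by blast
    have "Re (\<psi> w) = a" using w(2) real by (simp add: \<rho>_def complex_eq_iff)
    moreover have "Im (\<psi> w) > 0" using \<psi>V(1)[OF w(3)] \<rho>0(2) by (auto simp: S_def)
    moreover have "Im w = 0" using real by (simp add: complex_eq_iff)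
    ultimately show "Im (r (of_real a)) = 0 \<and> Re (\<psi> (r (of_real a))) = a \<and> Im (\<psi> (r (of_real a))) > 0
        \<and> H (\<psi> (r (of_real a))) = r (of_real a)"
      using \<psi>V(2)[OF w(3)] by (simp add: w_def)
  qed
qed

text \<open>The limit is \<open>fpot a + b\<^sup>2 / t\<close>; its two variables separate.\<close>

definition fpot :: "real \<Rightarrow> real" where
  "fpot a = (\<integral>x. ln ((a - x)\<^sup>2 + (v_fun \<mu> t a)\<^sup>2) \<partial>\<mu>) - (v_fun \<mu> t a)\<^sup>2 / t"

lemma fpot_local:
  assumes "v_fun \<mu> t a0 > 0"
  obtains \<delta> r c where "\<delta> > 0"
    "\<And>a. \<bar>a - a0\<bar> < \<delta> \<Longrightarrow> v_fun \<mu> t a > 0 \<and> isCont (v_fun \<mu> t) a"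
    "\<And>a. \<bar>a - a0\<bar> < \<delta> \<Longrightarrow> (fpot has_real_derivative 2 * (r a - a) / t) (at a)"
    "\<And>a. \<bar>a - a0\<bar> < \<delta> \<Longrightarrow> (\<integral>x. x / ((a - x)\<^sup>2 + (v_fun \<mu> t a)\<^sup>2) \<partial>\<mu>) = (2 * a - r a) / t"
    "\<And>a. \<bar>a - a0\<bar> < \<delta> \<Longrightarrow> (r::real \<Rightarrow> real) field_differentiable (at a)"
    "\<And>a. \<bar>a - a0\<bar> < \<delta> \<Longrightarrow> ((\<lambda>n. c n * (a - a0) ^ n) has_sum fpot a) UNIV"
proof -
  obtain \<delta> r Z where \<delta>: "\<delta> > 0" and rh: "r holomorphic_on ball (of_real a0) \<delta>"
    and Zh: "Z holomorphic_on ball (of_real a0) \<delta>"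
    and *: "\<And>a. \<bar>a - a0\<bar> < \<delta> \<Longrightarrow> Im (r (of_real a)) = 0 \<and> Re (Z (of_real a)) = a \<and> Im (Z (of_real a)) > 0
        \<and> H (Z (of_real a)) = r (of_real a)"
    using boundary_parametrization[OF assms vint_v_fun[OF assms]] by blast
  define U where "U = ball a0 \<delta>"
  have U: "a \<in> U \<longleftrightarrow> \<bar>a - a0\<bar> < \<delta>" for a by (simp add: U_def dist_real_def abs_minus_commute)
  have oU: "open U" by (simp add: U_def)
  have cb: "complex_of_real a \<in> ball (of_real a0) \<delta>" if "a \<in> U" for a
    using that by (simp add: U_def dist_norm flip: of_real_diff)
  define y where "y a = Im (Z (of_real a))" for a
  have ZRe: "Re (Z (of_real a)) = a" and y0: "y a > 0" and HZ: "H (Z (of_real a)) = r (of_real a)"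
    and rreal: "Im (r (of_real a)) = 0" if "a \<in> U" for a
    using *[of a] that by (auto simp: U y_def)
  have v: "v_fun \<mu> t a = y a" if "a \<in> U" for a
    using H_real(1)[of "Z (of_real a)"] y0[OF that] HZ[OF that] rreal[OF that] ZRe[OF that] by (simp add: y_def)
  have Zd: "(Z has_field_derivative deriv Z (of_real a)) (at (of_real a))" if "a \<in> U" for a
    by (rule holomorphic_derivI[OF Zh open_ball cb[OF that]])
  have yd: "(y has_real_derivative Im (deriv Z (of_real a))) (at a)" if "a \<in> U" for a
    unfolding y_def using has_vector_derivative_real_field[OF Zd[OF that]] by (rule has_field_derivative_Im)
  have vcont: "isCont (v_fun \<mu> t) a" if "a \<in> U" for a
  proof -
    have "\<forall>\<^sub>F x in nhds a. v_fun \<mu> t x = y x"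
      using eventually_nhds_in_open[OF oU that] by eventually_elim (rule v)
    then show ?thesis using DERIV_isCont[OF yd[OF that]] isCont_cong by blast
  qed
  define rr where "rr a = Re (r (of_real a))" for a
  have rC: "r (of_real a) = of_real (rr a)" if "a \<in> U" for a
    using rreal[OF that] by (simp add: rr_def complex_eq_iff)
  have rd: "rr field_differentiable (at a)" if "a \<in> U" for a
  proof -
    have "(r has_field_derivative deriv r (of_real a)) (at (of_real a))"
      by (rule holomorphic_derivI[OF rh open_ball cb[OF that]])
    from has_field_derivative_Re[OF has_vector_derivative_real_field[OF this]]
    show ?thesis unfolding rr_def field_differentiable_def by blast
  qed
  have q: "(\<integral>x. x / ((a - x)\<^sup>2 + (v_fun \<mu> t a)\<^sup>2) \<partial>\<mu>) = (2 * a - rr a) / t" if "a \<in> U" for a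
  proof -
    have "rr a = 2 * a - t * (\<integral>x. x / ((a - x)\<^sup>2 + (y a)\<^sup>2) \<partial>\<mu>)"
      using H_real(2)[of "Z (of_real a)"] y0[OF that] HZ[OF that] rreal[OF that] ZRe[OF that]
      by (simp add: y_def rr_def)
    then show ?thesis using t v[OF that] by (simp add: field_simps)
  qed
  have fpot_eq: "fpot a = 2 * Re (logpot (Z (of_real a))) - (y a)\<^sup>2 / t" if "a \<in> U" for a
    using logpot_Re[of "Z (of_real a)"] y0[OF that] ZRe[OF that] v[OF that] by (simp add: fpot_def y_def)
  have fd: "(fpot has_real_derivative 2 * (rr a - a) / t) (at a)" if a: "a \<in> U" for a
  proof -
    define Z' where "Z' = deriv Z (of_real a)"
    have "((\<lambda>a. Re (Z (of_real a))) has_real_derivative Re Z') (at a)"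
      unfolding Z'_def using has_vector_derivative_real_field[OF Zd[OF a]] by (rule has_field_derivative_Re)
    moreover have "\<forall>\<^sub>F x in nhds a. Re (Z (of_real x)) = x"
      using eventually_nhds_in_open[OF oU a] by eventually_elim (rule ZRe)
    ultimately have "((\<lambda>a. a) has_real_derivative Re Z') (at a)"
      using DERIV_cong_ev[OF refl, of "\<lambda>a. Re (Z (of_real a))" "\<lambda>x. x" a "Re Z'" "Re Z'"] by simp
    then have Z'1: "Re Z' = 1" using DERIV_unique[OF _ DERIV_ident] by blast
    have "((\<lambda>\<alpha>. logpot (Z \<alpha>)) has_field_derivative cauchy (Z (of_real a)) * Z') (at (of_real a))"
      by (rule DERIV_chain2[where f = logpot and g = Z]) (use logpot_deriv y0[OF a] Zd[OF a] in \<open>auto simp: y_def Z'_def\<close>)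
    then have "((\<lambda>a. Re (logpot (Z (of_real a)))) has_real_derivative Re (cauchy (Z (of_real a)) * Z')) (at a)"
      by (intro has_field_derivative_Re has_vector_derivative_real_field)
    moreover have "((\<lambda>a. (y a)\<^sup>2 / t) has_real_derivative 2 * y a * Im Z' / t) (at a)"
      using t by (auto intro!: derivative_eq_intros yd[OF a] simp: Z'_def)
    ultimately have "((\<lambda>a. 2 * Re (logpot (Z (of_real a))) - (y a)\<^sup>2 / t) has_real_derivative
        2 * Re (cauchy (Z (of_real a)) * Z') - 2 * y a * Im Z' / t) (at a)"
      by (intro DERIV_diff DERIV_cmult)
    moreover have "\<forall>\<^sub>F x in nhds a. 2 * Re (logpot (Z (of_real x))) - (y x)\<^sup>2 / t = fpot x"
      using eventually_nhds_in_open[OF oU a] by eventually_elim (simp add: fpot_eq)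
    ultimately have "(fpot has_real_derivative 2 * Re (cauchy (Z (of_real a)) * Z') - 2 * y a * Im Z' / t) (at a)"
      by (rule DERIV_cong_ev[OF refl _ refl, THEN iffD1, rotated])
    \<comment> \<open>Real H(Z) = r gives the Cauchy transform as (r - Z) / t. As Re Z' = 1, the
      term with Im Z' cancels against the derivative of y^2 / t.\<close>
    moreover have "2 * Re (cauchy (Z (of_real a)) * Z') - 2 * y a * Im Z' / t = 2 * (rr a - a) / t"
    proof -
      have "of_real t * cauchy (Z (of_real a)) = of_real (rr a) - Z (of_real a)"
        using HZ[OF a] rC[OF a] by (simp add: H_def algebra_simps)
      then have c: "cauchy (Z (of_real a)) = (of_real (rr a) - Z (of_real a)) / of_real t"
        using t by (simp add: field_simps)
      have "Re (cauchy (Z (of_real a))) = (rr a - a) / t" "Im (cauchy (Z (of_real a))) = - y a / t"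
        unfolding c by (simp_all add: ZRe[OF a] y_def)
      then have "Re (cauchy (Z (of_real a)) * Z') = (rr a - a) / t + y a / t * Im Z'"
        by (simp add: Z'1)
      then show ?thesis by (simp add: distrib_left)
    qed
    ultimately show ?thesis by simp
  qed
  \<comment> \<open>A holomorphic extension of the derivative of \<open>fpot\<close>. The real part
    of a primitive of it differs from \<open>fpot\<close> by a constant, so its Taylor coefficients
    give the series.\<close>
  define h where "h \<alpha> = of_real 2 * (r \<alpha> - \<alpha>) / of_real t" for \<alpha>
  have hh: "h holomorphic_on ball (of_real a0) \<delta>" unfolding h_def using t by (intro holomorphic_intros rh) auto
  have "\<exists>g. \<forall>x\<in>ball (of_real a0) \<delta>. (g has_field_derivative h x) (at x within ball (of_real a0) \<delta>)"
  proof (rule holomorphic_convex_primitive'[OF convex_ball open_ball hh])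
    fix g assume "\<And>x. x \<in> ball (of_real a0) \<delta> \<Longrightarrow> (g has_field_derivative h x) (at x within ball (of_real a0) \<delta>)"
    then show ?thesis by (intro exI[of _ g] ballI)
  qed
  then obtain g where "\<forall>x\<in>ball (of_real a0) \<delta>. (g has_field_derivative h x) (at x within ball (of_real a0) \<delta>)" ..
  then have g: "(g has_field_derivative h x) (at x within ball (of_real a0) \<delta>)"
    if "x \<in> ball (of_real a0) \<delta>" for x using that by (rule bspec)
  have gat: "(g has_field_derivative h x) (at x)" if "x \<in> ball (of_real a0) \<delta>" for x
    using g[OF that] unfolding at_within_open[OF that open_ball] .
  have gh: "g holomorphic_on ball (of_real a0) \<delta>"
    unfolding holomorphic_on_def field_differentiable_def using g by blast
  have "\<exists>k. \<forall>a\<in>U. fpot a - Re (g (of_real a)) = k"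
  proof (rule has_field_derivative_zero_constant)
    show "convex U" by (simp add: U_def)
    fix a assume a: "a \<in> U"
    have "((\<lambda>a. Re (g (of_real a))) has_real_derivative Re (h (of_real a))) (at a)"
      by (intro has_field_derivative_Re has_vector_derivative_real_field gat cb a)
    moreover have "Re (h (of_real a)) = 2 * (rr a - a) / t"
      by (simp add: h_def rC[OF a])
    ultimately have "((\<lambda>a. fpot a - Re (g (of_real a))) has_real_derivative 0) (at a)"
      using DERIV_diff[OF fd[OF a], of "\<lambda>a. Re (g (of_real a))" "2 * (rr a - a) / t"] by simp
    then show "((\<lambda>a. fpot a - Re (g (of_real a))) has_real_derivative 0) (at a within U)"
      by (rule has_field_derivative_at_within)
  qed
  then obtain k where "\<forall>a\<in>U. fpot a - Re (g (of_real a)) = k" by blast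
  then have k: "fpot a = Re (g (of_real a)) + k" if "a \<in> U" for a using that by (simp add: diff_eq_eq)
  define G where "G \<alpha> = g \<alpha> + of_real k" for \<alpha>
  have Gh: "G holomorphic_on ball (of_real a0) \<delta>" unfolding G_def by (intro holomorphic_intros gh)
  define C where "C n = (deriv ^^ n) G (of_real a0) / fact n" for n
  have Gs: "(\<lambda>n. C n * (w - of_real a0) ^ n) sums G w" if "w \<in> ball (of_real a0) \<delta>" for w
    unfolding C_def by (rule holomorphic_power_series[OF Gh that])
  have series: "((\<lambda>n. Re (C n) * (a - a0) ^ n) has_sum fpot a) UNIV" if a: "a \<in> U" for a
  proof -
    have sums: "(\<lambda>n. C n * (of_real (a - a0)) ^ n) sums G (of_real a)"
      using Gs[OF cb[OF a]] by simp
    \<comment> \<open>A point strictly between the given one and the circle of convergence: it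
      yields absolute convergence, as \<open>has_sum\<close> is unconditional.\<close>
    define x where "x = complex_of_real ((\<bar>a - a0\<bar> + \<delta>) / 2)"
    have "\<bar>a - a0\<bar> < \<delta>" using a U by simp
    then have x: "norm (complex_of_real (a - a0)) < norm x" "norm x < \<delta>"
      unfolding x_def norm_of_real by auto
    have "(\<lambda>n. C n * x ^ n) sums G (of_real a0 + x)"
      using Gs[of "of_real a0 + x"] x by (simp add: dist_norm)
    then have S: "summable (\<lambda>n. norm (C n * (of_real (a - a0)) ^ n))"
      by (intro powser_insidea[OF _ x(1)]) (rule sums_summable)
    have bnd: "norm (Re (C n) * (a - a0) ^ n) \<le> norm (C n * (of_real (a - a0)) ^ n)" for n
      unfolding norm_mult norm_power norm_of_real by (intro mult_mono) (auto simp: abs_Re_le_cmod)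
    have "summable (\<lambda>n. norm (Re (C n) * (a - a0) ^ n))"
      by (rule summable_comparison_test'[OF S, of 0]) (use bnd in \<open>simp only: real_norm_def abs_idempotent\<close>)
    moreover have "(\<lambda>n. Re (C n) * (a - a0) ^ n) sums fpot a"
    proof -
      have "Re (C n * of_real (a - a0) ^ n) = Re (C n) * (a - a0) ^ n" for n
        unfolding of_real_power[symmetric] by simp
      then show ?thesis using sums_Re[OF sums] k[OF a] by (simp add: G_def)
    qed
    ultimately show ?thesis by (rule norm_summable_imp_has_sum)
  qed
  show ?thesis
  proof (rule that[of \<delta> rr "\<lambda>n. Re (C n)"])
    fix a assume "\<bar>a - a0\<bar> < \<delta>"
    then have a: "a \<in> U" by (simp add: U)
    show "v_fun \<mu> t a > 0 \<and> isCont (v_fun \<mu> t) a" using v[OF a] y0[OF a] vcont[OF a] by simp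
    show "(fpot has_real_derivative 2 * (rr a - a) / t) (at a)" by (rule fd[OF a])
    show "(\<integral>x. x / ((a - x)\<^sup>2 + (v_fun \<mu> t a)\<^sup>2) \<partial>\<mu>) = (2 * a - rr a) / t" by (rule q[OF a])
    show "rr field_differentiable (at a)" by (rule rd[OF a])
    show "((\<lambda>n. Re (C n) * (a - a0) ^ n) has_sum fpot a) UNIV" by (rule series[OF a])
  qed (rule \<delta>)
qed

end

section \<open>Analyticity and Laplacian of the limit\<close>

theorem theorem3p8:
  fixes sm :: "complex \<Rightarrow> 'a::ring_1 \<Rightarrow> 'a" and st :: "'a \<Rightarrow> 'a" and tau :: "'a \<Rightarrow> complex"
    and x0 :: 'a and c :: "real \<Rightarrow> 'a" and \<mu> :: "real measure" and t :: real and lam :: complex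
  assumes alg: "star_prob_space sm st tau"
    and sa: "st x0 = x0"
    and mu_prob: "prob_space \<mu>" and mu_sets: "sets \<mu> = sets borel"
    and mu_cpt: "\<exists>K. compact K \<and> measure \<mu> K = 1"
    and mu_dist: "\<forall>n. tau (x0 ^ n) = complex_of_real (\<integral>x. x ^ n \<partial>\<mu>)"
    and bm: "free_circ_BM_free_from sm st tau c x0"
    and t_pos: "t > 0"
    and lam_in: "lam \<in> Lambda_set \<mu> t"
  shows "((\<lambda>eps. S_fun sm st tau x0 c t lam eps) \<longlongrightarrow>
            (\<integral>x. ln ((Re lam - x)\<^sup>2 + (v_fun \<mu> t (Re lam))\<^sup>2) \<partial>\<mu>)
              - ((v_fun \<mu> t (Re lam))\<^sup>2 - (Im lam)\<^sup>2) / t) (at_right 0)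
       \<and> real_analytic_on (\<lambda>z. Lim (at_right 0) (S_fun sm st tau x0 c t z)) (Lambda_set \<mu> t)
       \<and> laplacian (\<lambda>z. Lim (at_right 0) (S_fun sm st tau x0 c t z)) lam
           = 4 / t * (1 - t / 2 * deriv (\<lambda>a. \<integral>x. x / ((a - x)\<^sup>2 + (v_fun \<mu> t a)\<^sup>2) \<partial>\<mu>) (Re lam))"
proof -
  interpret star_prob sm st tau by unfold_locales (rule alg)
  interpret \<mu>: prob_space \<mu> by (rule mu_prob)
  obtain K where K: "compact K" "measure \<mu> K = 1" using mu_cpt by blast
  obtain B where B: "\<And>x. x \<in> K \<Longrightarrow> \<bar>x\<bar> \<le> B"
    using compact_imp_bounded[OF K(1)] unfolding bounded_iff by auto
  have "AE x in \<mu>. x \<in> K"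
    using K by (subst (asm) \<mu>.prob_eq_1) (auto simp: mu_sets intro: borel_compact)
  then have cm: "compact_measure \<mu> B t"
    by (intro compact_measure.intro compact_measure_axioms.intro mu_prob mu_sets t_pos)
      (auto elim!: eventually_mono intro: B)
  interpret compact_measure \<mu> B t by (rule cm)
  define \<Lambda> where "\<Lambda> = Lambda_set \<mu> t"
  define \<Phi> where "\<Phi> z = Lim (at_right 0) (S_fun sm st tau x0 c t z)" for z
  have lim: "((\<lambda>eps. S_fun sm st tau x0 c t z eps) \<longlongrightarrow>
            (\<integral>x. ln ((Re z - x)\<^sup>2 + (v_fun \<mu> t (Re z))\<^sup>2) \<partial>\<mu>)
              - ((v_fun \<mu> t (Re z))\<^sup>2 - (Im z)\<^sup>2) / t) (at_right 0)" if "z \<in> \<Lambda>" for z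
    by (rule log_limit[OF sa cm mu_dist bm]) (use that in \<open>simp add: \<Lambda>_def\<close>)
  have \<Phi>: "\<Phi> z = fpot (Re z) + (Im z)\<^sup>2 / t" if "z \<in> \<Lambda>" for z
  proof -
    have "\<Phi> z = (\<integral>x. ln ((Re z - x)\<^sup>2 + (v_fun \<mu> t (Re z))\<^sup>2) \<partial>\<mu>)
              - ((v_fun \<mu> t (Re z))\<^sup>2 - (Im z)\<^sup>2) / t"
      unfolding \<Phi>_def by (rule tendsto_Lim[OF trivial_limit_at_right_real lim[OF that]])
    then show ?thesis by (simp add: fpot_def diff_divide_distrib)
  qed
  have v_pos: "v_fun \<mu> t (Re z) > 0" if "z \<in> \<Lambda>" for z
    using that by (simp add: \<Lambda>_def Lambda_set_def)
  \<comment> \<open>Openness of \<Lambda>, from continuity of \<open>v_fun\<close> where it is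
    positive. It is needed to differentiate the limit, whose formula is known on \<Lambda>
    only.\<close>
  have nbhd: "\<forall>\<^sub>F w in nhds z. w \<in> \<Lambda>" if z: "z \<in> \<Lambda>" for z
  proof -
    obtain \<delta> where \<delta>: "\<delta> > 0" "\<And>a. \<bar>a - Re z\<bar> < \<delta> \<Longrightarrow> isCont (v_fun \<mu> t) a"
      using fpot_local[OF v_pos[OF z]] by metis
    have "isCont (v_fun \<mu> t) (Re z)" using \<delta> by simp
    then have "(v_fun \<mu> t \<longlongrightarrow> v_fun \<mu> t (Re z)) (nhds (Re z))"
      unfolding isCont_def by (simp only: tendsto_at_iff_tendsto_nhds)
    moreover have "(Re \<longlongrightarrow> Re z) (nhds z)" by (intro tendsto_Re filterlim_ident)
    ultimately have "((\<lambda>w. v_fun \<mu> t (Re w)) \<longlongrightarrow> v_fun \<mu> t (Re z)) (nhds z)" by (rule filterlim_compose)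
    moreover have "((\<lambda>w. \<bar>Im w\<bar>) \<longlongrightarrow> \<bar>Im z\<bar>) (nhds z)" by (intro tendsto_rabs tendsto_Im filterlim_ident)
    ultimately have "((\<lambda>w. v_fun \<mu> t (Re w) - \<bar>Im w\<bar>) \<longlongrightarrow> v_fun \<mu> t (Re z) - \<bar>Im z\<bar>) (nhds z)"
      by (rule tendsto_diff)
    then have "\<forall>\<^sub>F w in nhds z. v_fun \<mu> t (Re w) - \<bar>Im w\<bar> > 0"
      by (rule order_tendstoD) (use z in \<open>simp add: \<Lambda>_def Lambda_set_def\<close>)
    then show ?thesis by eventually_elim (simp add: \<Lambda>_def Lambda_set_def)
  qed
  have analytic: "real_analytic_on \<Phi> \<Lambda>"
    unfolding real_analytic_on_def
  proof
    fix z assume z: "z \<in> \<Lambda>"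
    obtain \<delta> c where \<delta>: "\<delta> > 0"
      and ser: "\<And>a. \<bar>a - Re z\<bar> < \<delta> \<Longrightarrow> ((\<lambda>n. c n * (a - Re z) ^ n) has_sum fpot a) UNIV"
      using fpot_local[OF v_pos[OF z]] by metis
    obtain e where e: "e > 0" "\<And>w. dist w z < e \<Longrightarrow> w \<in> \<Lambda>"
      using nbhd[OF z] unfolding eventually_nhds_metric by blast
    \<comment> \<open>The series of \<open>fpot\<close> sits in the row k = 0, the expansion of (Im
      z + Y)^2 / t in the column j = 0. The factor \<open>of_bool\<close> annihilates list entries
      beyond the third.\<close>
    define d :: "nat \<Rightarrow> nat \<Rightarrow> real" where
      "d j k = (if k = 0 then c j else 0) + (if j = 0 then [(Im z)\<^sup>2 / t, 2 * Im z / t, 1 / t] ! k * of_bool (k < 3) else 0)" for j k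
    show "\<exists>r>0. \<exists>c. \<forall>w\<in>ball z r.
       ((\<lambda>(j, k). c j k * (Re w - Re z) ^ j * (Im w - Im z) ^ k) has_sum \<Phi> w) UNIV"
    proof (intro exI[of _ "min \<delta> e"] exI[of _ d] conjI ballI)
      show "min \<delta> e > 0" using \<delta> e by simp
      fix w assume w: "w \<in> ball z (min \<delta> e)"
      have "\<bar>Re (w - z)\<bar> \<le> norm (w - z)" by (rule abs_Re_le_cmod)
      then have re: "\<bar>Re w - Re z\<bar> < \<delta>" using w by (simp add: dist_norm norm_minus_commute)
      have wL: "w \<in> \<Lambda>" using w by (intro e) (simp add: dist_commute)
      define X Y where "X = Re w - Re z" and "Y = Im w - Im z"
      define p where "p = (\<lambda>(j, k). (if k = 0 then c j else 0) * X ^ j * Y ^ (k::nat))"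
      define q where "q = (\<lambda>(j::nat, k). (if j = 0 then [(Im z)\<^sup>2 / t, 2 * Im z / t, 1 / t] ! k * of_bool (k < 3) else 0) * X ^ j * Y ^ k)"
      have "(p has_sum fpot (Re w)) (range (\<lambda>n. (n, 0)))"
        using ser[OF re] by (subst has_sum_reindex) (auto simp: inj_on_def comp_def p_def X_def)
      then have 1: "(p has_sum fpot (Re w)) UNIV"
        by (rule has_sum_cong_neutral[where T = UNIV and f = p and g = p, THEN iffD1, rotated 3])
          (auto simp: p_def image_iff)
      have sq: "sum q ({0} \<times> {..<3}) = (Im w)\<^sup>2 / t"
      proof -
        have "({0} \<times> {..<3} :: (nat \<times> nat) set) = Pair 0 ` {..<3}" by auto
        then have "sum q ({0} \<times> {..<3}) = (\<Sum>k<3. q (0, k))"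
          by (simp add: sum.reindex inj_on_def)
        also have "\<dots> = (Im z)\<^sup>2 / t + 2 * Im z / t * Y + 1 / t * Y\<^sup>2"
          by (simp add: q_def numeral_3_eq_3 power2_eq_square)
        also have "\<dots> = (Im z + Y)\<^sup>2 / t" by (simp add: power2_sum add_divide_distrib)
        finally show ?thesis by (simp add: Y_def)
      qed
      have "(q has_sum sum q ({0} \<times> {..<3})) ({0} \<times> {..<3})" by (rule has_sum_finite) simp
      then have 2: "(q has_sum (Im w)\<^sup>2 / t) UNIV"
        unfolding sq
        by (rule has_sum_cong_neutral[where T = UNIV and f = q and g = q, THEN iffD1, rotated 3])
          (auto simp: q_def split: if_splits)
      have "((\<lambda>jk. p jk + q jk) has_sum (fpot (Re w) + (Im w)\<^sup>2 / t)) UNIV" by (rule has_sum_add[OF 1 2])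
      also have "(\<lambda>jk. p jk + q jk) = (\<lambda>(j, k). d j k * (Re w - Re z) ^ j * (Im w - Im z) ^ k)"
        by (auto simp: fun_eq_iff p_def q_def d_def X_def Y_def distrib_right)
      finally show "((\<lambda>(j, k). d j k * (Re w - Re z) ^ j * (Im w - Im z) ^ k) has_sum \<Phi> w) UNIV"
        unfolding \<Phi>[OF wL] .
    qed
  qed
  define a0 b0 where "a0 = Re lam" and "b0 = Im lam"
  have lam: "lam \<in> \<Lambda>" using lam_in by (simp add: \<Lambda>_def)
  obtain \<delta> r where \<delta>: "\<delta> > 0"
    and fd: "\<And>a. \<bar>a - a0\<bar> < \<delta> \<Longrightarrow> (fpot has_real_derivative 2 * (r a - a) / t) (at a)"
    and q: "\<And>a. \<bar>a - a0\<bar> < \<delta> \<Longrightarrow> (\<integral>x. x / ((a - x)\<^sup>2 + (v_fun \<mu> t a)\<^sup>2) \<partial>\<mu>) = (2 * a - r a) / t"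
    and rd: "\<And>a. \<bar>a - a0\<bar> < \<delta> \<Longrightarrow> (r::real \<Rightarrow> real) field_differentiable (at a)"
  proof (rule fpot_local[OF v_pos[OF lam], folded a0_def])
    fix \<delta> r c
    assume "\<delta> > 0"
      "\<And>a. \<bar>a - a0\<bar> < \<delta> \<Longrightarrow> (fpot has_real_derivative 2 * (r a - a) / t) (at a)"
      "\<And>a. \<bar>a - a0\<bar> < \<delta> \<Longrightarrow> (\<integral>x. x / ((a - x)\<^sup>2 + (v_fun \<mu> t a)\<^sup>2) \<partial>\<mu>) = (2 * a - r a) / t"
      "\<And>a. \<bar>a - a0\<bar> < \<delta> \<Longrightarrow> (r::real \<Rightarrow> real) field_differentiable (at a)"
    then show ?thesis by (rule that)
  qed
  have near: "\<forall>\<^sub>F a in nhds a0. \<bar>a - a0\<bar> < \<delta>"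
    unfolding eventually_nhds_metric using \<delta> by (auto simp: dist_real_def)
  obtain r' where r': "(r has_real_derivative r') (at a0)"
    using rd[of a0] \<delta> by (auto simp: field_differentiable_def)
  have lam_eq: "Complex a0 b0 = lam" by (simp add: a0_def b0_def)
  have hor: "\<forall>\<^sub>F a in nhds a0. Complex a b0 \<in> \<Lambda>"
  proof -
    have "((\<lambda>a. Complex a b0) \<longlongrightarrow> lam) (nhds a0)"
      unfolding lam_eq[symmetric] by (intro tendsto_Complex filterlim_ident tendsto_const)
    then show ?thesis using nbhd[OF lam] by (rule eventually_compose_filterlim[rotated])
  qed
  have ver: "\<forall>\<^sub>F b in nhds b0. Complex a0 b \<in> \<Lambda>"
  proof -
    have "((\<lambda>b. Complex a0 b) \<longlongrightarrow> lam) (nhds b0)"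
      unfolding lam_eq[symmetric] by (intro tendsto_Complex filterlim_ident tendsto_const)
    then show ?thesis using nbhd[OF lam] by (rule eventually_compose_filterlim[rotated])
  qed
  have "deriv (deriv (\<lambda>a. \<Phi> (Complex a b0))) a0 = 2 * (r' - 1) / t"
  proof -
    \<comment> \<open>The inner derivative has to be known on a neighbourhood of \<open>a0\<close>,
      hence the nested form.\<close>
    have "\<forall>\<^sub>F a in nhds a0. \<forall>\<^sub>F x in nhds a. Complex x b0 \<in> \<Lambda>"
      using hor by (simp add: eventually_eventually)
    with near have "\<forall>\<^sub>F a in nhds a0. deriv (\<lambda>a. \<Phi> (Complex a b0)) a = 2 * (r a - a) / t"
    proof eventually_elim
      case (elim a)
      have "\<forall>\<^sub>F x in nhds a. \<Phi> (Complex x b0) = fpot x + b0\<^sup>2 / t"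
        using elim(2) by eventually_elim (simp add: \<Phi>)
      then have "deriv (\<lambda>a. \<Phi> (Complex a b0)) a = deriv (\<lambda>x. fpot x + b0\<^sup>2 / t) a" by (rule deriv_cong_ev[OF _ refl])
      also have "\<dots> = 2 * (r a - a) / t"
        by (rule DERIV_imp_deriv) (auto intro!: derivative_eq_intros fd elim)
      finally show ?case .
    qed
    then have "deriv (deriv (\<lambda>a. \<Phi> (Complex a b0))) a0 = deriv (\<lambda>a. 2 * (r a - a) / t) a0"
      by (rule deriv_cong_ev[OF _ refl])
    also have "\<dots> = 2 * (r' - 1) / t"
      by (rule DERIV_imp_deriv) (use t_pos in \<open>auto intro!: derivative_eq_intros r'\<close>)
    finally show ?thesis .
  qed
  moreover have "deriv (deriv (\<lambda>b. \<Phi> (Complex a0 b))) b0 = 2 / t"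
  proof -
    have "\<forall>\<^sub>F b in nhds b0. \<forall>\<^sub>F x in nhds b. Complex a0 x \<in> \<Lambda>"
      using ver by (simp add: eventually_eventually)
    then have "\<forall>\<^sub>F b in nhds b0. deriv (\<lambda>b. \<Phi> (Complex a0 b)) b = 2 * b / t"
    proof eventually_elim
      case (elim b)
      have "\<forall>\<^sub>F x in nhds b. \<Phi> (Complex a0 x) = fpot a0 + x\<^sup>2 / t"
        using elim by eventually_elim (simp add: \<Phi>)
      then have "deriv (\<lambda>b. \<Phi> (Complex a0 b)) b = deriv (\<lambda>x. fpot a0 + x\<^sup>2 / t) b" by (rule deriv_cong_ev[OF _ refl])
      also have "\<dots> = 2 * b / t"
        by (rule DERIV_imp_deriv) (use t_pos in \<open>auto intro!: derivative_eq_intros\<close>)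
      finally show ?case .
    qed
    then have "deriv (deriv (\<lambda>b. \<Phi> (Complex a0 b))) b0 = deriv (\<lambda>b. 2 * b / t) b0"
      by (rule deriv_cong_ev[OF _ refl])
    also have "\<dots> = 2 / t"
      by (rule DERIV_imp_deriv) (use t_pos in \<open>auto intro!: derivative_eq_intros\<close>)
    finally show ?thesis .
  qed
  moreover have "deriv (\<lambda>a. \<integral>x. x / ((a - x)\<^sup>2 + (v_fun \<mu> t a)\<^sup>2) \<partial>\<mu>) a0 = (2 - r') / t"
  proof -
    have "\<forall>\<^sub>F a in nhds a0. (\<integral>x. x / ((a - x)\<^sup>2 + (v_fun \<mu> t a)\<^sup>2) \<partial>\<mu>) = (2 * a - r a) / t"
      using near by eventually_elim (rule q)
    then have "deriv (\<lambda>a. \<integral>x. x / ((a - x)\<^sup>2 + (v_fun \<mu> t a)\<^sup>2) \<partial>\<mu>) a0 = deriv (\<lambda>a. (2 * a - r a) / t) a0"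
      by (rule deriv_cong_ev[OF _ refl])
    also have "\<dots> = (2 - r') / t"
      by (rule DERIV_imp_deriv) (use t_pos in \<open>auto intro!: derivative_eq_intros r'\<close>)
    finally show ?thesis .
  qed
  \<comment> \<open>Both sides are 2 r' / t.\<close>
  ultimately have lap: "laplacian \<Phi> lam
      = 4 / t * (1 - t / 2 * deriv (\<lambda>a. \<integral>x. x / ((a - x)\<^sup>2 + (v_fun \<mu> t a)\<^sup>2) \<partial>\<mu>) (Re lam))"
    unfolding laplacian_def a0_def b0_def using t_pos by (simp add: field_simps)
  show ?thesis
    using lim[OF lam] analytic lap unfolding \<Phi>_def \<Lambda>_def by blast
qed

end
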